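(* Let $H$ be a real separable Hilbert space and $Y$ a real or complex separable Hilbert space. Suppose that $-A$ generates a $C_0$-contraction semigroup $(S(t))_{t\ge0}$ on $Y$, let $F:Y\to Y$ and $G:Y\to\mathcal{L}_2(H,Y)$ be Borel measurable, and suppose that for some $q\in[2,\infty)$ and $\varepsilon>0$ there is $C_{q+\varepsilon}\ge0$ such that for all $x\in Y$ $$\mathrm{Re}\,\langle x,F(x)\rangle_Y+\frac{q+\varepsilon-1}{2}\|G(x)\|_{\mathcal{L}_2(H,Y)}^2\le C_{q+\varepsilon}(1+\|x\|_Y^2).$$ Let $\theta\in(0,\frac14]$ and $u_0\in L^q_{\mathcal{F}_0}(\Omega;Y)$. Then the nonlinearities-stopped exponential Euler scheme with parameter $\theta$ is pathwise uniformly stable in $Y$. That is, for every $T>0$ there exists a constant $C_{T,q,\varepsilon}\ge0$, independent of $k$, $N$, and $\theta$, such that $$\Big\|\sup_{t\in[0,T]}\|\hat U(t)\|_Y\Big\|_{L^q(\Omega)}\le C_{T,q,\varepsilon}\big(1+\|u_0\|_{L^q(\Omega;Y)}\big).$$ In particular, the same bound holds for $\big\|\max_{j=0,\ldots,N}\|U^j\|_Y\big\|_{L^q(\Omega)}$ and $\big\|\sup_{t\in[0,T]}\|U^k(t)\|_Y\big\|_{L^q(\Omega)}$.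
   Context: $(\Omega,\mathcal{F},(\mathcal{F}_t)_{t\in[0,T]},\mathbb{P})$ is a filtered probability space satisfying the usual conditions. $W_H$ is an $H$-cylindrical Brownian motion adapted to $(\mathcal{F}_t)$: a mapping $W_H:L^2(0,T;H)\to L^2(\Omega)$ such that $W_Hb$ is Gaussian, $\mathbb{E}(W_Hb_1\,W_Hb_2)=\langle b_1,b_2\rangle_{L^2(0,T;H)}$, $W_Hb$ is $\mathcal{F}_t$-measurable if $b$ is supported in $[0,t]$ and independent of $\mathcal{F}_s$ if $b$ is supported in $[s,T]$; $W_H(t)h:=W_H(\mathbf{1}_{(0,t)}\otimes h)$. $\mathcal{L}_2(H,Y)$ denotes the Hilbert--Schmidt operators from $H$ to $Y$. $L^q_{\mathcal{F}_0}(\Omega;Y)$ denotes the $\mathcal{F}_0$-measurable elements of $L^q(\Omega;Y)$. Scheme: for $N\in\mathbb{N}$ let $k=T/N$ and $t_j=jk$, $0\le j\le N$. Set $U^0=u_0$ and, for $0\le j\le N-1$, $$U^{j+1}=S(k)U^j+kS(k)\mathbf{1}_{\theta,j}F(U^j)+S(k)\mathbf{1}_{\theta,j}G(U^j)\Delta W_{j+1},$$ where $\mathbf{1}_{\theta,j}=\mathbf{1}_{\{\|F(U^j)\|_Y+\|G(U^j)\|_{\mathcal{L}_2(H,Y)}\le k^{-\theta}\}}$ and, for an orthonormal basis $(h_n)_n$ of $H$, $R\,\Delta W_{j+1}:=\sum_n(W_H(t_{j+1})h_n-W_H(t_j)h_n)Rh_n$. Piecewise constant extension: $U^k(s)=U^j$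 for $s\in[t_j,t_{j+1})$, $0\le j\le N-1$, $U^k(T)=U^N$. Continuous extension: $\hat U(T)=U^N$ and, for $t\in[t_j,t_{j+1})$, $0\le j\le N-1$, $$\hat U(t)=S(t-t_j)\Big[U^j+(t-t_j)\mathbf{1}_{\theta,j}F(U^j)+\int_{t_j}^t\mathbf{1}_{\theta,j}G(U^j)\,\mathrm{d}W_H(s)\Big].$$ *)

theory Defs
  imports "HOL-Probability.Probability"
begin

section \<open>Hilbert spaces\<close>

text \<open>
  A Hilbert space over the reals (\<open>K = \<real>\<close>) or over the complex numbers (\<open>K = UNIV\<close>). The
  additive group, the norm and the real multiplication are those of the type; the scalar
  multiplication \<open>sc\<close> (used for scalars in \<open>K\<close> only) and the \<open>K\<close>-valued inner product \<open>ip\<close>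
  are compatible with them. In the complex case \<open>\<bullet>\<close> is the real part of the inner product, which
  induces the same norm; separability and completeness are type class assumptions.
\<close>

definition hilbert_over ::
  "complex set \<Rightarrow> (complex \<Rightarrow> 'y \<Rightarrow> 'y) \<Rightarrow> ('y::real_inner \<Rightarrow> 'y \<Rightarrow> complex) \<Rightarrow> bool" where
  "hilbert_over K sc ip \<longleftrightarrow>
     (K = \<real> \<or> K = UNIV) \<and>
     (\<forall>r x. sc (of_real r) x = r *\<^sub>R x) \<and>
     (\<forall>a\<in>K. \<forall>b\<in>K. \<forall>x. sc (a + b) x = sc a x + sc b x \<and> sc (a * b) x = sc a (sc b x)) \<and>
     (\<forall>a\<in>K. \<forall>x y. sc a (x + y) = sc a x + sc a y) \<and>
     (\<forall>x y. ip x y \<in> K \<and> ip y x = cnj (ip x y) \<and> Re (ip x y) = x \<bullet> y) \<and>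
     (\<forall>x y z. ip (x + y) z = ip x z + ip y z) \<and>
     (\<forall>a\<in>K. \<forall>x y. ip (sc a x) y = a * ip x y)"

lemma hilbert_over_real:
  "hilbert_over \<real> (\<lambda>a x. Re a *\<^sub>R x) (\<lambda>x y. complex_of_real (x \<bullet> y))"
  by (auto simp: hilbert_over_def inner_commute inner_add_left inner_add_right scaleR_add_left scaleR_add_right
      elim!: Reals_cases)

text \<open>The index set \<open>I\<close> also accommodates finite-dimensional spaces.\<close>

definition orthonormal_basis :: "nat set \<Rightarrow> (nat \<Rightarrow> 'h::real_inner) \<Rightarrow> bool" where
  "orthonormal_basis I h \<longleftrightarrow>
     (\<forall>m\<in>I. \<forall>n\<in>I. h m \<bullet> h n = (if m = n then 1 else 0)) \<and> closure (span (h ` I)) = UNIV"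

text \<open>
  Hilbert--Schmidt operators and their norm, computed with respect to an orthonormal basis
  \<open>(h n)\<close>, \<open>n \<in> I\<close>; neither depends on the choice of that basis.
\<close>

definition hs_ops :: "nat set \<Rightarrow> (nat \<Rightarrow> 'h::real_inner) \<Rightarrow> ('h \<Rightarrow> 'y::real_inner) set" where
  "hs_ops I h = {R. bounded_linear R \<and> (\<lambda>n. (norm (R (h n)))\<^sup>2) summable_on I}"

definition hs_norm :: "nat set \<Rightarrow> (nat \<Rightarrow> 'h::real_inner) \<Rightarrow> ('h \<Rightarrow> 'y::real_inner) \<Rightarrow> real" where
  "hs_norm I h R = sqrt (\<Sum>\<^sub>\<infinity>n\<in>I. (norm (R (h n)))\<^sup>2)"

text \<open>The Borel sigma-algebra of the Hilbert--Schmidt norm.\<close>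

definition hs_borel :: "nat set \<Rightarrow> (nat \<Rightarrow> 'h::real_inner) \<Rightarrow> ('h \<Rightarrow> 'y::real_inner) measure" where
  "hs_borel I h = sigma (hs_ops I h)
     {V. V \<subseteq> hs_ops I h \<and>
         (\<forall>R\<in>V. \<exists>e>0. \<forall>R'\<in>hs_ops I h. hs_norm I h (\<lambda>u. R' u - R u) < e \<longrightarrow> R' \<in> V)}"


section \<open>Contraction semigroups\<close>

definition c0_contraction_semigroup ::
  "complex set \<Rightarrow> (complex \<Rightarrow> 'y \<Rightarrow> 'y) \<Rightarrow> (real \<Rightarrow> 'y::real_inner \<Rightarrow> 'y) \<Rightarrow> bool" where
  "c0_contraction_semigroup K sc S \<longleftrightarrow>
     (\<forall>t\<ge>0. bounded_linear (S t) \<and> (\<forall>a\<in>K. \<forall>x. S t (sc a x) = sc a (S t x)) \<and>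
             (\<forall>x. norm (S t x) \<le> norm x)) \<and>
     (\<forall>x. S 0 x = x) \<and>
     (\<forall>s\<ge>0. \<forall>t\<ge>0. \<forall>x. S (s + t) x = S s (S t x)) \<and>
     (\<forall>x. continuous_on {0..} (\<lambda>t. S t x))"

text \<open>The operator \<open>B\<close> with domain \<open>D\<close> is the infinitesimal generator of \<open>S\<close>.\<close>

definition generates :: "'y set \<Rightarrow> ('y \<Rightarrow> 'y) \<Rightarrow> (real \<Rightarrow> 'y::real_normed_vector \<Rightarrow> 'y) \<Rightarrow> bool" where
  "generates D B S \<longleftrightarrow>
     D = {x. \<exists>y. ((\<lambda>t. (S t x - x) /\<^sub>R t) \<longlongrightarrow> y) (at_right 0)} \<and>
     (\<forall>x\<in>D. ((\<lambda>t. (S t x - x) /\<^sub>R t) \<longlongrightarrow> B x) (at_right 0))"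


section \<open>Moments\<close>

definition ennreal_powr :: "ennreal \<Rightarrow> real \<Rightarrow> ennreal" where
  "ennreal_powr x p = (if x = \<infinity> then \<infinity> else ennreal (enn2real x powr p))"

text \<open>
  The \<open>L\<^sup>q\<close> norm of a nonnegative extended random variable. It is infinite for non-measurable
  functions, so a finite bound includes measurability.
\<close>

definition Lq_norm :: "'w measure \<Rightarrow> real \<Rightarrow> ('w \<Rightarrow> ennreal) \<Rightarrow> ennreal" where
  "Lq_norm M q Z =
     (if Z \<in> borel_measurable M
      then ennreal_powr (\<integral>\<^sup>+\<omega>. ennreal_powr (Z \<omega>) q \<partial>M) (1 / q) else \<infinity>)"


section \<open>Cylindrical Brownian motion and the stochastic integral\<close>

definition usual_filtration :: "'w measure \<Rightarrow> real \<Rightarrow> (real \<Rightarrow> 'w measure) \<Rightarrow> bool" where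
  "usual_filtration M T FF \<longleftrightarrow>
     complete_measure M \<and> null_sets M \<subseteq> sets (FF 0) \<and>
     (\<forall>t\<in>{0..T}. subalgebra M (FF t)) \<and>
     (\<forall>s\<in>{0..T}. \<forall>t\<in>{s..T}. sets (FF s) \<subseteq> sets (FF t)) \<and>
     (\<forall>t\<in>{0..<T}. sets (FF t) = (\<Inter>s\<in>{t<..T}. sets (FF s)))"

text \<open>Real Gaussian random variables, including the degenerate (almost surely constant) ones.\<close>

definition gaussian :: "'w measure \<Rightarrow> ('w \<Rightarrow> real) \<Rightarrow> bool" where
  "gaussian M X \<longleftrightarrow> X \<in> borel_measurable M \<and>
     ((\<exists>m. AE \<omega> in M. X \<omega> = m) \<or>
      (\<exists>m \<sigma>. \<sigma> > 0 \<and> distributed M lborel X (normal_density m \<sigma>)))"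

abbreviation time_measure :: "real \<Rightarrow> real measure" where
  "time_measure T \<equiv> restrict_space lborel {0<..<T}"

text \<open>
  Elements of \<open>L\<^sup>2(0,T;H)\<close> are represented by functions, so \<open>W\<close> below acts on representatives.
  Its covariance condition makes \<open>W b\<close> almost surely independent of the representative (and
  linear in \<open>b\<close>).
\<close>

definition L2_time :: "real \<Rightarrow> (real \<Rightarrow> 'h::{real_inner,banach,second_countable_topology}) set" where
  "L2_time T = {b. b \<in> borel_measurable (time_measure T) \<and>
                   integrable (time_measure T) (\<lambda>t. (norm (b t))\<^sup>2)}"

definition supported_in :: "real \<Rightarrow> real set \<Rightarrow> (real \<Rightarrow> 'h::real_vector) \<Rightarrow> bool" where
  "supported_in T J b \<longleftrightarrow> (AE s in time_measure T. s \<notin> J \<longrightarrow> b s = 0)"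

definition cylindrical_BM ::
  "'w measure \<Rightarrow> real \<Rightarrow> (real \<Rightarrow> 'w measure) \<Rightarrow>
   ((real \<Rightarrow> 'h::{real_inner,banach,second_countable_topology}) \<Rightarrow> 'w \<Rightarrow> real) \<Rightarrow> bool" where
  "cylindrical_BM M T FF W \<longleftrightarrow>
     (\<forall>b\<in>L2_time T. gaussian M (W b)) \<and>
     (\<forall>b1\<in>L2_time T. \<forall>b2\<in>L2_time T.
        (\<integral>\<omega>. W b1 \<omega> * W b2 \<omega> \<partial>M) = (\<integral>t. b1 t \<bullet> b2 t \<partial>time_measure T)) \<and>
     (\<forall>b\<in>L2_time T. \<forall>t\<in>{0..T}.
        supported_in T {0..t} b \<longrightarrow> W b \<in> borel_measurable (FF t)) \<and>
     (\<forall>b\<in>L2_time T. \<forall>s\<in>{0..T}.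
        supported_in T {s..T} b \<longrightarrow>
        prob_space.indep_set M (sets (vimage_algebra (space M) (W b) borel)) (sets (FF s)))"

definition BM_at :: "((real \<Rightarrow> 'h::real_vector) \<Rightarrow> 'w \<Rightarrow> real) \<Rightarrow> real \<Rightarrow> 'h \<Rightarrow> 'w \<Rightarrow> real" where
  "BM_at W t u = W (\<lambda>s. indicator {0<..<t} s *\<^sub>R u)"

text \<open>
  A list of tuples \<open>(r, s, A, v, x)\<close> stands for the finite-rank adapted step process
  \<open>\<Sum> 1_{(r,s] \<times> A} \<langle>\<cdot>,v\<rangle> x\<close>.
\<close>

type_synonym ('w, 'h, 'y) step_process = "(real \<times> real \<times> 'w set \<times> 'h \<times> 'y) list"

definition adapted_step ::
  "(real \<Rightarrow> 'w measure) \<Rightarrow> real \<Rightarrow> real \<Rightarrow> ('w, 'h, 'y) step_process \<Rightarrow> bool" where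
  "adapted_step FF a b es \<longleftrightarrow>
     (\<forall>(r, s, A, v, x)\<in>set es. a \<le> r \<and> r \<le> s \<and> s \<le> b \<and> A \<in> sets (FF r))"

definition step_value ::
  "('w, 'h::real_inner, 'y::real_vector) step_process \<Rightarrow> real \<Rightarrow> 'w \<Rightarrow> 'h \<Rightarrow> 'y" where
  "step_value es t \<omega> u =
     (\<Sum>(r, s, A, v, x)\<leftarrow>es. (indicator {r<..s} t * indicator A \<omega> * (u \<bullet> v)) *\<^sub>R x)"

definition step_integral ::
  "((real \<Rightarrow> 'h::real_inner) \<Rightarrow> 'w \<Rightarrow> real) \<Rightarrow> ('w, 'h, 'y::real_vector) step_process \<Rightarrow>
   real \<Rightarrow> 'w \<Rightarrow> 'y" where
  "step_integral W es t \<omega> =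
     (\<Sum>(r, s, A, v, x)\<leftarrow>es.
        (indicator A \<omega> * (BM_at W (min s t) v \<omega> - BM_at W (min r t) v \<omega>)) *\<^sub>R x)"

text \<open>
  The process \<open>X\<close> is an adapted, almost surely continuous version of the Ito integral process
  \<open>t \<mapsto> \<integral>_a^t \<Phi>(s) dW(s)\<close>, \<open>t \<in> [a,b]\<close>: the integral is the \<open>L\<^sup>2\<close>-limit of integrals of adapted
  step processes that converge to \<open>\<Phi>\<close> in \<open>L\<^sup>2((a,b) \<times> \<Omega>; L\<^sub>2(H,Y))\<close>. This determines \<open>X\<close> on
  \<open>[a,b]\<close> up to indistinguishability.
\<close>

definition ito_integral ::
  "'w measure \<Rightarrow> (real \<Rightarrow> 'w measure) \<Rightarrow>
   ((real \<Rightarrow> 'h::{real_inner,banach,second_countable_topology}) \<Rightarrow> 'w \<Rightarrow> real) \<Rightarrow>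
   nat set \<Rightarrow> (nat \<Rightarrow> 'h) \<Rightarrow> real \<Rightarrow> real \<Rightarrow>
   (real \<Rightarrow> 'w \<Rightarrow> 'h \<Rightarrow> 'y::{real_inner,banach,second_countable_topology}) \<Rightarrow>
   (real \<Rightarrow> 'w \<Rightarrow> 'y) \<Rightarrow> bool" where
  "ito_integral M FF W I h a b \<Phi> X \<longleftrightarrow>
     (\<lambda>(t, \<omega>). \<Phi> t \<omega>) \<in> (restrict_space lborel {a..b} \<Otimes>\<^sub>M M) \<rightarrow>\<^sub>M hs_borel I h \<and>
     (\<forall>t\<in>{a..b}. X t \<in> borel_measurable (FF t)) \<and>
     (AE \<omega> in M. continuous_on {a..b} (\<lambda>t. X t \<omega>)) \<and>
     (\<exists>es :: nat \<Rightarrow> ('w, 'h, 'y) step_process.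
        (\<forall>n. adapted_step FF a b (es n)) \<and>
        (\<lambda>n. \<integral>\<^sup>+(t, \<omega>). ennreal ((hs_norm I h (\<lambda>u. \<Phi> t \<omega> u - step_value (es n) t \<omega> u))\<^sup>2)
               \<partial>(restrict_space lborel {a..b} \<Otimes>\<^sub>M M)) \<longlonglongrightarrow> 0 \<and>
        (\<forall>t\<in>{a..b}.
           (\<lambda>n. \<integral>\<^sup>+\<omega>. ennreal ((norm (X t \<omega> - step_integral W (es n) t \<omega>))\<^sup>2) \<partial>M) \<longlonglongrightarrow> 0))"

text \<open>
  \<open>Z = \<Sum>n (W(t) h\<^sub>n - W(s) h\<^sub>n) R h\<^sub>n\<close> for a random operator \<open>R\<close>, with convergence of the series
  in \<open>L\<^sup>2(\<Omega>; Y)\<close>.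
\<close>

definition noise_increment ::
  "'w measure \<Rightarrow> ((real \<Rightarrow> 'h::real_inner) \<Rightarrow> 'w \<Rightarrow> real) \<Rightarrow> nat set \<Rightarrow> (nat \<Rightarrow> 'h) \<Rightarrow>
   real \<Rightarrow> real \<Rightarrow> ('w \<Rightarrow> 'h \<Rightarrow> 'y::real_inner) \<Rightarrow> ('w \<Rightarrow> 'y) \<Rightarrow> bool" where
  "noise_increment M W I h s t R Z \<longleftrightarrow>
     Z \<in> borel_measurable M \<and>
     (\<lambda>m. \<integral>\<^sup>+\<omega>. ennreal ((norm (Z \<omega> -
            (\<Sum>n\<in>I \<inter> {..<m}. (BM_at W t (h n) \<omega> - BM_at W s (h n) \<omega>) *\<^sub>R R \<omega> (h n))))\<^sup>2) \<partial>M)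
       \<longlonglongrightarrow> 0"


section \<open>The scheme\<close>

definition grid :: "real \<Rightarrow> nat \<Rightarrow> nat \<Rightarrow> real" where
  "grid T N j = real j * (T / real N)"

definition stop_ind ::
  "nat set \<Rightarrow> (nat \<Rightarrow> 'h::real_inner) \<Rightarrow> ('y::real_inner \<Rightarrow> 'y) \<Rightarrow> ('y \<Rightarrow> 'h \<Rightarrow> 'y) \<Rightarrow>
   real \<Rightarrow> real \<Rightarrow> 'y \<Rightarrow> real" where
  "stop_ind I h F G k \<theta> x = (if norm (F x) + hs_norm I h (G x) \<le> k powr (- \<theta>) then 1 else 0)"

definition stopped_exponential_euler ::
  "'w measure \<Rightarrow> ((real \<Rightarrow> 'h::real_inner) \<Rightarrow> 'w \<Rightarrow> real) \<Rightarrow> nat set \<Rightarrow> (nat \<Rightarrow> 'h) \<Rightarrow>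
   (real \<Rightarrow> 'y::real_inner \<Rightarrow> 'y) \<Rightarrow> ('y \<Rightarrow> 'y) \<Rightarrow> ('y \<Rightarrow> 'h \<Rightarrow> 'y) \<Rightarrow> real \<Rightarrow> real \<Rightarrow> nat \<Rightarrow>
   ('w \<Rightarrow> 'y) \<Rightarrow> (nat \<Rightarrow> 'w \<Rightarrow> 'y) \<Rightarrow> bool" where
  "stopped_exponential_euler M W I h S F G \<theta> T N u0 U \<longleftrightarrow>
     (let k = T / real N; st = stop_ind I h F G k \<theta> in
      (\<forall>j\<le>N. U j \<in> borel_measurable M) \<and>
      (AE \<omega> in M. U 0 \<omega> = u0 \<omega>) \<and>
      (\<forall>j<N. \<exists>Z.
         noise_increment M W I h (grid T N j) (grid T N (Suc j))
           (\<lambda>\<omega> v. st (U j \<omega>) *\<^sub>R G (U j \<omega>) v) Z \<and>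
         (AE \<omega> in M.
            U (Suc j) \<omega> =
              S k (U j \<omega>) + k *\<^sub>R S k (st (U j \<omega>) *\<^sub>R F (U j \<omega>)) + S k (Z \<omega>))))"

definition piecewise_constant_extension ::
  "'w measure \<Rightarrow> real \<Rightarrow> nat \<Rightarrow> (nat \<Rightarrow> 'w \<Rightarrow> 'y) \<Rightarrow> (real \<Rightarrow> 'w \<Rightarrow> 'y) \<Rightarrow> bool" where
  "piecewise_constant_extension M T N U Uk \<longleftrightarrow>
     (\<forall>\<omega>\<in>space M. Uk T \<omega> = U N \<omega> \<and>
        (\<forall>j<N. \<forall>t\<in>{grid T N j..<grid T N (Suc j)}. Uk t \<omega> = U j \<omega>))"

definition continuous_extension ::
  "'w measure \<Rightarrow> (real \<Rightarrow> 'w measure) \<Rightarrow>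
   ((real \<Rightarrow> 'h::{real_inner,banach,second_countable_topology}) \<Rightarrow> 'w \<Rightarrow> real) \<Rightarrow>
   nat set \<Rightarrow> (nat \<Rightarrow> 'h) \<Rightarrow>
   (real \<Rightarrow> 'y::{real_inner,banach,second_countable_topology} \<Rightarrow> 'y) \<Rightarrow>
   ('y \<Rightarrow> 'y) \<Rightarrow> ('y \<Rightarrow> 'h \<Rightarrow> 'y) \<Rightarrow> real \<Rightarrow> real \<Rightarrow> nat \<Rightarrow>
   (nat \<Rightarrow> 'w \<Rightarrow> 'y) \<Rightarrow> (real \<Rightarrow> 'w \<Rightarrow> 'y) \<Rightarrow> bool" where
  "continuous_extension M FF W I h S F G \<theta> T N U Uhat \<longleftrightarrow>
     (let st = stop_ind I h F G (T / real N) \<theta> in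
      \<exists>X. (\<forall>j<N. ito_integral M FF W I h (grid T N j) (grid T N (Suc j))
                   (\<lambda>s \<omega> v. st (U j \<omega>) *\<^sub>R G (U j \<omega>) v) (X j)) \<and>
          (\<forall>\<omega>\<in>space M. Uhat T \<omega> = U N \<omega> \<and>
             (\<forall>j<N. \<forall>t\<in>{grid T N j..<grid T N (Suc j)}.
                Uhat t \<omega> = S (t - grid T N j)
                  (U j \<omega> + (t - grid T N j) *\<^sub>R (st (U j \<omega>) *\<^sub>R F (U j \<omega>)) + X j t \<omega>))))"

end

theory Submission
  imports Defs
begin

text \<open>
  Let \<open>r = q + \<epsilon>/2\<close>. On one step the coefficients are frozen, so the second order expansion of
  \<open>(1 + \<parallel>x\<parallel>\<^sup>2)\<^bsup>r/2\<^esup>\<close> along the increment \<open>k F + G \<Delta>W\<close> and the coercivity condition give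
  \<open>E[(1 + \<parallel>U\<^bsup>j+1\<^esup>\<parallel>\<^sup>2)\<^bsup>r/2\<^esup> | F\<^sub>j] \<le> (1 + c k) (1 + \<parallel>U\<^bsup>j\<^esup>\<parallel>\<^sup>2)\<^bsup>r/2\<^esup>\<close>: the stopping bounds
  \<open>\<parallel>F\<parallel>\<close> and \<open>\<parallel>G\<parallel>\<close> by \<open>k\<^bsup>-\<theta>\<^esup>\<close>, \<open>\<theta> \<le> 1/4\<close>, so \<open>k\<^sup>2 \<parallel>F\<parallel>\<^sup>2\<close> and all moments of \<open>G \<Delta>W\<close> of order at least
  four are \<open>O(k)\<close>. Contractivity of the semigroup removes \<open>S(k)\<close>. Hence \<open>(1 + c k)\<^bsup>-j\<^esup> (1 + \<parallel>U\<^bsup>j\<^esup>\<parallel>\<^sup>2)\<^bsup>r/2\<^esup>\<close> is a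
  nonnegative supermartingale, and the maximal inequality
  \<open>E (max Z\<^sub>j)\<^sup>p \<le> E Z\<^sub>0\<^sup>p / (1 - p)\<close> with \<open>p = q/r < 1\<close> bounds \<open>E max \<parallel>U\<^bsup>j\<^esup>\<parallel>\<^bsup>q\<^esup>\<close> without requiring moments of \<open>u\<^sub>0\<close>
  beyond \<open>q\<close>. Between grid points the scheme deviates from \<open>U\<^bsup>j\<^esup>\<close> by a bounded drift and the stochastic
  integral \<open>X\<^sub>j\<close>. Chaining bounds \<open>E sup \<parallel>X\<^sub>j\<parallel>\<^bsup>2m\<^esup>\<close> by \<open>O(k\<^sup>m k\<^bsup>-m/2\<^esup>) = O(k)\<close> for \<open>m \<ge> 2\<close>, so the sum over
  the \<open>T/k\<close> intervals, and with it the maximum, stays bounded.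
\<close>

section \<open>Elementary inequalities\<close>

text \<open>Only moments of order \<open>q\<close> of \<open>u0\<close> are available, while moments
  of the larger order \<open>q + \<epsilon>/2\<close> are propagated, so the latter may be infinite.
  Conditional statements are therefore inequalities between extended integrals over all sets of the
  past sigma-algebra. The terms of the expansion, which have no sign, are integrated only on past
  sets where the current value is bounded; these sets then exhaust the space.

  The noise in the recursion is an L2 limit of a series, the Ito integral an L2 limit of step
  integrals. Since the integrand is frozen on a step, every increment of the Ito integral inside the
  step is also the L2 limit of that series. Hence one set of variance and moment bounds serves both
  the recursion at the grid points and the chaining between them.

  The bounds have to be uniform in \<theta> and to hold also for steps longer than 1, which shapes
  the step-size constants. Finally, a finite \<open>Lq_norm\<close> includes measurability, so the
  supremum over all times requires path continuity and the completeness of \<open>M\<close>.\<close>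

lemma powr_second_order_upper:
  fixes p \<delta> :: real
  assumes p: "1 \<le> p" and \<delta>: "0 < \<delta>"
  obtains w0 where "0 < w0" "w0 \<le> 1/2"
    "\<And>w. \<bar>w\<bar> \<le> w0 \<Longrightarrow> (1 + w) powr p \<le> 1 + p * w + (p * (p - 1) / 2 + \<delta>) * w\<^sup>2"
proof -
  \<comment> \<open>With this tolerance on \<open>z powr (p - 2)\<close> near 1, the Lagrange
    remainder exceeds \<open>p * (p - 1) / 2 * w^2\<close> by at most \<open>\<delta> * w^2\<close>.
    The summand 1 keeps the quotient defined for \<open>p = 1\<close>.\<close>
  define d where "d = 2 * \<delta> / (p * (p - 1) + 1)"
  have pp: "0 \<le> p * (p - 1)" using p by simp
  have d: "0 < d" using pp \<delta> by (simp add: d_def)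
  have "isCont (\<lambda>z::real. z powr (p - 2)) 1" by (intro continuous_intros) auto
  then obtain e where e: "0 < e" "\<And>z. \<bar>z - 1\<bar> < e \<Longrightarrow> \<bar>z powr (p - 2) - 1\<bar> < d"
    using d unfolding continuous_at_eps_delta dist_real_def by (metis powr_one_eq_one)
  define w0 where "w0 = min (1/2) (e/2)"
  have w0: "0 < w0" "w0 \<le> 1/2" "w0 < e" using e(1) by (auto simp: w0_def)
  define diff where "diff m = (\<lambda>z::real. if m = (0::nat) then z powr p else if m = 1 then p * z powr (p - 1)
      else p * (p - 1) * z powr (p - 2))" for m
  have bnd: "(1 + w) powr p \<le> 1 + p * w + (p * (p - 1) / 2 + \<delta>) * w\<^sup>2" if w: "\<bar>w\<bar> \<le> w0" for w
  proof (cases "w = 0")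
    case True then show ?thesis by simp
  next
    case False
    have D: "\<forall>m t. m < 2 \<and> 1/2 \<le> t \<and> t \<le> 3/2 \<longrightarrow> (diff m has_real_derivative diff (Suc m) t) (at t)"
    proof (intro allI impI)
      fix m :: nat and t :: real assume A: "m < 2 \<and> 1/2 \<le> t \<and> t \<le> 3/2"
      then have "m = 0 \<or> m = 1" "0 < t" by auto
      then show "(diff m has_real_derivative diff (Suc m) t) (at t)"
        by (auto simp: diff_def[abs_def] intro!: derivative_eq_intros)
    qed
    obtain t where t: "if 1 + w < 1 then 1 + w < t \<and> t < 1 else 1 < t \<and> t < 1 + w"
      and eq: "diff 0 (1 + w) = (\<Sum>m<2. diff m 1 / fact m * (1 + w - 1) ^ m) + diff 2 t / fact 2 * (1 + w - 1) ^ 2"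
    proof -
      have "\<exists>t. (if 1 + w < 1 then 1 + w < t \<and> t < 1 else 1 < t \<and> t < 1 + w) \<and>
        diff 0 (1 + w) = (\<Sum>m<2. diff m 1 / fact m * (1 + w - 1) ^ m) + diff 2 t / fact 2 * (1 + w - 1) ^ 2"
        by (rule Taylor[where a="1/2" and b="3/2"]) (use D w w0 False in auto)
      then show ?thesis using that by blast
    qed
    have tt: "\<bar>t - 1\<bar> < e" using t w w0 by (auto split: if_splits)
    have "(1 + w) powr p = 1 + p * w + p * (p - 1) / 2 * t powr (p - 2) * w\<^sup>2"
      using eq by (simp add: diff_def numeral_2_eq_2 lessThan_Suc)
    also have "\<dots> \<le> 1 + p * w + p * (p - 1) / 2 * (1 + d) * w\<^sup>2"
      using e(2)[OF tt] pp by (intro add_left_mono mult_right_mono mult_left_mono) auto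
    also have "p * (p - 1) / 2 * (1 + d) \<le> p * (p - 1) / 2 + \<delta>"
      using pp \<delta> by (simp add: d_def field_simps)
    finally show ?thesis by (simp add: mult_right_mono)
  qed
  show ?thesis using that[OF w0(1,2) bnd] .
qed

text \<open>For small \<open>s\<close> this is the second-order bound at
  \<open>w = 2 * \<alpha> * s + s^2\<close>: as \<open>w^2\<close> is at most about
  \<open>4 * s^2\<close>, the quadratic coefficient becomes
  \<open>p + 4 * (p * (p - 1) / 2) = p * (2 * p - 1)\<close>. Away from zero the left side grows at
  most like \<open>s^(2p)\<close>, and \<open>p \<le> m\<close> lets \<open>C * s ^ (2 * m)\<close>
  take over.\<close>

lemma powr_quadratic_upper:
  fixes p \<delta> :: real
  assumes p: "1 \<le> p" and \<delta>: "0 < \<delta>" and m: "p \<le> real m"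
  obtains C where "0 \<le> C"
    "\<And>\<alpha> s. \<bar>\<alpha>\<bar> \<le> 1 \<Longrightarrow> 0 \<le> s \<Longrightarrow>
       (1 + 2 * \<alpha> * s + s\<^sup>2) powr p \<le> 1 + 2 * p * \<alpha> * s + (p * (2 * p - 1) + \<delta>) * s\<^sup>2 + C * s ^ (2 * m)"
proof -
  define d where "d = \<delta> / 8"
  have d: "0 < d" using \<delta> by (simp add: d_def)
  obtain w0 where w0: "0 < w0" "w0 \<le> 1/2"
    "\<And>w. \<bar>w\<bar> \<le> w0 \<Longrightarrow> (1 + w) powr p \<le> 1 + p * w + (p * (p - 1) / 2 + d) * w\<^sup>2"
    using powr_second_order_upper[OF p d] by blast
  define B where "B = p * (p - 1) / 2 + d"
  have B: "0 < B" using p d by (simp add: B_def add_nonneg_pos)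
  \<comment> \<open>The bound \<open>w0 / 3\<close> gives \<open>|w| \<le> 3 * s \<le> w0\<close>.
    The last one makes the cubic and quartic parts of \<open>B * w^2\<close> at most
    \<open>\<delta> / 2 * s^2\<close>; the other half of \<delta> is \<open>4 * d\<close>.\<close>
  define s0 where "s0 = min 1 (min (w0 / 3) (\<delta> / (10 * B)))"
  have s0: "0 < s0" "s0 \<le> 1" "s0 \<le> w0 / 3" "s0 \<le> \<delta> / (10 * B)"
    using w0 \<delta> B by (auto simp: s0_def)
  define c where "c = 1 + 1 / s0"
  define C where "C = c ^ (2 * m)"
  have c: "1 \<le> c" using s0 by (simp add: c_def)
  have C: "0 \<le> C" using c by (simp add: C_def)
  have *: "(1 + 2 * \<alpha> * s + s\<^sup>2) powr p \<le> 1 + 2 * p * \<alpha> * s + (p * (2 * p - 1) + \<delta>) * s\<^sup>2 + C * s ^ (2 * m)"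
    if a: "\<bar>\<alpha>\<bar> \<le> 1" and s: "0 \<le> s" for \<alpha> s
  proof (cases "s \<le> s0")
    case True
    have as: "\<bar>\<alpha> * s\<bar> \<le> s" using a s by (simp add: abs_mult mult_left_le_one_le)
    have s1: "s\<^sup>2 \<le> s" using True s0 s by (simp add: power2_eq_square mult_left_le)
    define w where "w = 2 * \<alpha> * s + s\<^sup>2"
    have absw: "\<bar>w\<bar> \<le> 2 * s + s\<^sup>2" using as zero_le_power2[of s] unfolding w_def by linarith
    then have "\<bar>w\<bar> \<le> w0" using s1 True s0 by linarith
    from w0(3)[OF this] have "(1 + w) powr p \<le> 1 + p * w + B * w\<^sup>2" by (simp add: B_def)
    also have "w\<^sup>2 \<le> (2 * s + s\<^sup>2)\<^sup>2" using absw by (metis abs_ge_zero power2_abs power_mono)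
    also have "(2 * s + s\<^sup>2)\<^sup>2 = s\<^sup>2 * (4 + s * (4 + s))" by (simp add: power2_eq_square algebra_simps)
    also have "\<dots> \<le> s\<^sup>2 * (4 + s0 * 5)"
      using True s0 s by (intro mult_left_mono add_left_mono mult_mono) auto
    also have "B * (s\<^sup>2 * (4 + s0 * 5)) = (4 * B + 5 * B * s0) * s\<^sup>2" by (simp add: algebra_simps)
    also have "\<dots> \<le> (4 * B + \<delta> / 2) * s\<^sup>2"
      using s0(4) B by (intro mult_right_mono) (auto simp: field_simps)
    also have "1 + p * w + (4 * B + \<delta> / 2) * s\<^sup>2 = 1 + 2 * p * \<alpha> * s + (p * (2 * p - 1) + \<delta>) * s\<^sup>2"
      by (simp add: w_def B_def d_def field_simps)
    also have "\<dots> \<le> \<dots> + C * s ^ (2 * m)" using C s by simp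
    finally show ?thesis using B by (simp add: w_def add.assoc)
  next
    case False
    then have s: "s0 < s" "0 < s" using s0 by auto
    have nn: "0 \<le> 1 + 2 * \<alpha> * s + s\<^sup>2"
    proof -
      have "- 2 * s \<le> 2 * \<alpha> * s" using a s mult_right_mono[of "-1" \<alpha> s] by (auto simp: abs_le_iff)
      moreover have "0 \<le> (1 - s)\<^sup>2" by simp
      ultimately show ?thesis by (simp add: power2_eq_square algebra_simps)
    qed
    have up: "1 + 2 * \<alpha> * s + s\<^sup>2 \<le> (1 + s)\<^sup>2"
      using a s by (auto simp: power2_eq_square algebra_simps abs_le_iff)
    have cs: "1 + s \<le> c * s" using s s0 by (simp add: c_def field_simps)
    have "(1 + 2 * \<alpha> * s + s\<^sup>2) powr p \<le> ((c * s)\<^sup>2) powr p"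
      using up cs s nn p by (intro powr_mono2) (auto intro: order_trans[OF up] power_mono)
    also have "\<dots> \<le> ((c * s)\<^sup>2) powr real m"
      using cs s m by (intro powr_mono) (auto intro: one_le_power)
    also have "\<dots> = C * s ^ (2 * m)"
      using c s by (simp add: powr_realpow C_def power_mult_distrib power_mult)
    finally have 1: "(1 + 2 * \<alpha> * s + s\<^sup>2) powr p \<le> C * s ^ (2 * m)" .
    \<comment> \<open>The bound by \<open>C * s ^ (2 * m)\<close> alone does not suffice if the
      remaining terms on the right are negative; completing the square excludes this.\<close>
    have "0 \<le> (1 - p * s)\<^sup>2 + (p * (p - 1)) * s\<^sup>2" using p by simp
    also have "\<dots> = 1 - 2 * p * s + p * (2 * p - 1) * s\<^sup>2" by (simp add: power2_eq_square algebra_simps)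
    also have "\<dots> \<le> 1 + 2 * p * \<alpha> * s + (p * (2 * p - 1) + \<delta>) * s\<^sup>2"
    proof -
      have "- 1 * (2 * p * s) \<le> \<alpha> * (2 * p * s)" using a s p by (intro mult_right_mono) auto
      moreover have "0 \<le> \<delta> * s\<^sup>2" using \<delta> by simp
      ultimately show ?thesis by (simp add: algebra_simps)
    qed
    finally show ?thesis using 1 by linarith
  qed
  show ?thesis using that[OF C *] .
qed

text \<open>Division by \<open>\<rho> = 1 + (norm x)^2\<close> reduces the vectors to two numbers,
  \<open>s = norm y / sqrt \<rho>\<close> and the cosine-like \<alpha>, which Cauchy-Schwarz bounds
  by 1. The constant is thus independent of the dimension. The prefactor depends on \<open>x\<close>
  only and later serves as a weight known from the past.\<close>

lemma norm_powr_expansion_upper: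
  fixes r \<delta> :: real
  assumes r: "2 \<le> r" and \<delta>: "0 < \<delta>" and m: "r \<le> 2 * real m"
  obtains C where "0 \<le> C"
    "\<And>x y :: 'a::real_inner. (1 + (norm (x + y))\<^sup>2) powr (r / 2) \<le>
       (1 + (norm x)\<^sup>2) powr (r / 2 - 1) *
         (1 + (norm x)\<^sup>2 + r * (x \<bullet> y) + (r * (r - 1) / 2 + \<delta>) * (norm y)\<^sup>2 + C * norm y ^ (2 * m))"
proof -
  obtain C where C: "0 \<le> C"
    "\<And>\<alpha> s. \<bar>\<alpha>\<bar> \<le> 1 \<Longrightarrow> 0 \<le> s \<Longrightarrow>
       (1 + 2 * \<alpha> * s + s\<^sup>2) powr (r/2) \<le> 1 + 2 * (r/2) * \<alpha> * s + ((r/2) * (2 * (r/2) - 1) + \<delta>) * s\<^sup>2 + C * s ^ (2 * m)"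
    using powr_quadratic_upper[of "r/2" \<delta> m] assms by auto
  have m1: "1 \<le> m" using r m by linarith
  have "(1 + (norm (x + y))\<^sup>2) powr (r / 2) \<le>
       (1 + (norm x)\<^sup>2) powr (r / 2 - 1) *
         (1 + (norm x)\<^sup>2 + r * (x \<bullet> y) + (r * (r - 1) / 2 + \<delta>) * (norm y)\<^sup>2 + C * norm y ^ (2 * m))"
    for x y :: 'a
  proof (cases "y = 0")
    case True
    have "(1 + (norm x)\<^sup>2) powr (r / 2) = (1 + (norm x)\<^sup>2) powr (r / 2 - 1) * (1 + (norm x)\<^sup>2) powr 1"
      by (subst powr_add[symmetric]) simp
    then show ?thesis using True m1 by (simp add: add_pos_nonneg power_0_left)
  next
    case False
    define \<rho> where "\<rho> = 1 + (norm x)\<^sup>2"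
    have \<rho>: "1 \<le> \<rho>" by (simp add: \<rho>_def)
    define s where "s = norm y / sqrt \<rho>"
    define \<alpha> where "\<alpha> = (x \<bullet> y) / (sqrt \<rho> * norm y)"
    have s: "0 \<le> s" using \<rho> by (simp add: s_def)
    have nx: "norm x \<le> sqrt \<rho>" by (simp add: \<rho>_def real_le_rsqrt)
    have "\<bar>x \<bullet> y\<bar> \<le> sqrt \<rho> * norm y"
      using Cauchy_Schwarz_ineq2[of x y] mult_right_mono[OF nx norm_ge_zero[of y]] by linarith
    then have a: "\<bar>\<alpha>\<bar> \<le> 1" using \<rho> False by (simp add: \<alpha>_def)
    have as: "\<rho> * (\<alpha> * s) = x \<bullet> y" using \<rho> False by (simp add: \<alpha>_def s_def field_simps)
    have ss: "\<rho> * s\<^sup>2 = (norm y)\<^sup>2" using \<rho> by (simp add: s_def power_divide)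
    have sm: "\<rho> * s ^ (2 * m) \<le> norm y ^ (2 * m)"
    proof -
      have "\<rho> * s ^ (2 * m) = norm y ^ (2 * m) * (\<rho> / \<rho> ^ m)"
        using \<rho> by (simp add: s_def power_divide power_mult)
      also have "\<dots> \<le> norm y ^ (2 * m) * 1"
        using \<rho> m1 self_le_power[of \<rho> m] by (intro mult_left_mono) (auto simp: divide_le_eq)
      finally show ?thesis by simp
    qed
    have "1 + (norm (x + y))\<^sup>2 = \<rho> + 2 * (x \<bullet> y) + (norm y)\<^sup>2"
      by (simp add: \<rho>_def power2_norm_eq_inner algebra_simps inner_commute)
    also have "\<dots> = \<rho> * (1 + 2 * \<alpha> * s + s\<^sup>2)" using as ss by (simp add: algebra_simps)
    finally have "(1 + (norm (x + y))\<^sup>2) powr (r / 2) = \<rho> powr (r/2) * (1 + 2 * \<alpha> * s + s\<^sup>2) powr (r/2)"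
      using \<rho> by (metis powr_mult)
    also have "\<dots> \<le> \<rho> powr (r/2) * (1 + 2 * (r/2) * \<alpha> * s + ((r/2) * (2 * (r/2) - 1) + \<delta>) * s\<^sup>2 + C * s ^ (2 * m))"
      by (intro mult_left_mono C(2) a s) simp
    also have "\<rho> powr (r/2) = \<rho> powr (r/2 - 1) * \<rho>"
    proof -
      have "\<rho> powr (r/2) = \<rho> powr (r / 2 - 1) * \<rho> powr 1" by (subst powr_add[symmetric]) simp
      then show ?thesis using \<rho> by simp
    qed
    also have "\<rho> powr (r/2 - 1) * \<rho> * (1 + 2 * (r/2) * \<alpha> * s + ((r/2) * (2 * (r/2) - 1) + \<delta>) * s\<^sup>2 + C * s ^ (2 * m))
       = \<rho> powr (r/2 - 1) * (\<rho> + r * (\<rho> * (\<alpha> * s)) + (r * (r - 1) / 2 + \<delta>) * (\<rho> * s\<^sup>2) + C * (\<rho> * s ^ (2 * m)))"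
      by (simp add: algebra_simps)
    also have "\<dots> \<le> \<rho> powr (r/2 - 1) * (\<rho> + r * (\<rho> * (\<alpha> * s)) + (r * (r - 1) / 2 + \<delta>) * (\<rho> * s\<^sup>2) + C * norm y ^ (2 * m))"
      by (intro mult_left_mono add_left_mono sm C) simp
    finally show ?thesis unfolding as ss unfolding \<rho>_def .
  qed
  then show ?thesis using that[OF C(1)] by blast
qed

section \<open>Orthonormal bases\<close>

text \<open>\<open>v - P n v\<close> depends linearly on \<open>v\<close>, never has a larger norm
  than \<open>v\<close>, and vanishes for large \<open>n\<close> when \<open>v\<close> lies in the
  span; density extends the convergence to all \<open>v\<close>.\<close>

lemma orthonormal_basis_expansion:
  fixes h :: "nat \<Rightarrow> 'h::real_inner"
  assumes "orthonormal_basis I h"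
  shows "(\<lambda>n. \<Sum>i\<in>I \<inter> {..<n}. (v \<bullet> h i) *\<^sub>R h i) \<longlonglongrightarrow> v"
proof -
  have on: "h m \<bullet> h n = (if m = n then 1 else 0)" if "m \<in> I" "n \<in> I" for m n
    using assms that by (auto simp: orthonormal_basis_def)
  have cl: "closure (span (h ` I)) = UNIV" using assms by (auto simp: orthonormal_basis_def)
  define P where "P n v = (\<Sum>i\<in>I \<inter> {..<n}. (v \<bullet> h i) *\<^sub>R h i)" for n v
  have Pdiff: "P n (u - v) = P n u - P n v" for n u v
    by (simp add: P_def inner_diff_left scaleR_diff_left sum_subtractf)
  have Padd: "P n (u + v) = P n u + P n v" for n u v
    by (simp add: P_def inner_add_left scaleR_add_left sum.distrib)
  have Psc: "P n (c *\<^sub>R u) = c *\<^sub>R P n u" for n c u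
    by (simp add: P_def scaleR_sum_right)
  have Ph: "P n v \<bullet> h j = v \<bullet> h j" if "j \<in> I \<inter> {..<n}" for n v j
  proof -
    have "P n v \<bullet> h j = (\<Sum>i\<in>I \<inter> {..<n}. (v \<bullet> h i) * (h i \<bullet> h j))"
      by (simp add: P_def inner_sum_left)
    also have "\<dots> = (\<Sum>i\<in>I \<inter> {..<n}. if i = j then v \<bullet> h i else 0)"
      using that by (intro sum.cong) (auto simp: on)
    also have "\<dots> = v \<bullet> h j" using that by simp
    finally show ?thesis .
  qed
  have orth: "(v - P n v) \<bullet> P n v = 0" for n v
  proof -
    have "(v - P n v) \<bullet> P n v = (\<Sum>i\<in>I \<inter> {..<n}. (v \<bullet> h i) * ((v - P n v) \<bullet> h i))"
      by (subst (2) P_def) (simp add: inner_sum_right)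
    also have "\<dots> = 0" by (intro sum.neutral) (auto simp: inner_diff_left Ph)
    finally show ?thesis .
  qed
  have contr: "norm (v - P n v) \<le> norm v" for n v
  proof -
    have "(norm v)\<^sup>2 = (norm (v - P n v))\<^sup>2 + (norm (P n v))\<^sup>2"
      using orth[of v n] by (simp add: power2_norm_eq_inner inner_diff_left inner_diff_right inner_commute)
    then show ?thesis by (metis le_add_same_cancel1 norm_ge_zero power2_le_imp_le zero_le_power2)
  qed
  have fin: "\<exists>n0. \<forall>n\<ge>n0. P n u = u" if "u \<in> span (h ` I)" for u
    using that
  proof (induction rule: span_induct_alt)
    case base show ?case by (simp add: P_def)
  next
    case (step c x y)
    then obtain i n0 where i: "i \<in> I" "x = h i" and n0: "\<forall>n\<ge>n0. P n y = y" by auto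
    have "P n (h i) = h i" if "n > i" for n
    proof -
      have "P n (h i) = (\<Sum>j\<in>I \<inter> {..<n}. if j = i then h j else 0)"
        unfolding P_def using i by (intro sum.cong) (auto simp: on)
      then show ?thesis using i that by simp
    qed
    then have "\<forall>n\<ge>max n0 (Suc i). P n (c *\<^sub>R x + y) = c *\<^sub>R x + y"
      using n0 i by (auto simp: Padd Psc)
    then show ?case by blast
  qed
  have "(\<lambda>n. P n v) \<longlonglongrightarrow> v"
  proof (rule LIMSEQ_I)
    fix e :: real assume "0 < e"
    moreover have "v \<in> closure (span (h ` I))" using cl by simp
    ultimately obtain u where u: "u \<in> span (h ` I)" "dist u v < e" by (meson closure_approachable)
    obtain n0 where n0: "\<forall>n\<ge>n0. P n u = u" using fin[OF u(1)] by blast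
    have "norm (P n v - v) < e" if "n \<ge> n0" for n
    proof -
      have "v - P n v = (v - u) - P n (v - u)" using n0 that by (simp add: Pdiff)
      then have "norm (v - P n v) \<le> norm (v - u)" using contr by metis
      then show ?thesis using u(2) by (simp add: dist_norm norm_minus_commute)
    qed
    then show "\<exists>no. \<forall>n\<ge>no. norm (P n v - v) < e" by blast
  qed
  then show ?thesis by (simp add: P_def)
qed

lemma sum_lessThan_indicator:
  fixes f :: "nat \<Rightarrow> 'a::real_vector"
  shows "(\<Sum>i<n. indicator I i *\<^sub>R f i) = (\<Sum>i\<in>I \<inter> {..<n}. f i)"
  by (subst sum.inter_restrict[of "{..<n}" f I, unfolded Int_commute[of "{..<n}"]])
     (auto intro!: sum.cong simp: indicator_def)

lemma parseval_sums:
  fixes h :: "nat \<Rightarrow> 'h::real_inner"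
  assumes "orthonormal_basis I h"
  shows "(\<lambda>n. indicator I n * ((v \<bullet> h n) * (w \<bullet> h n))) sums (v \<bullet> w)"
proof -
  have "(\<lambda>n. (\<Sum>i\<in>I \<inter> {..<n}. (v \<bullet> h i) *\<^sub>R h i) \<bullet> w) \<longlonglongrightarrow> v \<bullet> w"
    by (intro tendsto_intros orthonormal_basis_expansion[OF assms])
  then show ?thesis
    unfolding sums_def using sum_lessThan_indicator[where f="\<lambda>i. (v \<bullet> h i) * (w \<bullet> h i)" and I=I]
    by (simp add: inner_sum_left inner_commute[of w] Int_commute)
qed

text \<open>\<open>E\<close> is a normalised orthogonal basis of the span. It serves to split the
  norm of a random sum with finitely many fixed coefficients into squares of scalar Gaussian
  variables.\<close>

lemma finite_orthonormal_cover:
  fixes C :: "'a::real_inner set"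
  assumes "finite C"
  obtains E where "finite E" "\<And>v. v \<in> span C \<Longrightarrow> (norm v)\<^sup>2 = (\<Sum>e\<in>E. (v \<bullet> e)\<^sup>2)"
proof -
  obtain B where B: "finite B" "span B = span C" "pairwise orthogonal B"
    using basis_orthogonal[OF assms] by blast
  define E where "E = (\<lambda>b. b /\<^sub>R norm b) ` (B - {0})"
  have E: "finite E" using B by (simp add: E_def)
  have on: "e \<bullet> e' = (if e = e' then 1 else 0)" if e: "e \<in> E" "e' \<in> E" for e e'
  proof -
    obtain b b' where b: "b \<in> B" "b \<noteq> 0" "e = b /\<^sub>R norm b" and b': "b' \<in> B" "b' \<noteq> 0" "e' = b' /\<^sub>R norm b'"
      using e by (auto simp: E_def)
    show ?thesis
    proof (cases "b = b'")
      case True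
      then show ?thesis using b b' by (simp add: norm_eq_sqrt_inner field_simps)
    next
      case False
      then have "b \<bullet> b' = 0" using B b b' by (auto simp: pairwise_def orthogonal_def)
      moreover from this have "e \<bullet> e' = 0" using b b' by simp
      moreover have "e \<bullet> e \<noteq> 0" using b by simp
      ultimately show ?thesis by auto
    qed
  qed
  have sp: "v = (\<Sum>e\<in>E. (v \<bullet> e) *\<^sub>R e)" if "v \<in> span B" for v
    using that
  proof (induction rule: span_induct_alt)
    case base show ?case by simp
  next
    case (step c x y)
    have x: "x = (\<Sum>e\<in>E. (x \<bullet> e) *\<^sub>R e)"
    proof (cases "x = 0")
      case False
      define e0 where "e0 = x /\<^sub>R norm x"
      have e0: "e0 \<in> E" "x = norm x *\<^sub>R e0" using step False by (auto simp: E_def e0_def)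
      have "(\<Sum>e\<in>E. (x \<bullet> e) *\<^sub>R e) = (\<Sum>e\<in>E. if e = e0 then norm x *\<^sub>R e else 0)"
      proof (intro sum.cong refl)
        fix e assume "e \<in> E"
        then have "x \<bullet> e = norm x * (if e0 = e then 1 else 0)"
          by (subst e0(2)) (simp add: on e0(1))
        then show "(x \<bullet> e) *\<^sub>R e = (if e = e0 then norm x *\<^sub>R e else 0)" by auto
      qed
      also have "\<dots> = x" using e0 E by simp
      finally show ?thesis by simp
    qed simp
    show ?case
      by (subst x, subst step(2), simp add: inner_add_left scaleR_add_left sum.distrib scaleR_sum_right)
  qed
  show ?thesis
  proof (rule that[OF E])
    fix v assume v: "v \<in> span C"
    have "(norm v)\<^sup>2 = v \<bullet> (\<Sum>e\<in>E. (v \<bullet> e) *\<^sub>R e)"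
      using sp v B by (simp add: power2_norm_eq_inner)
    then show "(norm v)\<^sup>2 = (\<Sum>e\<in>E. (v \<bullet> e)\<^sup>2)"
      by (simp add: inner_sum_right power2_eq_square)
  qed
qed

section \<open>Inequalities on the sets of a sub-sigma-algebra\<close>

lemma nn_integral_subalgebra_mono:
  fixes u v X :: "'w \<Rightarrow> ennreal"
  assumes sub: "subalgebra M F" and u[measurable]: "u \<in> borel_measurable M" and v[measurable]: "v \<in> borel_measurable M"
    and le: "\<And>B. B \<in> sets F \<Longrightarrow> (\<integral>\<^sup>+\<omega>. indicator B \<omega> * u \<omega> \<partial>M) \<le> (\<integral>\<^sup>+\<omega>. indicator B \<omega> * v \<omega> \<partial>M)"
    and X: "X \<in> borel_measurable F"
  shows "(\<integral>\<^sup>+\<omega>. X \<omega> * u \<omega> \<partial>M) \<le> (\<integral>\<^sup>+\<omega>. X \<omega> * v \<omega> \<partial>M)"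
  using X
proof (induction rule: borel_measurable_induct)
  case (cong f g)
  have "space F = space M" using sub by (simp add: subalgebra_def)
  then have "(\<integral>\<^sup>+\<omega>. f \<omega> * u \<omega> \<partial>M) = (\<integral>\<^sup>+\<omega>. g \<omega> * u \<omega> \<partial>M)" "(\<integral>\<^sup>+\<omega>. f \<omega> * v \<omega> \<partial>M) = (\<integral>\<^sup>+\<omega>. g \<omega> * v \<omega> \<partial>M)"
    using cong(3) by (auto intro!: nn_integral_cong)
  then show ?case using cong by simp
next
  case (set A) then show ?case by (rule le)
next
  case (mult w c)
  note [measurable] = measurable_from_subalg[OF sub mult(2)]
  show ?case using mult(4) by (simp add: mult.assoc nn_integral_cmult mult_left_mono)
next
  case (add w w')
  have [measurable]: "w \<in> borel_measurable M" "w' \<in> borel_measurable M"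
    using add.hyps by (auto intro: measurable_from_subalg[OF sub])
  show ?case using add.IH by (simp add: distrib_right nn_integral_add add_mono)
next
  case (seq U)
  note [measurable] = measurable_from_subalg[OF sub seq(1)]
  have eq: "(\<integral>\<^sup>+\<omega>. (\<Squnion> range U) \<omega> * w \<omega> \<partial>M) = (SUP i. \<integral>\<^sup>+\<omega>. U i \<omega> * w \<omega> \<partial>M)"
    if [measurable]: "w \<in> borel_measurable M" for w
  proof -
    have "(\<integral>\<^sup>+\<omega>. (\<Squnion> range U) \<omega> * w \<omega> \<partial>M) = (\<integral>\<^sup>+\<omega>. (SUP i. U i \<omega> * w \<omega>) \<partial>M)"
      by (simp add: SUP_mult_right_ennreal image_comp)
    also have "\<dots> = (SUP i. \<integral>\<^sup>+\<omega>. U i \<omega> * w \<omega> \<partial>M)"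
      using \<open>incseq U\<close> by (intro nn_integral_monotone_convergence_SUP)
        (auto simp: incseq_def le_fun_def intro!: mult_right_mono)
    finally show ?thesis .
  qed
  show ?case unfolding eq[OF u] eq[OF v] by (intro SUP_mono) (use seq.IH in blast)
qed

text \<open>Removes a localisation: inequalities on increasing sets pass to their union by
  continuity from below of the measures with densities \<open>u\<close> and \<open>v\<close>,
  whether or not these are finite.\<close>

lemma nn_integral_le_exhaust:
  fixes u v :: "'w \<Rightarrow> ennreal"
  assumes [measurable]: "u \<in> borel_measurable M" "v \<in> borel_measurable M" "B \<in> sets M"
    and A[measurable]: "\<And>n::nat. A n \<in> sets M" and inc: "incseq A" and un: "space M \<subseteq> (\<Union>n. A n)"
    and le: "\<And>n. (\<integral>\<^sup>+\<omega>. indicator (B \<inter> A n) \<omega> * u \<omega> \<partial>M) \<le> (\<integral>\<^sup>+\<omega>. indicator (B \<inter> A n) \<omega> * v \<omega> \<partial>M)"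
  shows "(\<integral>\<^sup>+\<omega>. indicator B \<omega> * u \<omega> \<partial>M) \<le> (\<integral>\<^sup>+\<omega>. indicator B \<omega> * v \<omega> \<partial>M)"
proof -
  have BA: "(\<Union>n. B \<inter> A n) = B" using un sets.sets_into_space[OF \<open>B \<in> sets M\<close>] by auto
  have eq: "(\<integral>\<^sup>+\<omega>. indicator B \<omega> * w \<omega> \<partial>M) = (SUP n. \<integral>\<^sup>+\<omega>. indicator (B \<inter> A n) \<omega> * w \<omega> \<partial>M)"
    if [measurable]: "w \<in> borel_measurable M" for w
  proof -
    have "(SUP n. emeasure (density M w) (B \<inter> A n)) = emeasure (density M w) (\<Union>n. B \<inter> A n)"
      using inc by (intro SUP_emeasure_incseq) (auto simp: incseq_def)
    then show ?thesis unfolding BA by (simp add: emeasure_density mult.commute)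
  qed
  show ?thesis unfolding eq[OF assms(1)] eq[OF assms(2)] by (intro SUP_mono) (use le in blast)
qed

section \<open>Maximal inequality for powers below one\<close>

lemma powr_le_tangent:
  fixes p x y :: real
  assumes "0 < p" "p < 1" "0 < x" "0 < y"
  shows "y powr p \<le> (1 - p) * x powr p + p * (x powr (p - 1) * y)"
proof -
  have "(y / x) powr p * 1 powr (1 - p) \<le> p * (y / x) + (1 - p) * 1"
    using assms by (intro Youngs_inequality_0) auto
  then have "x powr p * (y / x) powr p \<le> x powr p * (p * (y / x) + (1 - p))"
    by (intro mult_left_mono) auto
  moreover have "x powr p * (y / x) powr p = y powr p" using assms by (simp add: powr_divide)
  moreover have "x powr (p - 1) = x powr p / x" using assms by (simp add: powr_diff)
  ultimately show ?thesis by (simp add: algebra_simps)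
qed

text \<open>
  The potential \<open>m\<^sup>p + p/(1-p) z m\<^sup>p\<^sup>-\<^sup>1\<close> of the current value \<open>z\<close> and the running maximum \<open>m\<close> is
  linear in \<open>z\<close> below \<open>m\<close> and lies below its tangent above \<open>m\<close>, so it does not increase in mean.
\<close>

lemma supermartingale_maximal_powr:
  fixes Z :: "nat \<Rightarrow> 'w \<Rightarrow> real" and p :: real
  assumes p: "0 < p" "p < 1"
    and sub: "\<And>j. j \<le> n \<Longrightarrow> subalgebra M (F j)"
    and mono: "\<And>j. j < n \<Longrightarrow> sets (F j) \<subseteq> sets (F (Suc j))"
    and Z: "\<And>j. j \<le> n \<Longrightarrow> Z j \<in> borel_measurable (F j)" and pos: "\<And>j \<omega>. 0 < Z j \<omega>"
    and le: "\<And>j B. j < n \<Longrightarrow> B \<in> sets (F j) \<Longrightarrow>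
      (\<integral>\<^sup>+\<omega>. indicator B \<omega> * ennreal (Z (Suc j) \<omega>) \<partial>M) \<le> (\<integral>\<^sup>+\<omega>. indicator B \<omega> * ennreal (Z j \<omega>) \<partial>M)"
  shows "(\<integral>\<^sup>+\<omega>. ennreal (Max ((\<lambda>j. Z j \<omega>) ` {..n}) powr p) \<partial>M) \<le> ennreal (1 / (1 - p)) * (\<integral>\<^sup>+\<omega>. ennreal (Z 0 \<omega> powr p) \<partial>M)"
proof -
  define X where "X j \<omega> = Max ((\<lambda>i. Z i \<omega>) ` {..j})" for j \<omega>
  define V where "V z m = m powr p + p / (1 - p) * (m powr (p - 1) * z)" for z m :: real
  have XS: "X (Suc j) \<omega> = max (X j \<omega>) (Z (Suc j) \<omega>)" for j \<omega>
    by (simp add: X_def atMost_Suc max.commute)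
  have Xpos: "0 < X j \<omega>" for j \<omega>
    unfolding X_def by (rule less_le_trans[OF pos[of 0]]) (auto intro: Max_ge)
  have ZM: "Z j \<in> borel_measurable M" if "j \<le> n" for j
    using measurable_from_subalg[OF sub Z] that by blast
  have XF: "X j \<in> borel_measurable (F j)" if "j \<le> n" for j
    using that
  proof (induction j)
    case 0 then show ?case using Z[of 0] by (simp add: X_def[abs_def])
  next
    case (Suc j)
    have "subalgebra (F (Suc j)) (F j)" using sub[of j] sub[of "Suc j"] mono[of j] Suc
      by (auto simp: subalgebra_def)
    from measurable_from_subalg[OF this] Suc
    have [measurable]: "X j \<in> borel_measurable (F (Suc j))" by auto
    have [measurable]: "Z (Suc j) \<in> borel_measurable (F (Suc j))" using Z Suc by simp
    have "X (Suc j) = (\<lambda>\<omega>. max (X j \<omega>) (Z (Suc j) \<omega>))" by (rule ext, rule XS)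
    then show ?case by simp
  qed
  have XM: "X j \<in> borel_measurable M" if "j \<le> n" for j
    using measurable_from_subalg[OF sub XF] that by blast
  have V0: "0 \<le> V z m" if "0 < z" for z m using that p by (simp add: V_def)
  have Vmax: "V z (max m z) \<le> V z m" if "0 < z" "0 < m" for z m
  proof (cases "z \<le> m")
    case False
    have "z powr (p - 1) * z = z powr p" using that powr_add[of z "p - 1" 1] by simp
    then have "V z z = z powr p * (1 + p / (1 - p))" by (simp add: V_def algebra_simps)
    also have "1 + p / (1 - p) = 1 / (1 - p)" using p by (simp add: field_simps)
    also have "z powr p * (1 / (1 - p)) \<le> ((1 - p) * m powr p + p * (m powr (p - 1) * z)) * (1 / (1 - p))"
      using p that by (intro mult_right_mono powr_le_tangent) auto
    also have "\<dots> = V z m" using p by (simp add: V_def field_simps)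
    finally show ?thesis using False by (simp add: max_def)
  qed (simp add: max_def)
  have main: "(\<integral>\<^sup>+\<omega>. ennreal (V (Z j \<omega>) (X j \<omega>)) \<partial>M) \<le> ennreal (1 / (1 - p)) * (\<integral>\<^sup>+\<omega>. ennreal (Z 0 \<omega> powr p) \<partial>M)"
    if "j \<le> n" for j using that
  proof (induction j)
    case 0
    have [measurable]: "Z 0 \<in> borel_measurable M" using ZM by simp
    have "V z z = 1 / (1 - p) * z powr p" if "0 < z" for z
    proof -
      have "z powr (p - 1) * z = z powr p" using that powr_add[of z "p - 1" 1] by simp
      then have "V z z = z powr p * (1 + p / (1 - p))" by (simp add: V_def algebra_simps)
      also have "1 + p / (1 - p) = 1 / (1 - p)" using p by (simp add: field_simps)
      finally show ?thesis by simp
    qed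
    then have "(\<integral>\<^sup>+\<omega>. ennreal (V (Z 0 \<omega>) (X 0 \<omega>)) \<partial>M) = (\<integral>\<^sup>+\<omega>. ennreal (1 / (1 - p)) * ennreal (Z 0 \<omega> powr p) \<partial>M)"
      using pos p by (intro nn_integral_cong) (simp add: X_def ennreal_mult[symmetric])
    then show ?case by (simp add: nn_integral_cmult)
  next
    case (Suc j)
    have [measurable]: "Z (Suc j) \<in> borel_measurable M" "Z j \<in> borel_measurable M" "X j \<in> borel_measurable M"
      using ZM XM Suc by auto
    have [measurable]: "X j \<in> borel_measurable (F j)" using XF Suc by auto
    let ?c = "\<lambda>\<omega>. ennreal (p / (1 - p) * X j \<omega> powr (p - 1))"
    have split: "(\<integral>\<^sup>+\<omega>. ennreal (V (Z i \<omega>) (X j \<omega>)) \<partial>M) =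
      (\<integral>\<^sup>+\<omega>. ennreal (X j \<omega> powr p) \<partial>M) + (\<integral>\<^sup>+\<omega>. ?c \<omega> * ennreal (Z i \<omega>) \<partial>M)" if "i = j \<or> i = Suc j" for i
    proof -
      have [measurable]: "Z i \<in> borel_measurable M" using that by auto
      have "(\<integral>\<^sup>+\<omega>. ennreal (V (Z i \<omega>) (X j \<omega>)) \<partial>M) = (\<integral>\<^sup>+\<omega>. ennreal (X j \<omega> powr p) + ?c \<omega> * ennreal (Z i \<omega>) \<partial>M)"
        using p pos by (intro nn_integral_cong)
          (simp add: V_def ennreal_mult'[symmetric] ennreal_plus[symmetric] less_imp_le mult.assoc del: ennreal_plus)
      then show ?thesis by (simp add: nn_integral_add)
    qed
    have "(\<integral>\<^sup>+\<omega>. ennreal (V (Z (Suc j) \<omega>) (X (Suc j) \<omega>)) \<partial>M) \<le> (\<integral>\<^sup>+\<omega>. ennreal (V (Z (Suc j) \<omega>) (X j \<omega>)) \<partial>M)"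
      unfolding XS by (intro nn_integral_mono ennreal_leI Vmax pos Xpos)
    \<comment> \<open>For a frozen maximum the potential is affine in \<open>z\<close> with a
      nonnegative slope measurable with respect to \<open>F j\<close>, so the supermartingale
      property applies with this slope as weight.\<close>
    also have "\<dots> \<le> (\<integral>\<^sup>+\<omega>. ennreal (V (Z j \<omega>) (X j \<omega>)) \<partial>M)"
      unfolding split[OF disjI1[OF refl]] split[OF disjI2[OF refl]]
    proof (rule add_left_mono, rule nn_integral_subalgebra_mono[OF sub[of j]])
      show "(\<integral>\<^sup>+\<omega>. indicator B \<omega> * ennreal (Z (Suc j) \<omega>) \<partial>M) \<le> (\<integral>\<^sup>+\<omega>. indicator B \<omega> * ennreal (Z j \<omega>) \<partial>M)"
        if "B \<in> sets (F j)" for B by (rule le) (use Suc.prems that in simp_all)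
    qed (use Suc.prems in simp_all)
    also have "\<dots> \<le> ennreal (1 / (1 - p)) * (\<integral>\<^sup>+\<omega>. ennreal (Z 0 \<omega> powr p) \<partial>M)"
      by (rule Suc.IH) (use Suc.prems in simp)
    finally show ?case .
  qed
  have "(\<integral>\<^sup>+\<omega>. ennreal (X n \<omega> powr p) \<partial>M) \<le> (\<integral>\<^sup>+\<omega>. ennreal (V (Z n \<omega>) (X n \<omega>)) \<partial>M)"
    using p pos by (intro nn_integral_mono ennreal_leI) (simp add: V_def less_imp_le)
  also note main[of n]
  finally show ?thesis by (simp add: X_def)
qed

section \<open>Almost sure limits and completeness\<close>

lemma nn_integral_tendsto_0_AE_subseq:
  fixes f :: "nat \<Rightarrow> 'w \<Rightarrow> real"
  assumes f: "\<And>n. f n \<in> borel_measurable M" and pos: "\<And>n \<omega>. 0 \<le> f n \<omega>"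
    and lim: "(\<lambda>n. \<integral>\<^sup>+\<omega>. ennreal (f n \<omega>) \<partial>M) \<longlonglongrightarrow> 0"
  obtains s where "strict_mono s" "AE \<omega> in M. (\<lambda>n. f (s n) \<omega>) \<longlonglongrightarrow> 0"
proof -
  have "\<forall>\<^sub>F n in sequentially. (\<integral>\<^sup>+\<omega>. ennreal (f n \<omega>) \<partial>M) < 1"
    using lim by (intro order_tendstoD(2)) auto
  \<comment> \<open>Finitely many of the integrals may be infinite; these terms are discarded before
    convergence in mean is applied.\<close>
  then obtain n0 where n0: "\<And>n. n \<ge> n0 \<Longrightarrow> (\<integral>\<^sup>+\<omega>. ennreal (f n \<omega>) \<partial>M) < 1"
    by (auto simp: eventually_sequentially)
  have int: "integrable M (f (n + n0))" for n
    by (rule integrableI_bounded) (use f n0[of "n + n0"] pos in \<open>auto intro: less_trans[OF _ ennreal_one_less_top]\<close>)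
  have "(\<lambda>n. ennreal (LINT \<omega>|M. f (n + n0) \<omega>)) \<longlonglongrightarrow> ennreal 0"
    using LIMSEQ_ignore_initial_segment[OF lim, of n0] nn_integral_eq_integral[OF int] pos by simp
  then have "(\<lambda>n. LINT \<omega>|M. norm (f (n + n0) \<omega>)) \<longlonglongrightarrow> 0"
    using pos by (subst (asm) tendsto_ennreal_iff) (auto intro!: always_eventually)
  from tendsto_L1_AE_subseq[OF int this] obtain s where
    "strict_mono s" "AE \<omega> in M. (\<lambda>n. f (s n + n0) \<omega>) \<longlonglongrightarrow> 0" by auto
  then show ?thesis by (intro that[of "\<lambda>n. s n + n0"]) (auto simp: strict_mono_def)
qed

text \<open>The functions differ inside a null set, all of whose subsets belong to \<open>F\<close>
  by completeness. This preserves adaptedness under the almost sure identities in which the scheme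
  is given.\<close>

lemma borel_measurable_complete_AE:
  fixes f g :: "'w \<Rightarrow> 'a::topological_space"
  assumes cM: "complete_measure M" and sub: "subalgebra M F" and null: "null_sets M \<subseteq> sets F"
    and f[measurable]: "f \<in> borel_measurable F" and eq: "AE \<omega> in M. f \<omega> = g \<omega>"
  shows "g \<in> borel_measurable F"
proof -
  have sp: "space F = space M" using sub by (simp add: subalgebra_def)
  obtain N where N: "N \<in> null_sets M" "{\<omega>\<in>space M. f \<omega> \<noteq> g \<omega>} \<subseteq> N"
    using eq by (auto elim!: AE_E intro: null_setsI)
  show ?thesis
  proof (rule measurableI)
    fix A :: "'a set" assume A: "A \<in> sets borel"
    have [measurable]: "N \<in> sets F" using N null by auto
    have "g -` A \<inter> N \<inter> space M \<in> sets M"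
      using complete_measure.complete[OF cM, of "g -` A \<inter> N \<inter> space M" N] N(1) by auto
    then have "g -` A \<inter> N \<inter> space M \<in> null_sets M" by (rule null_sets_subset[OF N(1)]) auto
    from subsetD[OF null this] have [measurable]: "g -` A \<inter> N \<inter> space M \<in> sets F" .
    have "g -` A \<inter> space F = (f -` A \<inter> space F - N) \<union> (g -` A \<inter> N \<inter> space M)"
      using N(2) sp by auto
    also have "\<dots> \<in> sets F" using A by measurable
    finally show "g -` A \<inter> space F \<in> sets F" .
  qed simp
qed

section \<open>One step of the scheme\<close>

lemma integral_le_of_nn_integral_le:
  fixes f g :: "'w \<Rightarrow> real"
  assumes "integrable M f" "integrable M g" "\<And>\<omega>. 0 \<le> f \<omega>" "\<And>\<omega>. 0 \<le> g \<omega>"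
    and "(\<integral>\<^sup>+\<omega>. ennreal (f \<omega>) \<partial>M) \<le> (\<integral>\<^sup>+\<omega>. ennreal (g \<omega>) \<partial>M)"
  shows "integral\<^sup>L M f \<le> integral\<^sup>L M g"
  using assms(5) nn_integral_eq_integral[OF assms(1)] nn_integral_eq_integral[OF assms(2)] assms(3,4)
  by (simp add: integral_nonneg)

lemma integrable_bounded_mult:
  fixes f g :: "'w \<Rightarrow> real"
  assumes "integrable M f" "g \<in> borel_measurable M" "\<And>\<omega>. \<bar>g \<omega>\<bar> \<le> c"
  shows "integrable M (\<lambda>\<omega>. g \<omega> * f \<omega>)"
proof (rule Bochner_Integration.integrable_bound[of M "\<lambda>\<omega>. c * f \<omega>"])
  show "AE \<omega> in M. norm (g \<omega> * f \<omega>) \<le> norm (c * f \<omega>)"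
    using assms(3) by (auto simp: abs_mult intro!: mult_right_mono order_trans[OF assms(3) abs_ge_self])
qed (use assms in auto)

lemma norm_add_square_Young:
  fixes u v :: "'a::real_normed_vector"
  assumes "0 < d"
  shows "(norm (u + v))\<^sup>2 \<le> (1 + 1 / d) * (norm u)\<^sup>2 + (1 + d) * (norm v)\<^sup>2"
proof -
  have "0 \<le> (norm u - d * norm v)\<^sup>2 / d" using assms by simp
  also have "\<dots> = (norm u)\<^sup>2 / d + d * (norm v)\<^sup>2 - 2 * norm u * norm v"
    using assms by (simp add: power2_eq_square field_simps)
  finally have "2 * norm u * norm v \<le> (norm u)\<^sup>2 / d + d * (norm v)\<^sup>2" by simp
  moreover have "(norm (u + v))\<^sup>2 \<le> (norm u + norm v)\<^sup>2" by (intro power_mono norm_triangle_ineq) auto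
  ultimately show ?thesis by (simp add: power2_eq_square algebra_simps)
qed

lemma sum_power_even_le:
  fixes a b :: real
  assumes "0 \<le> a" "0 \<le> b"
  shows "(a + b) ^ (2 * m) \<le> 4 ^ m * (a ^ (2 * m) + b ^ (2 * m))"
proof -
  have "(a + b) ^ (2 * m) \<le> (2 * max a b) ^ (2 * m)" using assms by (intro power_mono) auto
  also have "\<dots> = 4 ^ m * (max a b) ^ (2 * m)" by (simp add: power_mult_distrib power_mult)
  also have "\<dots> \<le> 4 ^ m * (a ^ (2 * m) + b ^ (2 * m))"
    using assms by (intro mult_left_mono) (auto simp: max_def)
  finally show ?thesis .
qed

text \<open>The noise \<xi> enters only through its vanishing mean against bounded past vectors, a
  conditional variance bound and a conditional bound on its moment of order \<open>2 * m\<close>. In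
  the expansion along \<open>k *\<^sub>R f + \<xi>\<close> the linear noise term drops out, Young's
  inequality with parameter \<open>d\<close> separates the squares of drift and noise, and the terms
  of first order in \<open>k\<close> combine to the left side of the coercivity hypothesis. What
  remains is at most \<open>c2 * k\<close>.\<close>

lemma (in prob_space) euler_step_moment:
  fixes x f \<xi> :: "'a \<Rightarrow> 'y::{real_inner,banach,second_countable_topology}" and \<gamma> :: "'a \<Rightarrow> real"
  assumes sub: "subalgebra M F"
    and xF[measurable]: "x \<in> borel_measurable F" and fF[measurable]: "f \<in> borel_measurable F"
    and \<gamma>F[measurable]: "\<gamma> \<in> borel_measurable F" and \<xi>M[measurable]: "\<xi> \<in> borel_measurable M"
    and fL: "\<And>\<omega>. norm (f \<omega>) \<le> L" and \<gamma>L: "\<And>\<omega>. 0 \<le> \<gamma> \<omega>" "\<And>\<omega>. \<gamma> \<omega> \<le> L"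
    and mean: "\<And>y c. y \<in> borel_measurable F \<Longrightarrow> (\<And>\<omega>. norm (y \<omega>) \<le> c) \<Longrightarrow> (LINT \<omega>|M. y \<omega> \<bullet> \<xi> \<omega>) = 0"
    and var: "\<And>B. B \<in> sets F \<Longrightarrow> (\<integral>\<^sup>+\<omega>. indicator B \<omega> * ennreal ((norm (\<xi> \<omega>))\<^sup>2) \<partial>M)
       \<le> (\<integral>\<^sup>+\<omega>. indicator B \<omega> * ennreal (k * (\<gamma> \<omega>)\<^sup>2) \<partial>M)"
    and mom: "\<And>B. B \<in> sets F \<Longrightarrow> (\<integral>\<^sup>+\<omega>. indicator B \<omega> * ennreal (norm (\<xi> \<omega>) ^ (2 * m)) \<partial>M)
       \<le> (\<integral>\<^sup>+\<omega>. indicator B \<omega> * ennreal b \<partial>M)"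
    and nn: "0 \<le> b" "0 \<le> k" "0 \<le> a" "0 \<le> C" "2 \<le> r" "0 < d" "0 \<le> c1" "0 \<le> c2"
    and expan: "\<And>x y :: 'y. (1 + (norm (x + y))\<^sup>2) powr (r / 2) \<le> (1 + (norm x)\<^sup>2) powr (r / 2 - 1) *
         (1 + (norm x)\<^sup>2 + r * (x \<bullet> y) + a * (norm y)\<^sup>2 + C * norm y ^ (2 * m))"
    and coer: "\<And>\<omega>. r * (x \<omega> \<bullet> f \<omega>) + a * (1 + d) * (\<gamma> \<omega>)\<^sup>2 \<le> c1 * (1 + (norm (x \<omega>))\<^sup>2)"
    and small: "a * (1 + 1 / d) * (k * L)\<^sup>2 + C * 4 ^ m * ((k * L) ^ (2 * m) + b) \<le> c2 * k"
    and B: "B \<in> sets F"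
  shows "(\<integral>\<^sup>+\<omega>. indicator B \<omega> * ennreal ((1 + (norm (x \<omega> + (k *\<^sub>R f \<omega> + \<xi> \<omega>)))\<^sup>2) powr (r / 2)) \<partial>M)
    \<le> (\<integral>\<^sup>+\<omega>. indicator B \<omega> * ennreal ((1 + (c1 + c2) * k) * (1 + (norm (x \<omega>))\<^sup>2) powr (r / 2)) \<partial>M)"
proof -
  have sp: "space F = space M" using sub by (simp add: subalgebra_def)
  have L0: "0 \<le> L" using \<gamma>L[of undefined] by linarith
  note [measurable] = measurable_from_subalg[OF sub xF] measurable_from_subalg[OF sub fF] measurable_from_subalg[OF sub \<gamma>F]
  \<comment> \<open>On these past sets \<open>x\<close> is bounded, which makes the four terms below
    integrable and turns the coefficient of the linear noise term into a bounded vector, as the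
    mean-zero hypothesis demands.\<close>
  define A where "A n = {\<omega>\<in>space F. norm (x \<omega>) \<le> real n}" for n
  have AF: "A n \<in> sets F" for n unfolding A_def by measurable
  have FM: "X \<in> sets M" if "X \<in> sets F" for X using that sub by (auto simp: subalgebra_def)
  note [measurable] = FM[OF AF] FM[OF B]
  show ?thesis
  proof (rule nn_integral_le_exhaust[where A=A])
    show "incseq A" by (auto simp: A_def incseq_def)
    show "space M \<subseteq> (\<Union>n. A n)" using real_arch_simple by (auto simp: A_def sp)
  next
    fix n
    have B'F[measurable]: "B \<inter> A n \<in> sets F" using B AF by auto
    note [measurable] = FM[OF B'F]
    define g where "g \<omega> = indicator (B \<inter> A n) \<omega> * (1 + (norm (x \<omega>))\<^sup>2) powr (r / 2 - 1)" for \<omega>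
    have gF[measurable]: "g \<in> borel_measurable F" unfolding g_def[abs_def] by measurable
    have gE: "(\<lambda>\<omega>. ennreal (g \<omega>)) \<in> borel_measurable F" by measurable
    note [measurable] = measurable_from_subalg[OF sub gF]
    define Kn where "Kn = (1 + (real n)\<^sup>2) powr (r / 2 - 1)"
    have g0: "0 \<le> g \<omega>" for \<omega> by (simp add: g_def)
    have gK: "g \<omega> \<le> Kn" for \<omega>
      using nn(5) by (auto simp: g_def Kn_def A_def indicator_def intro!: powr_mono2 power_mono)
    have gx: "norm (g \<omega> *\<^sub>R x \<omega>) \<le> Kn * real n" for \<omega>
    proof (cases "\<omega> \<in> A n")
      case True
      then show ?thesis using g0[of \<omega>] gK[of \<omega>] by (auto simp: A_def intro!: mult_mono order_trans[OF g0 gK])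
    next
      case False then show ?thesis by (simp add: g_def Kn_def)
    qed
    have gabs: "\<bar>g \<omega>\<bar> \<le> Kn" for \<omega> using g0 gK by simp
    have i\<gamma>: "integrable M (\<lambda>\<omega>. k * (\<gamma> \<omega>)\<^sup>2)"
      by (rule integrable_const_bound[where B="k * L\<^sup>2"]) (use nn \<gamma>L in \<open>auto intro!: mult_left_mono power_mono\<close>)
    have i2: "integrable M (\<lambda>\<omega>. (norm (\<xi> \<omega>))\<^sup>2)"
    proof (rule integrableI_nonneg)
      have "(\<integral>\<^sup>+\<omega>. ennreal ((norm (\<xi> \<omega>))\<^sup>2) \<partial>M) = (\<integral>\<^sup>+\<omega>. indicator (space F) \<omega> * ennreal ((norm (\<xi> \<omega>))\<^sup>2) \<partial>M)"
        by (intro nn_integral_cong) (auto simp: sp)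
      also have "\<dots> \<le> (\<integral>\<^sup>+\<omega>. indicator (space F) \<omega> * ennreal (k * (\<gamma> \<omega>)\<^sup>2) \<partial>M)" by (rule var) auto
      also have "\<dots> \<le> (\<integral>\<^sup>+\<omega>. ennreal (k * (\<gamma> \<omega>)\<^sup>2) \<partial>M)"
        by (intro nn_integral_mono) (auto simp: indicator_def)
      also have "\<dots> < \<infinity>" using nn_integral_eq_integral[OF i\<gamma>] nn by simp
      finally show "(\<integral>\<^sup>+\<omega>. ennreal ((norm (\<xi> \<omega>))\<^sup>2) \<partial>M) < \<infinity>" .
    qed auto
    have im: "integrable M (\<lambda>\<omega>. norm (\<xi> \<omega>) ^ (2 * m))"
    proof (rule integrableI_nonneg)
      have "(\<integral>\<^sup>+\<omega>. ennreal (norm (\<xi> \<omega>) ^ (2 * m)) \<partial>M) = (\<integral>\<^sup>+\<omega>. indicator (space F) \<omega> * ennreal (norm (\<xi> \<omega>) ^ (2 * m)) \<partial>M)"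
        by (intro nn_integral_cong) (auto simp: sp)
      also have "\<dots> \<le> (\<integral>\<^sup>+\<omega>. indicator (space F) \<omega> * ennreal b \<partial>M)" by (rule mom) auto
      also have "\<dots> \<le> (\<integral>\<^sup>+\<omega>. ennreal b \<partial>M)"
        by (intro nn_integral_mono) (auto simp: indicator_def)
      also have "\<dots> < \<infinity>" by (simp add: emeasure_space_1)
      finally show "(\<integral>\<^sup>+\<omega>. ennreal (norm (\<xi> \<omega>) ^ (2 * m)) \<partial>M) < \<infinity>" .
    qed auto
    have i1: "integrable M (\<lambda>\<omega>. (g \<omega> *\<^sub>R x \<omega>) \<bullet> \<xi> \<omega>)"
    proof (rule Bochner_Integration.integrable_bound[of M "\<lambda>\<omega>. Kn * real n * (1 + (norm (\<xi> \<omega>))\<^sup>2)"])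
      show "integrable M (\<lambda>\<omega>. Kn * real n * (1 + (norm (\<xi> \<omega>))\<^sup>2))" using i2 by simp
      show "AE \<omega> in M. norm ((g \<omega> *\<^sub>R x \<omega>) \<bullet> \<xi> \<omega>) \<le> norm (Kn * real n * (1 + (norm (\<xi> \<omega>))\<^sup>2))"
      proof (rule AE_I2)
        fix \<omega>
        have "norm (\<xi> \<omega>) \<le> 1 + (norm (\<xi> \<omega>))\<^sup>2"
          using zero_le_power2[of "2 * norm (\<xi> \<omega>) - 1"]
          by (simp add: power2_eq_square algebra_simps)
        then have "norm (g \<omega> *\<^sub>R x \<omega>) * norm (\<xi> \<omega>) \<le> Kn * real n * (1 + (norm (\<xi> \<omega>))\<^sup>2)"
          by (intro mult_mono gx) (auto simp: Kn_def)
        moreover have "norm ((g \<omega> *\<^sub>R x \<omega>) \<bullet> \<xi> \<omega>) \<le> norm (g \<omega> *\<^sub>R x \<omega>) * norm (\<xi> \<omega>)"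
          by (simp add: Cauchy_Schwarz_ineq2 del: inner_scaleR_left norm_scaleR)
        ultimately show "norm ((g \<omega> *\<^sub>R x \<omega>) \<bullet> \<xi> \<omega>) \<le> norm (Kn * real n * (1 + (norm (\<xi> \<omega>))\<^sup>2))" 
          by (simp add: Kn_def del: inner_scaleR_left norm_scaleR)
      qed
    qed measurable
    define K1 where "K1 = a * (1 + 1 / d) * (k * L)\<^sup>2 + C * 4 ^ m * (k * L) ^ (2 * m)"
    define K2 where "K2 = C * 4 ^ m"
    have K: "0 \<le> K1" "0 \<le> K2" using nn L0 by (auto simp: K1_def K2_def)
    have K12: "K1 + K2 * b \<le> c2 * k" using small by (simp add: K1_def K2_def algebra_simps)
    \<comment> \<open>\<open>T1\<close> is known from the past, \<open>T2\<close> is the linear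
      noise term, \<open>T3\<close> the quadratic one and \<open>T4\<close> the remainder of order
      \<open>2 * m\<close>; \<open>K1\<close> collects the deterministic drift errors.\<close>
    define T1 where "T1 \<omega> = g \<omega> * (1 + (norm (x \<omega>))\<^sup>2 + k * r * (x \<omega> \<bullet> f \<omega>) + K1)" for \<omega>
    define T2 where "T2 \<omega> = r * ((g \<omega> *\<^sub>R x \<omega>) \<bullet> \<xi> \<omega>)" for \<omega>
    define T3 where "T3 \<omega> = a * (1 + d) * (g \<omega> * (norm (\<xi> \<omega>))\<^sup>2)" for \<omega>
    define T4 where "T4 \<omega> = K2 * (g \<omega> * norm (\<xi> \<omega>) ^ (2 * m))" for \<omega>
    have iT1: "integrable M T1"
    proof (rule integrable_const_bound[where B="Kn * (1 + (real n)\<^sup>2 + k * r * (real n * L) + K1)"])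
      show "AE \<omega> in M. norm (T1 \<omega>) \<le> Kn * (1 + (real n)\<^sup>2 + k * r * (real n * L) + K1)"
      proof (rule AE_I2)
        fix \<omega>
        show "norm (T1 \<omega>) \<le> Kn * (1 + (real n)\<^sup>2 + k * r * (real n * L) + K1)"
        proof (cases "\<omega> \<in> A n")
          case True
          then have xn: "norm (x \<omega>) \<le> real n" by (simp add: A_def)
          have "\<bar>x \<omega> \<bullet> f \<omega>\<bar> \<le> norm (x \<omega>) * norm (f \<omega>)" by (rule Cauchy_Schwarz_ineq2)
          also have "\<dots> \<le> real n * L" by (intro mult_mono xn fL) auto
          finally have "k * r * \<bar>x \<omega> \<bullet> f \<omega>\<bar> \<le> k * r * (real n * L)" using nn by (intro mult_left_mono) auto
          moreover have "\<bar>k * r * (x \<omega> \<bullet> f \<omega>)\<bar> = k * r * \<bar>x \<omega> \<bullet> f \<omega>\<bar>" using nn by (simp add: abs_mult)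
          moreover have "(norm (x \<omega>))\<^sup>2 \<le> (real n)\<^sup>2" using xn by (intro power_mono) auto
          ultimately have "\<bar>1 + (norm (x \<omega>))\<^sup>2 + k * r * (x \<omega> \<bullet> f \<omega>) + K1\<bar> \<le> 1 + (real n)\<^sup>2 + k * r * (real n * L) + K1"
            using K zero_le_power2[of "norm (x \<omega>)"] by linarith
          then show ?thesis unfolding T1_def real_norm_def abs_mult by (intro mult_mono gabs) (auto simp: Kn_def)
        next
          case False
          then show ?thesis using K nn L0 by (simp add: T1_def g_def Kn_def)
        qed
      qed
      show "T1 \<in> borel_measurable M" unfolding T1_def[abs_def] by measurable
    qed
    have iT2: "integrable M T2" unfolding T2_def[abs_def] using i1 by (rule integrable_mult_right)
    have ig2: "integrable M (\<lambda>\<omega>. g \<omega> * (norm (\<xi> \<omega>))\<^sup>2)" by (rule integrable_bounded_mult[OF i2 _ gabs]) measurable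
    have igm: "integrable M (\<lambda>\<omega>. g \<omega> * norm (\<xi> \<omega>) ^ (2 * m))" by (rule integrable_bounded_mult[OF im _ gabs]) measurable
    have ig\<gamma>: "integrable M (\<lambda>\<omega>. g \<omega> * (k * (\<gamma> \<omega>)\<^sup>2))" by (rule integrable_bounded_mult[OF i\<gamma> _ gabs]) measurable
    have igb: "integrable M (\<lambda>\<omega>. g \<omega> * b)" by (rule integrable_bounded_mult[OF _ _ gabs]) auto
    have iT3: "integrable M T3" unfolding T3_def[abs_def] using ig2 by (rule integrable_mult_right)
    have iT4: "integrable M T4" unfolding T4_def[abs_def] using igm by (rule integrable_mult_right)
    have I2: "integral\<^sup>L M T2 = 0"
    proof -
      have "(LINT \<omega>|M. (g \<omega> *\<^sub>R x \<omega>) \<bullet> \<xi> \<omega>) = 0" by (rule mean[OF _ gx]) measurable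
      then show ?thesis by (simp add: T2_def[abs_def] del: inner_scaleR_left)
    qed
    have I3: "integral\<^sup>L M T3 \<le> a * (1 + d) * (LINT \<omega>|M. g \<omega> * (k * (\<gamma> \<omega>)\<^sup>2))"
    proof -
      have "(\<integral>\<^sup>+\<omega>. ennreal (g \<omega>) * ennreal ((norm (\<xi> \<omega>))\<^sup>2) \<partial>M) \<le> (\<integral>\<^sup>+\<omega>. ennreal (g \<omega>) * ennreal (k * (\<gamma> \<omega>)\<^sup>2) \<partial>M)"
        by (rule nn_integral_subalgebra_mono[OF sub _ _ var gE]) measurable
      then have "(LINT \<omega>|M. g \<omega> * (norm (\<xi> \<omega>))\<^sup>2) \<le> (LINT \<omega>|M. g \<omega> * (k * (\<gamma> \<omega>)\<^sup>2))"
        using g0 nn by (intro integral_le_of_nn_integral_le ig2 ig\<gamma>) (simp_all add: ennreal_mult)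
      then show ?thesis using nn by (simp add: T3_def[abs_def] mult_left_mono)
    qed
    have I4: "integral\<^sup>L M T4 \<le> K2 * (LINT \<omega>|M. g \<omega> * b)"
    proof -
      have "(\<integral>\<^sup>+\<omega>. ennreal (g \<omega>) * ennreal (norm (\<xi> \<omega>) ^ (2 * m)) \<partial>M) \<le> (\<integral>\<^sup>+\<omega>. ennreal (g \<omega>) * ennreal b \<partial>M)"
        by (rule nn_integral_subalgebra_mono[OF sub _ _ mom gE]) measurable
      then have "(LINT \<omega>|M. g \<omega> * norm (\<xi> \<omega>) ^ (2 * m)) \<le> (LINT \<omega>|M. g \<omega> * b)"
        using g0 nn by (intro integral_le_of_nn_integral_le igm igb) (simp_all add: ennreal_mult)
      then show ?thesis using K by (simp add: T4_def[abs_def] mult_left_mono)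
    qed
    define R where "R \<omega> = (1 + (c1 + c2) * k) * (indicator (B \<inter> A n) \<omega> * (1 + (norm (x \<omega>))\<^sup>2) powr (r / 2))" for \<omega>
    have R_eq: "R \<omega> = (1 + (c1 + c2) * k) * (g \<omega> * (1 + (norm (x \<omega>))\<^sup>2))" for \<omega>
    proof -
      have "(1 + (norm (x \<omega>))\<^sup>2) powr (r / 2) = (1 + (norm (x \<omega>))\<^sup>2) powr (r / 2 - 1) * (1 + (norm (x \<omega>))\<^sup>2) powr 1"
        by (subst powr_add[symmetric]) simp
      then show ?thesis by (simp add: R_def g_def add_nonneg_nonneg)
    qed
    have R0: "0 \<le> R \<omega>" for \<omega> using nn by (simp add: R_def)
    have iR: "integrable M R"
    proof (rule integrable_const_bound[where B="(1 + (c1 + c2) * k) * (Kn * (1 + (real n)\<^sup>2))"])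
      have "R \<omega> \<le> (1 + (c1 + c2) * k) * (Kn * (1 + (real n)\<^sup>2))" for \<omega>
      proof (cases "\<omega> \<in> A n")
        case True
        then show ?thesis using nn g0 gK unfolding R_eq
          by (intro mult_left_mono mult_mono) (auto simp: A_def Kn_def intro!: power_mono)
      next
        case False then show ?thesis using nn by (simp add: R_def Kn_def)
      qed
      then show "AE \<omega> in M. norm (R \<omega>) \<le> (1 + (c1 + c2) * k) * (Kn * (1 + (real n)\<^sup>2))" using R0 by simp
      show "R \<in> borel_measurable M" unfolding R_def[abs_def] by measurable
    qed
    have pw: "indicator (B \<inter> A n) \<omega> * (1 + (norm (x \<omega> + (k *\<^sub>R f \<omega> + \<xi> \<omega>)))\<^sup>2) powr (r / 2)
      \<le> T1 \<omega> + T2 \<omega> + T3 \<omega> + T4 \<omega>" for \<omega>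
    proof -
      let ?y = "k *\<^sub>R f \<omega> + \<xi> \<omega>"
      have kf: "norm (k *\<^sub>R f \<omega>) \<le> k * L" using nn fL by (simp add: mult_left_mono)
      have y2: "(norm ?y)\<^sup>2 \<le> (1 + 1 / d) * (k * L)\<^sup>2 + (1 + d) * (norm (\<xi> \<omega>))\<^sup>2"
        using norm_add_square_Young[OF nn(6), of "k *\<^sub>R f \<omega>" "\<xi> \<omega>"] power_mono[OF kf norm_ge_zero, of 2] nn
          mult_left_mono[of "(norm (k *\<^sub>R f \<omega>))\<^sup>2" "(k * L)\<^sup>2" "1 + 1 / d"] by auto
      have "norm ?y ^ (2 * m) \<le> (k * L + norm (\<xi> \<omega>)) ^ (2 * m)"
        using norm_triangle_ineq[of "k *\<^sub>R f \<omega>" "\<xi> \<omega>"] kf by (intro power_mono) auto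
      also have "\<dots> \<le> 4 ^ m * ((k * L) ^ (2 * m) + norm (\<xi> \<omega>) ^ (2 * m))"
        using nn L0 by (intro sum_power_even_le) auto
      finally have ym: "norm ?y ^ (2 * m) \<le> 4 ^ m * ((k * L) ^ (2 * m) + norm (\<xi> \<omega>) ^ (2 * m))" .
      have "indicator (B \<inter> A n) \<omega> * (1 + (norm (x \<omega> + ?y))\<^sup>2) powr (r / 2)
        \<le> indicator (B \<inter> A n) \<omega> * ((1 + (norm (x \<omega>))\<^sup>2) powr (r / 2 - 1) *
         (1 + (norm (x \<omega>))\<^sup>2 + r * (x \<omega> \<bullet> ?y) + a * (norm ?y)\<^sup>2 + C * norm ?y ^ (2 * m)))"
        by (intro mult_left_mono expan) auto
      also have "\<dots> = g \<omega> * (1 + (norm (x \<omega>))\<^sup>2 + r * (x \<omega> \<bullet> ?y) + a * (norm ?y)\<^sup>2 + C * norm ?y ^ (2 * m))"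
        by (simp add: g_def)
      also have "\<dots> \<le> g \<omega> * (1 + (norm (x \<omega>))\<^sup>2 + r * (x \<omega> \<bullet> ?y) + a * ((1 + 1 / d) * (k * L)\<^sup>2 + (1 + d) * (norm (\<xi> \<omega>))\<^sup>2)
          + C * (4 ^ m * ((k * L) ^ (2 * m) + norm (\<xi> \<omega>) ^ (2 * m))))"
        using nn g0 y2 ym by (intro mult_left_mono add_mono order_refl) auto
      also have "\<dots> = T1 \<omega> + T2 \<omega> + T3 \<omega> + T4 \<omega>"
        by (simp add: T1_def T2_def T3_def T4_def K1_def K2_def inner_add_right algebra_simps)
      finally show ?thesis .
    qed
    \<comment> \<open>The single terms have no sign, but their sum dominates a nonnegative function;
      its extended integral is therefore a Bochner integral, which can be split by
      linearity.\<close>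
    have T0: "0 \<le> T1 \<omega> + T2 \<omega> + T3 \<omega> + T4 \<omega>" for \<omega> by (rule order_trans[OF _ pw]) simp
    have "(\<integral>\<^sup>+\<omega>. indicator (B \<inter> A n) \<omega> * ennreal ((1 + (norm (x \<omega> + (k *\<^sub>R f \<omega> + \<xi> \<omega>)))\<^sup>2) powr (r / 2)) \<partial>M)
      \<le> (\<integral>\<^sup>+\<omega>. ennreal (T1 \<omega> + T2 \<omega> + T3 \<omega> + T4 \<omega>) \<partial>M)"
    proof (intro nn_integral_mono)
      fix \<omega>
      show "indicator (B \<inter> A n) \<omega> * ennreal ((1 + (norm (x \<omega> + (k *\<^sub>R f \<omega> + \<xi> \<omega>)))\<^sup>2) powr (r / 2))
        \<le> ennreal (T1 \<omega> + T2 \<omega> + T3 \<omega> + T4 \<omega>)"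
        using pw[of \<omega>] T0[of \<omega>] by (auto simp: indicator_def intro!: ennreal_leI split: if_splits)
    qed
    also have "\<dots> = ennreal (LINT \<omega>|M. T1 \<omega> + T2 \<omega> + T3 \<omega> + T4 \<omega>)"
      using T0 iT1 iT2 iT3 iT4 by (intro nn_integral_eq_integral) auto
    also have "(LINT \<omega>|M. T1 \<omega> + T2 \<omega> + T3 \<omega> + T4 \<omega>) \<le> integral\<^sup>L M T1 + a * (1 + d) * (LINT \<omega>|M. g \<omega> * (k * (\<gamma> \<omega>)\<^sup>2)) + K2 * (LINT \<omega>|M. g \<omega> * b)"
      using iT1 iT2 iT3 iT4 I2 I3 I4 by simp
    also have "\<dots> = (LINT \<omega>|M. T1 \<omega> + a * (1 + d) * (g \<omega> * (k * (\<gamma> \<omega>)\<^sup>2)) + K2 * (g \<omega> * b))"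
      using iT1 ig\<gamma> igb by simp
    also have "\<dots> \<le> integral\<^sup>L M R"
    proof (rule integral_mono)
      show "integrable M (\<lambda>\<omega>. T1 \<omega> + a * (1 + d) * (g \<omega> * (k * (\<gamma> \<omega>)\<^sup>2)) + K2 * (g \<omega> * b))"
        using iT1 ig\<gamma> igb by (intro Bochner_Integration.integrable_add integrable_mult_right)
      show "integrable M R" by (rule iR)
      fix \<omega>
      let ?\<rho> = "1 + (norm (x \<omega>))\<^sup>2"
      have "T1 \<omega> + a * (1 + d) * (g \<omega> * (k * (\<gamma> \<omega>)\<^sup>2)) + K2 * (g \<omega> * b)
        = g \<omega> * (?\<rho> + k * (r * (x \<omega> \<bullet> f \<omega>) + a * (1 + d) * (\<gamma> \<omega>)\<^sup>2) + (K1 + K2 * b))"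
        by (simp add: T1_def algebra_simps)
      also have "\<dots> \<le> g \<omega> * (?\<rho> + k * (c1 * ?\<rho>) + c2 * k * ?\<rho>)"
      proof (intro mult_left_mono[OF _ g0] add_mono order_refl)
        show "k * (r * (x \<omega> \<bullet> f \<omega>) + a * (1 + d) * (\<gamma> \<omega>)\<^sup>2) \<le> k * (c1 * ?\<rho>)"
          by (intro mult_left_mono coer nn)
        \<comment> \<open>Since \<open>?\<rho> \<ge> 1\<close>, the additive error can be written as
          a multiplicative one.\<close>
        have "c2 * k * 1 \<le> c2 * k * ?\<rho>" using nn by (intro mult_left_mono) auto
        then show "K1 + K2 * b \<le> c2 * k * ?\<rho>" using K12 by simp
      qed
      also have "\<dots> = R \<omega>" unfolding R_eq by (simp add: algebra_simps)
      finally show "T1 \<omega> + a * (1 + d) * (g \<omega> * (k * (\<gamma> \<omega>)\<^sup>2)) + K2 * (g \<omega> * b) \<le> R \<omega>" .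
    qed
    also have "ennreal (integral\<^sup>L M R) = (\<integral>\<^sup>+\<omega>. ennreal (R \<omega>) \<partial>M)"
      using iR R0 by (intro nn_integral_eq_integral[symmetric]) auto
    also have "\<dots> = (\<integral>\<^sup>+\<omega>. indicator (B \<inter> A n) \<omega> * ennreal ((1 + (c1 + c2) * k) * (1 + (norm (x \<omega>))\<^sup>2) powr (r / 2)) \<partial>M)"
      by (intro nn_integral_cong) (auto simp: R_def indicator_def)
    finally show "(\<integral>\<^sup>+\<omega>. indicator (B \<inter> A n) \<omega> * ennreal ((1 + (norm (x \<omega> + (k *\<^sub>R f \<omega> + \<xi> \<omega>)))\<^sup>2) powr (r / 2)) \<partial>M)
      \<le> (\<integral>\<^sup>+\<omega>. indicator (B \<inter> A n) \<omega> * ennreal ((1 + (c1 + c2) * k) * (1 + (norm (x \<omega>))\<^sup>2) powr (r / 2)) \<partial>M)"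
      by (simp add: ennreal_leI)
  qed measurable
qed

section \<open>Moments of the noise\<close>

lemma (in prob_space) gaussian_square_integrable:
  assumes "gaussian M X"
  shows "integrable M (\<lambda>\<omega>. (X \<omega>)\<^sup>2)"
proof -
  have [measurable]: "X \<in> borel_measurable M" using assms by (simp add: gaussian_def)
  show ?thesis
  proof (cases "\<exists>m. AE \<omega> in M. X \<omega> = m")
    case True
    then obtain m where "AE \<omega> in M. X \<omega> = m" by blast
    then have "AE \<omega> in M. m\<^sup>2 = (X \<omega>)\<^sup>2" by eventually_elim simp
    then show ?thesis by (rule integrable_cong_AE_imp[rotated 2]) auto
  next
    case False
    then obtain m \<sigma> where s: "\<sigma> > 0" and d: "distributed M lborel X (normal_density m \<sigma>)"
      using assms by (auto simp: gaussian_def)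
    have "integrable M (\<lambda>\<omega>. (X \<omega> - m) ^ 2)"
      using integrable_normal_moment[OF s, of m 2]
      by (subst (asm) distributed_integrable[OF d]) auto
    then have "integrable M (\<lambda>\<omega>. 2 * (X \<omega> - m)\<^sup>2 + 2 * m\<^sup>2)" by simp
    moreover have "(X \<omega>)\<^sup>2 \<le> 2 * (X \<omega> - m)\<^sup>2 + 2 * m\<^sup>2" for \<omega>
      using zero_le_power2[of "X \<omega> - 2 * m"] by (simp add: power2_eq_square algebra_simps)
    ultimately show ?thesis by (intro Bochner_Integration.integrable_bound[of M "\<lambda>\<omega>. 2 * (X \<omega> - m)\<^sup>2 + 2 * m\<^sup>2" "\<lambda>\<omega>. (X \<omega>)\<^sup>2"]) auto
  qed
qed

text \<open>\<open>gaussian\<close> admits almost surely constant variables; a centred one is zero,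
  and both sides are then 1 for \<open>m = 0\<close> and 0 otherwise. In the other case these are
  the even central moments of the normal density.\<close>

lemma (in prob_space) centered_gaussian_moment:
  fixes X :: "'a \<Rightarrow> real"
  assumes X: "gaussian M X" and mean: "expectation X = 0"
  shows "integrable M (\<lambda>\<omega>. X \<omega> ^ (2 * m))"
    and "expectation (\<lambda>\<omega>. X \<omega> ^ (2 * m)) = fact (2 * m) / (2 ^ m * fact m) * (expectation (\<lambda>\<omega>. (X \<omega>)\<^sup>2)) ^ m"
proof -
  have [measurable]: "X \<in> borel_measurable M" using X by (simp add: gaussian_def)
  have "integrable M (\<lambda>\<omega>. X \<omega> ^ (2 * m)) \<and>
    expectation (\<lambda>\<omega>. X \<omega> ^ (2 * m)) = fact (2 * m) / (2 ^ m * fact m) * (expectation (\<lambda>\<omega>. (X \<omega>)\<^sup>2)) ^ m"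
  proof (cases "\<exists>c. AE \<omega> in M. X \<omega> = c")
    case True
    then obtain c where c: "AE \<omega> in M. X \<omega> = c" by blast
    then have "expectation X = expectation (\<lambda>_. c)" by (intro integral_cong_AE) auto
    then have "c = 0" using mean by (simp add: prob_space)
    then have 1: "AE \<omega> in M. X \<omega> ^ (2 * m) = 0 ^ (2 * m)" "AE \<omega> in M. (X \<omega>)\<^sup>2 = 0" using c by auto
    have "integrable M (\<lambda>\<omega>. X \<omega> ^ (2 * m)) \<longleftrightarrow> integrable M (\<lambda>\<omega>. 0 ^ (2 * m) :: real)"
      by (rule integrable_cong_AE) (use 1 in auto)
    moreover have "expectation (\<lambda>\<omega>. X \<omega> ^ (2 * m)) = expectation (\<lambda>\<omega>. 0 ^ (2 * m) :: real)"
      by (rule integral_cong_AE) (use 1 in auto)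
    moreover have "expectation (\<lambda>\<omega>. (X \<omega>)\<^sup>2) = expectation (\<lambda>\<omega>. 0)"
      by (rule integral_cong_AE) (use 1 in auto)
    ultimately show ?thesis by (cases m) (auto simp: prob_space)
  next
    case False
    then obtain c \<sigma> where s: "\<sigma> > 0" and d: "distributed M lborel X (normal_density c \<sigma>)"
      using X by (auto simp: gaussian_def)
    have c0: "c = 0" using normal_distributed_expectation[OF s d] mean by simp
    have var: "expectation (\<lambda>\<omega>. (X \<omega>)\<^sup>2) = \<sigma>\<^sup>2" using normal_distributed_variance[OF s d] mean by simp
    have "integrable M (\<lambda>\<omega>. (X \<omega> - c) ^ (2 * m))"
      using integrable_normal_moment[OF s, of c "2 * m"]
      by (subst (asm) distributed_integrable[OF d]) auto
    moreover have "expectation (\<lambda>\<omega>. (X \<omega> - c) ^ (2 * m)) = fact (2 * m) / ((2 / \<sigma>\<^sup>2) ^ m * fact m)"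
      using integral_normal_moment_even[OF s, of c m]
      by (subst (asm) distributed_integral[OF d]) auto
    ultimately show ?thesis unfolding var using s by (simp add: c0 power_divide field_simps)
  qed
  then show "integrable M (\<lambda>\<omega>. X \<omega> ^ (2 * m))"
    "expectation (\<lambda>\<omega>. X \<omega> ^ (2 * m)) = fact (2 * m) / (2 ^ m * fact m) * (expectation (\<lambda>\<omega>. (X \<omega>)\<^sup>2)) ^ m" by auto
qed

lemma integrable_mult_of_squares:
  fixes f g :: "'w \<Rightarrow> real"
  assumes "integrable M (\<lambda>\<omega>. (f \<omega>)\<^sup>2)" "integrable M (\<lambda>\<omega>. (g \<omega>)\<^sup>2)" "f \<in> borel_measurable M" "g \<in> borel_measurable M"
  shows "integrable M (\<lambda>\<omega>. f \<omega> * g \<omega>)"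
proof (rule Bochner_Integration.integrable_bound[of M "\<lambda>\<omega>. (f \<omega>)\<^sup>2 + (g \<omega>)\<^sup>2"])
  show "AE \<omega> in M. norm (f \<omega> * g \<omega>) \<le> norm ((f \<omega>)\<^sup>2 + (g \<omega>)\<^sup>2)"
  proof (rule AE_I2)
    fix \<omega>
    have "2 * \<bar>f \<omega>\<bar> * \<bar>g \<omega>\<bar> \<le> (f \<omega>)\<^sup>2 + (g \<omega>)\<^sup>2"
      using zero_le_power2[of "\<bar>f \<omega>\<bar> - \<bar>g \<omega>\<bar>"] by (simp add: power2_eq_square algebra_simps)
    moreover have "0 \<le> \<bar>f \<omega>\<bar> * \<bar>g \<omega>\<bar>" by simp
    ultimately have "\<bar>f \<omega>\<bar> * \<bar>g \<omega>\<bar> \<le> (f \<omega>)\<^sup>2 + (g \<omega>)\<^sup>2" by linarith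
    then show "norm (f \<omega> * g \<omega>) \<le> norm ((f \<omega>)\<^sup>2 + (g \<omega>)\<^sup>2)" by (simp add: abs_mult)
  qed
qed (use assms in auto)

section \<open>Step functions of time as elements of L2\<close>

lemma emeasure_lborel_Ioo_finite: "emeasure lborel {a<..<b::real} < \<infinity>"
  by (cases "a \<le> b") auto

abbreviation time_step :: "real \<Rightarrow> real \<Rightarrow> 'h::real_vector \<Rightarrow> real \<Rightarrow> 'h" where
  "time_step s t u \<equiv> \<lambda>\<tau>. indicator {s<..<t} \<tau> *\<^sub>R u"

lemma L2_time_step: "time_step s t (u :: 'h::{real_inner,banach,second_countable_topology}) \<in> L2_time T"
proof -
  have fin: "emeasure (time_measure T) (space (time_measure T)) \<noteq> \<infinity>"
    using emeasure_lborel_Ioo_finite[of 0 T]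
    by (simp add: space_restrict_space emeasure_restrict_space)
  have [measurable]: "time_step s t u \<in> borel_measurable (time_measure T)"
    by (rule measurable_restrict_space1) measurable
  have "integrable (time_measure T) (\<lambda>\<tau>. (norm (time_step s t u \<tau>))\<^sup>2)"
  proof (rule finite_measure.integrable_const_bound[where B="(norm u)\<^sup>2"])
    show "finite_measure (time_measure T)" by (rule finite_measureI) (rule fin)
    show "AE \<tau> in time_measure T. norm ((norm (time_step s t u \<tau>))\<^sup>2) \<le> (norm u)\<^sup>2"
      by (rule AE_I2) (auto simp: indicator_def)
  qed measurable
  then show ?thesis by (simp add: L2_time_def)
qed

lemma integrable_L2_time_inner:
  assumes "b \<in> L2_time T" "b' \<in> L2_time T"
  shows "integrable (time_measure T) (\<lambda>\<tau>. b \<tau> \<bullet> b' \<tau>)"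
proof -
  have [measurable]: "b \<in> borel_measurable (time_measure T)" "b' \<in> borel_measurable (time_measure T)"
    using assms by (auto simp: L2_time_def)
  have "integrable (time_measure T) (\<lambda>\<tau>. norm (b \<tau>) * norm (b' \<tau>))"
    using assms by (intro integrable_mult_of_squares) (auto simp: L2_time_def)
  then show ?thesis
    by (rule Bochner_Integration.integrable_bound) (auto intro!: AE_I2 simp: Cauchy_Schwarz_ineq2 abs_mult)
qed

lemma L2_time_linear:
  assumes b: "b1 \<in> L2_time T" "b2 \<in> L2_time T"
  shows "(\<lambda>\<tau>. c1 *\<^sub>R b1 \<tau> + c2 *\<^sub>R b2 \<tau>) \<in> L2_time T"
proof -
  have [measurable]: "b1 \<in> borel_measurable (time_measure T)" "b2 \<in> borel_measurable (time_measure T)"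
    using assms by (auto simp: L2_time_def)
  have "(\<lambda>\<tau>. (norm (c1 *\<^sub>R b1 \<tau> + c2 *\<^sub>R b2 \<tau>))\<^sup>2) =
    (\<lambda>\<tau>. c1\<^sup>2 * (b1 \<tau> \<bullet> b1 \<tau>) + 2 * c1 * c2 * (b1 \<tau> \<bullet> b2 \<tau>) + c2\<^sup>2 * (b2 \<tau> \<bullet> b2 \<tau>))"
    unfolding power2_norm_eq_inner
    by (simp add: inner_add_left inner_add_right inner_commute power2_eq_square algebra_simps fun_eq_iff)
  moreover have "integrable (time_measure T) \<dots>"
    using integrable_L2_time_inner b by (intro Bochner_Integration.integrable_add integrable_mult_right) blast+
  ultimately show ?thesis by (simp add: L2_time_def)
qed

lemma time_step_inner:
  assumes "0 \<le> s" "0 \<le> s'" "t \<le> T" "t' \<le> T"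
  shows "(\<integral>\<tau>. time_step s t u \<tau> \<bullet> time_step s' t' u' \<tau> \<partial>time_measure T) = max 0 (min t t' - max s s') * (u \<bullet> u')"
proof -
  have "(\<integral>\<tau>. time_step s t u \<tau> \<bullet> time_step s' t' u' \<tau> \<partial>time_measure T) =
    (\<integral>\<tau>. indicator {0<..<T} \<tau> *\<^sub>R (time_step s t u \<tau> \<bullet> time_step s' t' u' \<tau>) \<partial>lborel)"
    by (rule integral_restrict_space) auto
  also have "\<dots> = (\<integral>\<tau>. indicator {max s s'<..<min t t'} \<tau> *\<^sub>R (u \<bullet> u') \<partial>lborel)"
    using assms by (intro Bochner_Integration.integral_cong) (auto simp: indicator_def)
  also have "\<dots> = measure lborel {max s s'<..<min t t'} *\<^sub>R (u \<bullet> u')"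
    using emeasure_lborel_Ioo_finite[of "max s s'" "min t t'"]
    by (subst integral_scaleR_left) (auto intro!: integrable_real_indicator)
  also have "\<dots> = max 0 (min t t' - max s s') * (u \<bullet> u')"
    by (cases "max s s' \<le> min t t'") (auto simp: max_def)
  finally show ?thesis .
qed

section \<open>Measurability, linearity and independence of the noise\<close>

locale cylindrical_noise = prob_space M
  for M :: "'w measure" +
  fixes T :: real and FF :: "real \<Rightarrow> 'w measure"
    and W :: "(real \<Rightarrow> 'h::{real_inner,banach,second_countable_topology}) \<Rightarrow> 'w \<Rightarrow> real"
  assumes T_pos: "0 < T" and usual: "usual_filtration M T FF" and cyl: "cylindrical_BM M T FF W"
begin

lemma FF_subalgebra: "t \<in> {0..T} \<Longrightarrow> subalgebra M (FF t)"
  using usual by (auto simp: usual_filtration_def)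

lemma FF_mono: "0 \<le> s \<Longrightarrow> s \<le> t \<Longrightarrow> t \<le> T \<Longrightarrow> sets (FF s) \<subseteq> sets (FF t)"
  using usual by (auto simp: usual_filtration_def)

lemma FF_subalgebra_mono: "0 \<le> s \<Longrightarrow> s \<le> t \<Longrightarrow> t \<le> T \<Longrightarrow> subalgebra (FF t) (FF s)"
  using FF_subalgebra[of s] FF_subalgebra[of t] FF_mono[of s t] by (auto simp: subalgebra_def)

lemma FF_complete:
  assumes "t \<in> {0..T}" "f \<in> borel_measurable (FF t)" "AE \<omega> in M. f \<omega> = g \<omega>"
  shows "g \<in> borel_measurable (FF t)"
proof -
  have "null_sets M \<subseteq> sets (FF 0)" using usual by (simp add: usual_filtration_def)
  also have "sets (FF 0) \<subseteq> sets (FF t)" using assms(1) by (intro FF_mono) auto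
  finally have "null_sets M \<subseteq> sets (FF t)" .
  moreover have "complete_measure M" using usual by (simp add: usual_filtration_def)
  ultimately show ?thesis
    using borel_measurable_complete_AE FF_subalgebra[OF assms(1)] assms(2,3) by blast
qed

lemma W_gaussian: "b \<in> L2_time T \<Longrightarrow> gaussian M (W b)"
  using cyl by (simp add: cylindrical_BM_def)

lemma W_measurable[measurable]: "b \<in> L2_time T \<Longrightarrow> W b \<in> borel_measurable M"
  using W_gaussian by (auto simp: gaussian_def)

lemma W_square_integrable: "b \<in> L2_time T \<Longrightarrow> integrable M (\<lambda>\<omega>. (W b \<omega>)\<^sup>2)"
  using W_gaussian gaussian_square_integrable by blast

lemma W_integrable: "b \<in> L2_time T \<Longrightarrow> integrable M (W b)"
  using square_integrable_imp_integrable[OF W_measurable W_square_integrable] by blast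

lemma W_cov:
  "b \<in> L2_time T \<Longrightarrow> b' \<in> L2_time T \<Longrightarrow> (\<integral>\<omega>. W b \<omega> * W b' \<omega> \<partial>M) = (\<integral>\<tau>. b \<tau> \<bullet> b' \<tau> \<partial>time_measure T)"
  using cyl by (simp add: cylindrical_BM_def)

lemma W_mult_integrable: "b \<in> L2_time T \<Longrightarrow> b' \<in> L2_time T \<Longrightarrow> integrable M (\<lambda>\<omega>. W b \<omega> * W b' \<omega>)"
  by (intro integrable_mult_of_squares W_square_integrable W_measurable)

text \<open>The covariance identity makes \<open>W\<close> an isometry, so the second moment of the
  defect equals the squared L2 norm of \<open>b3 - c1 b1 - c2 b2\<close>, which is zero. The same
  argument shows independence of the representative.\<close>

lemma W_linear_AE:
  assumes b: "b1 \<in> L2_time T" "b2 \<in> L2_time T" "b3 \<in> L2_time T"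
    and eq: "AE \<tau> in time_measure T. b3 \<tau> = c1 *\<^sub>R b1 \<tau> + c2 *\<^sub>R b2 \<tau>"
  shows "AE \<omega> in M. W b3 \<omega> = c1 * W b1 \<omega> + c2 * W b2 \<omega>"
proof -
  note i = W_mult_integrable and j = integrable_L2_time_inner
  have [measurable]: "b1 \<in> borel_measurable (time_measure T)" "b2 \<in> borel_measurable (time_measure T)"
     "b3 \<in> borel_measurable (time_measure T)"
    using b by (auto simp: L2_time_def)
  let ?I = "\<lambda>b b'. (\<integral>\<tau>. b \<tau> \<bullet> b' \<tau> \<partial>time_measure T)"
  have e: "(\<lambda>\<omega>. (W b3 \<omega> - (c1 * W b1 \<omega> + c2 * W b2 \<omega>))\<^sup>2) = (\<lambda>\<omega>. W b3 \<omega> * W b3 \<omega> + c1\<^sup>2 * (W b1 \<omega> * W b1 \<omega>)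
     + c2\<^sup>2 * (W b2 \<omega> * W b2 \<omega>) + 2 * c1 * c2 * (W b1 \<omega> * W b2 \<omega>)
     - 2 * c1 * (W b3 \<omega> * W b1 \<omega>) - 2 * c2 * (W b3 \<omega> * W b2 \<omega>))"
    by (auto simp: power2_eq_square algebra_simps)
  have int: "integrable M (\<lambda>\<omega>. (W b3 \<omega> - (c1 * W b1 \<omega> + c2 * W b2 \<omega>))\<^sup>2)"
    unfolding e using b by (intro Bochner_Integration.integrable_add Bochner_Integration.integrable_diff integrable_mult_right i)
  have "expectation (\<lambda>\<omega>. (W b3 \<omega> - (c1 * W b1 \<omega> + c2 * W b2 \<omega>))\<^sup>2) =
     ?I b3 b3 + c1\<^sup>2 * ?I b1 b1 + c2\<^sup>2 * ?I b2 b2 + 2 * c1 * c2 * ?I b1 b2 - 2 * c1 * ?I b3 b1 - 2 * c2 * ?I b3 b2"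
    unfolding e using b by (simp add: i W_cov)
  also have "\<dots> = (\<integral>\<tau>. b3 \<tau> \<bullet> b3 \<tau> + c1\<^sup>2 * (b1 \<tau> \<bullet> b1 \<tau>) + c2\<^sup>2 * (b2 \<tau> \<bullet> b2 \<tau>) + 2 * c1 * c2 * (b1 \<tau> \<bullet> b2 \<tau>)
     - 2 * c1 * (b3 \<tau> \<bullet> b1 \<tau>) - 2 * c2 * (b3 \<tau> \<bullet> b2 \<tau>) \<partial>time_measure T)"
    using b by (simp add: j)
  also have "\<dots> = (\<integral>\<tau>. 0 \<partial>time_measure T)"
    using eq by (intro integral_cong_AE)
      (auto elim!: eventually_mono simp: inner_add_left inner_add_right inner_commute power2_eq_square algebra_simps)
  finally have "expectation (\<lambda>\<omega>. (W b3 \<omega> - (c1 * W b1 \<omega> + c2 * W b2 \<omega>))\<^sup>2) = 0" by simp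
  then have "AE \<omega> in M. (W b3 \<omega> - (c1 * W b1 \<omega> + c2 * W b2 \<omega>))\<^sup>2 = 0"
    by (subst (asm) integral_nonneg_eq_0_iff_AE[OF int]) auto
  then show ?thesis by auto
qed

lemma W_adapted:
  "b \<in> L2_time T \<Longrightarrow> t \<in> {0..T} \<Longrightarrow> supported_in T {0..t} b \<Longrightarrow> W b \<in> borel_measurable (FF t)"
  using cyl by (simp add: cylindrical_BM_def)

text \<open>The axiom speaks of sigma-algebras; here it becomes a product formula for integrable
  variables of the past. The function \<open>g\<close> is kept general to cover the identity, for
  means, and even powers, for moments.\<close>

lemma W_indep:
  fixes X :: "'w \<Rightarrow> real" and g :: "real \<Rightarrow> real"
  assumes b: "b \<in> L2_time T" and s: "s \<in> {0..T}" and sup: "supported_in T {s..T} b"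
    and X: "X \<in> borel_measurable (FF s)" and iX: "integrable M X"
    and g: "g \<in> borel_measurable borel" and ig: "integrable M (\<lambda>\<omega>. g (W b \<omega>))"
  shows "integrable M (\<lambda>\<omega>. X \<omega> * g (W b \<omega>))"
    and "expectation (\<lambda>\<omega>. X \<omega> * g (W b \<omega>)) = expectation X * expectation (\<lambda>\<omega>. g (W b \<omega>))"
proof -
  have XM: "X \<in> borel_measurable M" using measurable_from_subalg[OF FF_subalgebra[OF s] X] .
  have sp: "space (FF s) = space M" using FF_subalgebra[OF s] by (simp add: subalgebra_def)
  have ind: "indep_set (sets (vimage_algebra (space M) (W b) borel)) (sets (FF s))"
    using cyl b s sup by (simp add: cylindrical_BM_def)
  have sub: "sigma_sets (space M) {X -` A \<inter> space M |A. A \<in> sets borel} \<subseteq> sets (FF s)"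
    using X sets.sigma_sets_subset[of "{X -` A \<inter> space M |A. A \<in> sets borel}" "FF s"]
    unfolding sp by (auto simp: measurable_def sp)
  have "indep_set (sigma_sets (space M) {X -` A \<inter> space M |A. A \<in> sets borel})
     (sigma_sets (space M) {W b -` A \<inter> space M |A. A \<in> sets borel})"
  proof (rule indep_setI)
    show "sigma_sets (space M) {X -` A \<inter> space M |A. A \<in> sets borel} \<subseteq> events"
      using sub FF_subalgebra[OF s] by (auto simp: subalgebra_def)
    show "sigma_sets (space M) {W b -` A \<inter> space M |A. A \<in> sets borel} \<subseteq> events"
      using indep_setD_ev1[OF ind] by (simp add: sets_vimage_algebra)
    fix A A'
    assume A: "A \<in> sigma_sets (space M) {X -` A \<inter> space M |A. A \<in> sets borel}"
      and A': "A' \<in> sigma_sets (space M) {W b -` A \<inter> space M |A. A \<in> sets borel}"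
    have "prob (A' \<inter> A) = prob A' * prob A"
      by (rule indep_setD[OF ind]) (use A A' sub in \<open>auto simp: sets_vimage_algebra\<close>)
    then show "prob (A \<inter> A') = prob A * prob A'" by (simp add: Int_commute mult.commute)
  qed
  then have "indep_var borel X borel (W b)"
    unfolding indep_var_eq using XM W_measurable[OF b] by blast
  then have "indep_var borel ((\<lambda>x. x) \<circ> X) borel (g \<circ> W b)"
    using g by (intro indep_var_compose) auto
  then have iv: "indep_var borel X borel (\<lambda>\<omega>. g (W b \<omega>))" by (simp add: comp_def)
  show "integrable M (\<lambda>\<omega>. X \<omega> * g (W b \<omega>))" by (rule indep_var_integrable[OF iv iX ig])
  show "expectation (\<lambda>\<omega>. X \<omega> * g (W b \<omega>)) = expectation X * expectation (\<lambda>\<omega>. g (W b \<omega>))"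
    by (rule indep_var_lebesgue_integral[OF iv iX ig])
qed

section \<open>Increments of the noise in a fixed direction\<close>

definition D :: "real \<Rightarrow> real \<Rightarrow> 'h \<Rightarrow> 'w \<Rightarrow> real" where
  "D s t u \<omega> = BM_at W t u \<omega> - BM_at W s u \<omega>"

text \<open>\<open>BM_at\<close> uses open intervals, so the difference of the indicators of
  \<open>(0,t)\<close> and \<open>(0,s)\<close> is that of \<open>(s,t)\<close> except at the point
  \<open>s\<close>, which is a null set.\<close>

lemma D_AE: 
  assumes "0 \<le> s" "s \<le> t"
  shows "AE \<omega> in M. D s t u \<omega> = W (time_step s t u) \<omega>"
proof -
  have "AE \<tau> in lborel. \<tau> \<noteq> s" by (rule AE_lborel_singleton)
  then have "AE \<tau> in time_measure T. \<tau> \<noteq> s"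
    by (subst AE_restrict_space_iff) (auto elim: eventually_mono)
  then have "AE \<tau> in time_measure T. time_step s t u \<tau> = 1 *\<^sub>R time_step 0 t u \<tau> + (-1) *\<^sub>R time_step 0 s u \<tau>"
    by eventually_elim (use assms in \<open>auto simp: indicator_def\<close>)
  from W_linear_AE[OF L2_time_step L2_time_step L2_time_step this]
  show ?thesis by eventually_elim (simp add: D_def BM_at_def)
qed

lemma D_measurable_FF:
  assumes "0 \<le> s" "s \<le> t" "t \<le> T"
  shows "D s t u \<in> borel_measurable (FF t)"
proof -
  have "W (time_step 0 r u) \<in> borel_measurable (FF t)" if "0 \<le> r" "r \<le> t" for r
  proof -
    have "supported_in T {0..t} (time_step 0 r u)"
      unfolding supported_in_def by (rule AE_I2) (use that in \<open>auto simp: indicator_def\<close>)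
    then show ?thesis using W_adapted[OF L2_time_step] assms by auto
  qed
  then show ?thesis using assms unfolding D_def[abs_def] BM_at_def by (intro borel_measurable_diff) auto
qed

lemma D_measurable[measurable]: "D s t u \<in> borel_measurable M"
  unfolding D_def[abs_def] BM_at_def by (intro borel_measurable_diff W_measurable L2_time_step)

lemma supported_time_step: "s \<le> s' \<Longrightarrow> t \<le> T \<Longrightarrow> supported_in T {s..T} (time_step s' t u)"
  unfolding supported_in_def by (rule AE_I2) (auto simp: indicator_def)

text \<open>
  Centredness is not part of the definition of \<open>W\<close>. It follows since the mean \<open>a(r)\<close> of \<open>W(1\<^bsub>(0,r)\<^esub> u)\<close>
  is continuous in \<open>r\<close> and satisfies \<open>a(s)(a(t) - a(s)) = 0\<close>, the increments being both independent
  and uncorrelated.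
\<close>

lemma W_time_step_mean:
  assumes st: "0 \<le> s" "s \<le> t" "t \<le> T"
  shows "expectation (W (time_step s t u)) = 0"
proof -
  define a where "a r = expectation (W (time_step 0 r u))" for r
  have diff: "expectation (W (time_step s t u)) = a t - a s" if "0 \<le> s" "s \<le> t" for s t
  proof -
    have "expectation (W (time_step s t u)) = expectation (D s t u)"
      using D_AE[OF that, of u] by (intro integral_cong_AE W_measurable L2_time_step D_measurable) (auto elim!: eventually_mono)
    also have "\<dots> = a t - a s"
      unfolding a_def D_def[abs_def] BM_at_def
      by (intro Bochner_Integration.integral_diff W_integrable L2_time_step)
    finally show ?thesis .
  qed
  have prod: "a s * (a t - a s) = 0" if "0 \<le> s" "s \<le> t" "t \<le> T" for s t
  proof -
    have X: "W (time_step 0 s u) \<in> borel_measurable (FF s)"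
      by (rule W_adapted[OF L2_time_step]) (use that in \<open>auto simp: supported_in_def indicator_def intro!: AE_I2\<close>)
    have "expectation (\<lambda>\<omega>. W (time_step 0 s u) \<omega> * W (time_step s t u) \<omega>) = a s * (a t - a s)"
      unfolding diff[OF that(1,2), symmetric] unfolding a_def
      by (rule W_indep(2)[where g="\<lambda>x. x"])
        (use that X in \<open>auto intro: L2_time_step W_integrable supported_time_step\<close>)
    moreover have "expectation (\<lambda>\<omega>. W (time_step 0 s u) \<omega> * W (time_step s t u) \<omega>) = 0"
      using that by (subst W_cov[OF L2_time_step L2_time_step], subst time_step_inner) auto
    ultimately show ?thesis by simp
  qed
  \<comment> \<open>Nonnegativity of the variance bounds the squared mean by the second moment,
    which the covariance identity evaluates.\<close>
  have lip: "(a t - a s)\<^sup>2 \<le> (t - s) * (norm u)\<^sup>2" if "0 \<le> s" "s \<le> t" "t \<le> T" for s t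
  proof -
    let ?X = "W (time_step s t u)"
    have "0 \<le> variance ?X" by simp
    also have "variance ?X = expectation (\<lambda>\<omega>. (?X \<omega>)\<^sup>2) - (expectation ?X)\<^sup>2"
      by (intro variance_eq W_integrable W_square_integrable L2_time_step)
    also have "expectation (\<lambda>\<omega>. (?X \<omega>)\<^sup>2) = (t - s) * (norm u)\<^sup>2"
      unfolding power2_eq_square using that
      by (subst W_cov[OF L2_time_step L2_time_step], subst time_step_inner) (auto simp: norm_eq_sqrt_inner)
    finally show ?thesis using diff[OF that(1,2)] by simp
  qed
  have a0: "a 0 = 0" using prod[of 0 0] diff[of 0 0] lip[of 0 0]
  proof -
    have "AE \<omega> in M. W (time_step 0 0 u) \<omega> = 0 * W (time_step 0 0 u) \<omega> + 0 * W (time_step 0 0 u) \<omega>"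
      by (rule W_linear_AE[OF L2_time_step L2_time_step L2_time_step]) simp
    then have "a 0 = expectation (\<lambda>_. 0)"
      unfolding a_def by (intro integral_cong_AE W_measurable L2_time_step) simp_all
    then show ?thesis by simp
  qed
  have cont: "continuous_on {0..T} a"
  proof (rule continuous_onI)
    fix x e :: real assume x: "x \<in> {0..T}" "0 < e"
    define d where "d = e\<^sup>2 / ((norm u)\<^sup>2 + 1)"
    have "0 < (norm u)\<^sup>2 + 1" by (simp add: add_nonneg_pos)
    then have d: "0 < d" "d * ((norm u)\<^sup>2 + 1) = e\<^sup>2" using x by (auto simp: d_def)
    have "dist (a y) (a x) \<le> e" if y: "y \<in> {0..T}" "dist y x < d" for y
    proof -
      have "(a y - a x)\<^sup>2 \<le> \<bar>y - x\<bar> * (norm u)\<^sup>2"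
        using lip[of x y] lip[of y x] x y by (cases "x \<le> y") (auto simp: power2_commute)
      also have "\<dots> \<le> d * ((norm u)\<^sup>2 + 1)"
        using y d by (intro mult_mono) (auto simp: dist_real_def)
      finally have "\<bar>a y - a x\<bar> \<le> \<bar>e\<bar>" unfolding d(2) by (simp add: abs_le_square_iff)
      then show ?thesis using x by (simp add: dist_real_def)
    qed
    then show "\<exists>d>0. \<forall>x'\<in>{0..T}. dist x' x < d \<longrightarrow> dist (a x') (a x) \<le> e" using d(1) by blast
  qed
  have zero: "a t = 0" if t: "0 \<le> t" "t \<le> T" for t
  proof (rule ccontr)
    assume nz: "a t \<noteq> 0"
    have c: "continuous_on {0..t} a" using cont t by (auto intro: continuous_on_subset)
    \<comment> \<open>At a point where \<open>a\<close> takes half of its value at \<open>t\<close>,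
      the product \<open>a s * (a t - a s)\<close> would be the nonzero square of
      \<open>a t / 2\<close>.\<close>
    have "\<exists>s\<ge>0. s \<le> t \<and> a s = a t / 2"
    proof (cases "0 \<le> a t")
      case True then show ?thesis using IVT'[of a 0 "a t / 2" t] c t a0 by auto
    next
      case False then show ?thesis using IVT2'[of a t "a t / 2" 0] c t a0 by auto
    qed
    then obtain s where "0 \<le> s" "s \<le> t" "a s = a t / 2" by blast
    then show False using prod[of s t] nz t by simp
  qed
  show ?thesis using diff[OF st(1,2)] zero[of s] zero[of t] st by simp
qed

end

section \<open>Stochastic increments with adapted coefficients\<close>

text \<open>Fatou's lemma with varying bounds, the form in which moment estimates pass from finite
  sums to almost sure limits.\<close>

lemma nn_integral_le_of_AE_limit:
  fixes f :: "nat \<Rightarrow> 'w \<Rightarrow> ennreal"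
  assumes f: "\<And>n. f n \<in> borel_measurable M"
    and lim: "AE \<omega> in M. (\<lambda>n. f n \<omega>) \<longlonglongrightarrow> g \<omega>"
    and le: "\<And>n. (\<integral>\<^sup>+\<omega>. f n \<omega> \<partial>M) \<le> a n" and a: "a \<longlonglongrightarrow> b"
  shows "(\<integral>\<^sup>+\<omega>. g \<omega> \<partial>M) \<le> b"
proof -
  have "(\<integral>\<^sup>+\<omega>. g \<omega> \<partial>M) = (\<integral>\<^sup>+\<omega>. liminf (\<lambda>n. f n \<omega>) \<partial>M)"
    using lim by (intro nn_integral_cong_AE) (auto elim!: eventually_mono simp: lim_imp_Liminf)
  also have "\<dots> \<le> liminf (\<lambda>n. \<integral>\<^sup>+\<omega>. f n \<omega> \<partial>M)" by (rule nn_integral_liminf[OF f])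
  also have "\<dots> \<le> liminf a" using le by (intro Liminf_mono) auto
  also have "\<dots> = b" using a by (intro lim_imp_Liminf) auto
  finally show ?thesis .
qed

text \<open>Jensen's inequality for the power function at the points \<open>a e / w e\<close> with
  weights proportional to \<open>w e\<close>. If the weights match the typical sizes of
  \<open>a e\<close>, no power of the number of terms is lost.\<close>

lemma sum_power_le_weighted:
  fixes a w :: "'i \<Rightarrow> real"
  assumes "finite E" "\<And>e. e \<in> E \<Longrightarrow> 0 \<le> a e" "\<And>e. e \<in> E \<Longrightarrow> 0 < w e" "1 \<le> m"
  shows "(\<Sum>e\<in>E. a e) ^ m \<le> (\<Sum>e\<in>E. w e) ^ (m - 1) * (\<Sum>e\<in>E. a e ^ m / w e ^ (m - 1))"
proof (cases "E = {}")
  case True then show ?thesis using assms(4) by (simp add: power_0_left)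
next
  case False
  define \<sigma> where "\<sigma> = (\<Sum>e\<in>E. w e)"
  have \<sigma>: "0 < \<sigma>" unfolding \<sigma>_def using False assms by (intro sum_pos) auto
  obtain k where m: "m = Suc k" using assms(4) by (cases m) auto
  have "(\<Sum>e\<in>E. (w e / \<sigma>) *\<^sub>R (a e / w e)) ^ m \<le> (\<Sum>e\<in>E. (w e / \<sigma>) * (a e / w e) ^ m)"
  proof (rule convex_on_sum[of E "{0..}" "\<lambda>x. x ^ m"])
    show "convex_on {0..} (\<lambda>x::real. x ^ m)"
      by (rule convex_on_realI[where f'="\<lambda>x. real m * x ^ (m - 1)"])
        (auto intro!: derivative_eq_intros mult_left_mono power_mono)
    show "(\<Sum>e\<in>E. w e / \<sigma>) = 1" using \<sigma> by (simp add: sum_divide_distrib[symmetric] \<sigma>_def)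
  qed (use assms False \<sigma> in \<open>auto simp: less_imp_le\<close>)
  moreover have "(\<Sum>e\<in>E. (w e / \<sigma>) *\<^sub>R (a e / w e)) = (\<Sum>e\<in>E. a e) / \<sigma>"
    unfolding sum_divide_distrib using assms(3) by (intro sum.cong) (auto simp: less_imp_neq[symmetric])
  moreover have "(\<Sum>e\<in>E. (w e / \<sigma>) * (a e / w e) ^ m) = (\<Sum>e\<in>E. a e ^ m / w e ^ (m - 1)) / \<sigma>"
    unfolding sum_divide_distrib using assms(3) \<sigma>
    by (intro sum.cong) (auto simp: m power_divide less_imp_neq[symmetric] field_simps)
  ultimately have "(\<Sum>e\<in>E. a e) ^ m / \<sigma> ^ m \<le> (\<Sum>e\<in>E. a e ^ m / w e ^ (m - 1)) / \<sigma>"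
    by (simp add: power_divide)
  then show ?thesis using \<sigma> by (simp add: \<sigma>_def[symmetric] m field_simps)
qed

text \<open>This is the double factorial \<open>(2m - 1)!!\<close>, the moment of order
  \<open>2m\<close> of a standard normal variable.\<close>

definition gauss_moment :: "nat \<Rightarrow> real" where
  "gauss_moment m = fact (2 * m) / (2 ^ m * fact m)"

lemma gauss_moment_nonneg: "0 \<le> gauss_moment m"
  by (simp add: gauss_moment_def)

context cylindrical_noise
begin

lemma D_linear_AE:
  assumes "0 \<le> s" "s \<le> t"
  shows "AE \<omega> in M. D s t (c1 *\<^sub>R u1 + c2 *\<^sub>R u2) \<omega> = c1 * D s t u1 \<omega> + c2 * D s t u2 \<omega>"
proof -
  have "AE \<omega> in M. W (time_step s t (c1 *\<^sub>R u1 + c2 *\<^sub>R u2)) \<omega> = c1 * W (time_step s t u1) \<omega> + c2 * W (time_step s t u2) \<omega>"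
    by (rule W_linear_AE[OF L2_time_step L2_time_step L2_time_step]) (auto simp: algebra_simps)
  with D_AE[OF assms, of u1] D_AE[OF assms, of u2] D_AE[OF assms, of "c1 *\<^sub>R u1 + c2 *\<^sub>R u2"]
  show ?thesis by eventually_elim simp
qed

lemma D_sum_AE:
  assumes "0 \<le> s" "s \<le> t" "finite J"
  shows "AE \<omega> in M. D s t (\<Sum>i\<in>J. c i *\<^sub>R u i) \<omega> = (\<Sum>i\<in>J. c i * D s t (u i) \<omega>)"
  using assms(3)
proof (induction J)
  case empty
  show ?case using D_linear_AE[OF assms(1,2), of 0 0 0 0] by simp
next
  case (insert j J)
  have "AE \<omega> in M. D s t (c j *\<^sub>R u j + 1 *\<^sub>R (\<Sum>i\<in>J. c i *\<^sub>R u i)) \<omega> = c j * D s t (u j) \<omega> + 1 * D s t (\<Sum>i\<in>J. c i *\<^sub>R u i) \<omega>"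
    by (rule D_linear_AE[OF assms(1,2)])
  with insert.IH show ?case by eventually_elim (simp add: insert.hyps)
qed

lemma FF_M: "t \<in> {0..T} \<Longrightarrow> X \<in> borel_measurable (FF t) \<Longrightarrow> X \<in> borel_measurable M"
  using measurable_from_subalg[OF FF_subalgebra] .

lemma FF_sets_M: "t \<in> {0..T} \<Longrightarrow> B \<in> sets (FF t) \<Longrightarrow> B \<in> events"
  using FF_subalgebra by (auto simp: subalgebra_def)

lemma D_mult_mean:
  assumes st: "0 \<le> s" "s \<le> t" "t \<le> T" and X: "X \<in> borel_measurable (FF s)" "integrable M X"
  shows "integrable M (\<lambda>\<omega>. X \<omega> * D s t u \<omega>)" and "expectation (\<lambda>\<omega>. X \<omega> * D s t u \<omega>) = 0"
proof -
  have s: "s \<in> {0..T}" using st by auto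
  note [measurable] = FF_M[OF s X(1)] W_measurable[OF L2_time_step]
  have ae: "AE \<omega> in M. X \<omega> * W (time_step s t u) \<omega> = X \<omega> * D s t u \<omega>" using D_AE[OF st(1,2), of u] by auto
  note ind = W_indep[where g="\<lambda>x. x", OF L2_time_step s supported_time_step[OF order_refl st(3)] X _ W_integrable[OF L2_time_step]]
  show "integrable M (\<lambda>\<omega>. X \<omega> * D s t u \<omega>)"
    by (rule integrable_cong_AE_imp[OF ind(1)]) (use ae in auto)
  have "expectation (\<lambda>\<omega>. X \<omega> * D s t u \<omega>) = expectation (\<lambda>\<omega>. X \<omega> * W (time_step s t u) \<omega>)"
    by (rule integral_cong_AE) (use ae in auto)
  also have "\<dots> = 0" using ind(2)[of u] W_time_step_mean[OF st, of u] by simp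
  finally show "expectation (\<lambda>\<omega>. X \<omega> * D s t u \<omega>) = 0" .
qed

lemma D_mult_moment:
  assumes st: "0 \<le> s" "s \<le> t" "t \<le> T" and X: "X \<in> borel_measurable (FF s)" "integrable M X"
  shows "integrable M (\<lambda>\<omega>. X \<omega> * D s t u \<omega> ^ (2 * m))"
    and "expectation (\<lambda>\<omega>. X \<omega> * D s t u \<omega> ^ (2 * m)) = expectation X * (gauss_moment m * ((t - s) * (norm u)\<^sup>2) ^ m)"
proof -
  let ?w = "W (time_step s t u)"
  have s: "s \<in> {0..T}" using st by auto
  note [measurable] = FF_M[OF s X(1)] W_measurable[OF L2_time_step]
  have ae: "AE \<omega> in M. X \<omega> * ?w \<omega> ^ (2 * m) = X \<omega> * D s t u \<omega> ^ (2 * m)" using D_AE[OF st(1,2), of u] by auto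
  note mom = centered_gaussian_moment[OF W_gaussian[OF L2_time_step] W_time_step_mean[OF st], of u m]
  note ind = W_indep[where g="\<lambda>x. x ^ (2 * m)", OF L2_time_step s supported_time_step[OF order_refl st(3)] X _ mom(1)]
  show "integrable M (\<lambda>\<omega>. X \<omega> * D s t u \<omega> ^ (2 * m))"
    by (rule integrable_cong_AE_imp[OF ind(1)]) (use ae in auto)
  have v: "expectation (\<lambda>\<omega>. (?w \<omega>)\<^sup>2) = (t - s) * (norm u)\<^sup>2"
    unfolding power2_eq_square using st
    by (subst W_cov[OF L2_time_step L2_time_step], subst time_step_inner) (auto simp: norm_eq_sqrt_inner)
  have "expectation (\<lambda>\<omega>. X \<omega> * D s t u \<omega> ^ (2 * m)) = expectation (\<lambda>\<omega>. X \<omega> * ?w \<omega> ^ (2 * m))"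
    by (rule integral_cong_AE) (use ae in auto)
  also have "\<dots> = expectation X * expectation (\<lambda>\<omega>. ?w \<omega> ^ (2 * m))" by (rule ind(2)) measurable
  finally show "expectation (\<lambda>\<omega>. X \<omega> * D s t u \<omega> ^ (2 * m)) = expectation X * (gauss_moment m * ((t - s) * (norm u)\<^sup>2) ^ m)"
    unfolding mom(2) v gauss_moment_def .
qed

text \<open>Only single variables \<open>W b\<close> are assumed to be independent of the past; products are reached by polarization.\<close>

lemma D_mult_product:
  assumes st: "0 \<le> s" "s \<le> t" "t \<le> T" "s \<le> t'" "t' \<le> T" and X: "X \<in> borel_measurable (FF s)" "integrable M X"
  shows "integrable M (\<lambda>\<omega>. X \<omega> * (D s t u \<omega> * D s t' u' \<omega>))"
    and "expectation (\<lambda>\<omega>. X \<omega> * (D s t u \<omega> * D s t' u' \<omega>)) = expectation X * ((min t t' - s) * (u \<bullet> u'))"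
proof -
  have s: "s \<in> {0..T}" using st by auto
  let ?b1 = "time_step s t u" and ?b2 = "time_step s t' u'"
  let ?b = "\<lambda>\<tau>. 1 *\<^sub>R ?b1 \<tau> + 1 *\<^sub>R ?b2 \<tau>"
  have bL: "?b \<in> L2_time T" by (intro L2_time_linear L2_time_step)
  note [measurable] = FF_M[OF s X(1)] W_measurable[OF L2_time_step] W_measurable[OF bL]
  have [measurable]: "W (\<lambda>\<tau>. ?b1 \<tau> + ?b2 \<tau>) \<in> borel_measurable M" using W_measurable[OF bL] by simp
  have sup: "supported_in T {s..T} ?b1" "supported_in T {s..T} ?b2" "supported_in T {s..T} ?b"
    unfolding supported_in_def by (rule AE_I2; use st in \<open>auto simp: indicator_def\<close>)+
  have sq: "(\<lambda>x::real. x\<^sup>2) \<in> borel_measurable borel" by simp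
  note ind1 = W_indep[OF L2_time_step s sup(1) X sq W_square_integrable[OF L2_time_step]]
  note ind2 = W_indep[OF L2_time_step s sup(2) X sq W_square_integrable[OF L2_time_step]]
  note ind3 = W_indep[OF bL s sup(3) X sq W_square_integrable[OF bL]]
  have "AE \<omega> in M. W ?b \<omega> = 1 * W ?b1 \<omega> + 1 * W ?b2 \<omega>"
    by (intro W_linear_AE L2_time_step bL) simp
  with D_AE[OF st(1,2), of u] D_AE[OF st(1,4), of u']
  have ae: "AE \<omega> in M. (X \<omega> * (W ?b \<omega>)\<^sup>2 - X \<omega> * (W ?b1 \<omega>)\<^sup>2 - X \<omega> * (W ?b2 \<omega>)\<^sup>2) / 2 = X \<omega> * (D s t u \<omega> * D s t' u' \<omega>)"
    by eventually_elim (simp add: power2_eq_square algebra_simps)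
  have int: "integrable M (\<lambda>\<omega>. (X \<omega> * (W ?b \<omega>)\<^sup>2 - X \<omega> * (W ?b1 \<omega>)\<^sup>2 - X \<omega> * (W ?b2 \<omega>)\<^sup>2) / 2)"
    by (intro integrable_divide_zero Bochner_Integration.integrable_diff ind1(1) ind2(1) ind3(1))
  show "integrable M (\<lambda>\<omega>. X \<omega> * (D s t u \<omega> * D s t' u' \<omega>))"
    by (rule integrable_cong_AE_imp[OF int]) (use ae in auto)
  let ?E = "\<lambda>b b'. (\<integral>\<tau>. b \<tau> \<bullet> b' \<tau> \<partial>time_measure T)"
  have bb: "?E ?b ?b = ?E ?b1 ?b1 + ?E ?b2 ?b2 + 2 * ?E ?b1 ?b2"
  proof -
    have "?E ?b ?b = (\<integral>\<tau>. ?b1 \<tau> \<bullet> ?b1 \<tau> + ?b2 \<tau> \<bullet> ?b2 \<tau> + 2 * (?b1 \<tau> \<bullet> ?b2 \<tau>) \<partial>time_measure T)"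
      by (intro Bochner_Integration.integral_cong) (auto simp: inner_add_left inner_add_right inner_commute)
    also have "\<dots> = ?E ?b1 ?b1 + ?E ?b2 ?b2 + 2 * ?E ?b1 ?b2"
    proof -
      have "(\<integral>x. f x + g x + 2 * k x \<partial>N) = integral\<^sup>L N f + integral\<^sup>L N g + 2 * integral\<^sup>L N k"
        if "integrable N f" "integrable N g" "integrable N k" for N and f g k :: "real \<Rightarrow> real"
        using that by simp
      from this[OF integrable_L2_time_inner[OF L2_time_step L2_time_step] integrable_L2_time_inner[OF L2_time_step L2_time_step]
         integrable_L2_time_inner[OF L2_time_step L2_time_step]] show ?thesis .
    qed
    finally show ?thesis .
  qed
  have "expectation (\<lambda>\<omega>. X \<omega> * (D s t u \<omega> * D s t' u' \<omega>)) =
     expectation (\<lambda>\<omega>. (X \<omega> * (W ?b \<omega>)\<^sup>2 - X \<omega> * (W ?b1 \<omega>)\<^sup>2 - X \<omega> * (W ?b2 \<omega>)\<^sup>2) / 2)"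
    by (rule integral_cong_AE) (use ae in auto)
  also have "\<dots> = (expectation X * ?E ?b ?b - expectation X * ?E ?b1 ?b1 - expectation X * ?E ?b2 ?b2) / 2"
    using ind1 ind2 ind3 W_cov[OF L2_time_step L2_time_step, of s t u s t u] W_cov[OF L2_time_step L2_time_step, of s t' u' s t' u']
      W_cov[OF bL bL] by (simp add: power2_eq_square)
  also have "\<dots> = expectation X * ?E ?b1 ?b2" unfolding bb by (simp add: algebra_simps)
  also have "?E ?b1 ?b2 = (min t t' - s) * (u \<bullet> u')"
    using st by (subst time_step_inner) auto
  finally show "expectation (\<lambda>\<omega>. X \<omega> * (D s t u \<omega> * D s t' u' \<omega>)) = expectation X * ((min t t' - s) * (u \<bullet> u'))" .
qed

section \<open>Finite noise sums with coefficients from the past\<close>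

definition wsum :: "real \<Rightarrow> real \<Rightarrow> nat set \<Rightarrow> (nat \<Rightarrow> 'h) \<Rightarrow> (nat \<Rightarrow> 'w \<Rightarrow> 'y::real_vector) \<Rightarrow> 'w \<Rightarrow> 'y" where
  "wsum s t J h y \<omega> = (\<Sum>i\<in>J. D s t (h i) \<omega> *\<^sub>R y i \<omega>)"

lemma wsum_measurable:
  fixes y :: "nat \<Rightarrow> 'w \<Rightarrow> 'y::{real_inner,banach,second_countable_topology}"
  assumes "\<And>i. i \<in> J \<Longrightarrow> y i \<in> borel_measurable M"
  shows "wsum s t J h y \<in> borel_measurable M"
  unfolding wsum_def[abs_def] using assms by measurable

lemma wsum_mean:
  fixes y :: "nat \<Rightarrow> 'w \<Rightarrow> 'y::{real_inner,banach,second_countable_topology}"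
  assumes st: "0 \<le> s" "s \<le> t" "t \<le> T" and J: "finite J"
    and y: "\<And>i. i \<in> J \<Longrightarrow> y i \<in> borel_measurable (FF s)" "\<And>i \<omega>. i \<in> J \<Longrightarrow> norm (y i \<omega>) \<le> L"
    and z: "z \<in> borel_measurable (FF s)" "\<And>\<omega>. norm (z \<omega>) \<le> c"
  shows "integrable M (\<lambda>\<omega>. z \<omega> \<bullet> wsum s t J h y \<omega>)" "expectation (\<lambda>\<omega>. z \<omega> \<bullet> wsum s t J h y \<omega>) = 0"
proof -
  have s: "s \<in> {0..T}" using st by auto
  have eq: "z \<omega> \<bullet> wsum s t J h y \<omega> = (\<Sum>i\<in>J. (z \<omega> \<bullet> y i \<omega>) * D s t (h i) \<omega>)" for \<omega>
    by (simp add: wsum_def inner_sum_right mult.commute)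
  have X: "(\<lambda>\<omega>. z \<omega> \<bullet> y i \<omega>) \<in> borel_measurable (FF s)" "integrable M (\<lambda>\<omega>. z \<omega> \<bullet> y i \<omega>)" if "i \<in> J" for i
  proof -
    show m: "(\<lambda>\<omega>. z \<omega> \<bullet> y i \<omega>) \<in> borel_measurable (FF s)" using z(1) y(1)[OF that] by simp
    have "\<bar>z \<omega> \<bullet> y i \<omega>\<bar> \<le> c * L" for \<omega>
      using Cauchy_Schwarz_ineq2[of "z \<omega>" "y i \<omega>"] mult_mono[OF z(2) y(2)[OF that], of \<omega> \<omega>] z(2)[of \<omega>]
        norm_ge_zero[of "z \<omega>"] norm_ge_zero[of "y i \<omega>"] by linarith
    then show "integrable M (\<lambda>\<omega>. z \<omega> \<bullet> y i \<omega>)"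
      by (intro integrable_const_bound[where B="c * L"] FF_M[OF s m]) auto
  qed
  show "integrable M (\<lambda>\<omega>. z \<omega> \<bullet> wsum s t J h y \<omega>)" "expectation (\<lambda>\<omega>. z \<omega> \<bullet> wsum s t J h y \<omega>) = 0"
    unfolding eq using D_mult_mean[OF st X] by (auto simp: Bochner_Integration.integral_sum)
qed

text \<open>When the square is expanded, the pair \<open>(i, j)\<close> carries the factor
  \<open>(t - s) * (h i \<bullet> h j)\<close>, so only the diagonal survives. The set
  \<open>B\<close> is absorbed into the past factor of \<open>D_mult_product\<close>.\<close>

lemma wsum_var:
  fixes y :: "nat \<Rightarrow> 'w \<Rightarrow> 'y::{real_inner,banach,second_countable_topology}"
  assumes st: "0 \<le> s" "s \<le> t" "t \<le> T" and J: "finite J"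
    and h: "\<And>i j. i \<in> J \<Longrightarrow> j \<in> J \<Longrightarrow> h i \<bullet> h j = (if i = j then 1 else 0)"
    and y: "\<And>i. i \<in> J \<Longrightarrow> y i \<in> borel_measurable (FF s)" "\<And>i \<omega>. i \<in> J \<Longrightarrow> norm (y i \<omega>) \<le> L"
    and B: "B \<in> sets (FF s)"
  shows "(\<integral>\<^sup>+\<omega>. indicator B \<omega> * ennreal ((norm (wsum s t J h y \<omega>))\<^sup>2) \<partial>M) =
    (\<integral>\<^sup>+\<omega>. indicator B \<omega> * ennreal ((t - s) * (\<Sum>i\<in>J. (norm (y i \<omega>))\<^sup>2)) \<partial>M)"
proof -
  have s: "s \<in> {0..T}" using st by auto
  note [measurable] = FF_sets_M[OF s B]
  let ?X = "\<lambda>i j \<omega>. indicator B \<omega> * (y i \<omega> \<bullet> y j \<omega>)"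
  have X: "?X i j \<in> borel_measurable (FF s)" "integrable M (?X i j)" if "i \<in> J" "j \<in> J" for i j
  proof -
    show m: "?X i j \<in> borel_measurable (FF s)" using B y(1)[OF that(1)] y(1)[OF that(2)] by simp
    have "\<bar>?X i j \<omega>\<bar> \<le> L * L" for \<omega>
    proof -
      have "\<bar>y i \<omega> \<bullet> y j \<omega>\<bar> \<le> norm (y i \<omega>) * norm (y j \<omega>)" by (rule Cauchy_Schwarz_ineq2)
      also have "\<dots> \<le> L * L"
        using y(2)[OF that(1), of \<omega>] y(2)[OF that(2), of \<omega>] by (intro mult_mono) (auto intro: order_trans[OF norm_ge_zero])
      finally show ?thesis by (auto simp: indicator_def)
    qed
    then show "integrable M (?X i j)" by (intro integrable_const_bound[where B="L * L"] FF_M[OF s m]) auto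
  qed
  have sq: "indicator B \<omega> * (norm (wsum s t J h y \<omega>))\<^sup>2 = (\<Sum>i\<in>J. \<Sum>j\<in>J. ?X i j \<omega> * (D s t (h i) \<omega> * D s t (h j) \<omega>))" for \<omega>
    by (simp add: wsum_def power2_norm_eq_inner inner_sum_left inner_sum_right sum_distrib_left mult_ac inner_commute)
  note P = D_mult_product[OF st st(2,3) X]
  have i1: "integrable M (\<lambda>\<omega>. indicator B \<omega> * (norm (wsum s t J h y \<omega>))\<^sup>2)"
    unfolding sq using P(1) by (intro Bochner_Integration.integrable_sum) auto
  have i2: "integrable M (\<lambda>\<omega>. indicator B \<omega> * ((t - s) * (\<Sum>i\<in>J. (norm (y i \<omega>))\<^sup>2)))"
  proof -
    have "integrable M (\<lambda>\<omega>. (t - s) * (\<Sum>i\<in>J. ?X i i \<omega>))"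
      using X(2) by (intro integrable_mult_right Bochner_Integration.integrable_sum) auto
    then show ?thesis by (simp add: power2_norm_eq_inner sum_distrib_left mult_ac)
  qed
  have "expectation (\<lambda>\<omega>. indicator B \<omega> * (norm (wsum s t J h y \<omega>))\<^sup>2) =
     (\<Sum>i\<in>J. \<Sum>j\<in>J. expectation (?X i j) * ((t - s) * (h i \<bullet> h j)))"
    unfolding sq using P by (simp add: Bochner_Integration.integral_sum)
  also have "\<dots> = (\<Sum>i\<in>J. \<Sum>j\<in>J. if i = j then expectation (?X i j) * (t - s) else 0)"
    by (intro sum.cong refl) (simp add: h)
  also have "\<dots> = (\<Sum>i\<in>J. expectation (?X i i) * (t - s))" using J by simp
  also have "\<dots> = expectation (\<lambda>\<omega>. indicator B \<omega> * ((t - s) * (\<Sum>i\<in>J. (norm (y i \<omega>))\<^sup>2)))"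
  proof -
    have "(\<Sum>i\<in>J. expectation (?X i i) * (t - s)) = expectation (\<lambda>\<omega>. \<Sum>i\<in>J. ?X i i \<omega> * (t - s))"
      using X(2) by (simp add: Bochner_Integration.integral_sum)
    then show ?thesis by (simp add: power2_norm_eq_inner sum_distrib_left mult_ac)
  qed
  finally have eq: "expectation (\<lambda>\<omega>. indicator B \<omega> * (norm (wsum s t J h y \<omega>))\<^sup>2) =
    expectation (\<lambda>\<omega>. indicator B \<omega> * ((t - s) * (\<Sum>i\<in>J. (norm (y i \<omega>))\<^sup>2)))" .
  have "(\<integral>\<^sup>+\<omega>. indicator B \<omega> * ennreal ((norm (wsum s t J h y \<omega>))\<^sup>2) \<partial>M) =
    (\<integral>\<^sup>+\<omega>. ennreal (indicator B \<omega> * (norm (wsum s t J h y \<omega>))\<^sup>2) \<partial>M)"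
    by (intro nn_integral_cong) (auto simp: indicator_def)
  also have "\<dots> = (\<integral>\<^sup>+\<omega>. ennreal (indicator B \<omega> * ((t - s) * (\<Sum>i\<in>J. (norm (y i \<omega>))\<^sup>2))) \<partial>M)"
    using st by (subst nn_integral_eq_integral[OF i1]; (subst nn_integral_eq_integral[OF i2])?) (auto simp: eq sum_nonneg)
  also have "\<dots> = (\<integral>\<^sup>+\<omega>. indicator B \<omega> * ennreal ((t - s) * (\<Sum>i\<in>J. (norm (y i \<omega>))\<^sup>2)) \<partial>M)"
    by (intro nn_integral_cong) (auto simp: indicator_def)
  finally show ?thesis .
qed

text \<open>
  A bound through \<open>\<Sum>i. \<bar>D s t (h i)\<bar> * norm (c i)\<close> would not be dimension-free. Instead, the Gaussian variables
  \<open>\<xi> \<bullet> e\<close>, for \<open>e\<close> in an orthonormal basis of the span of the \<open>c i\<close>, enter a convex combination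
  with weights proportional to their variances; joint independence is not needed.
\<close>

lemma wsum_moment_const:
  fixes c :: "nat \<Rightarrow> 'y::{real_inner,banach,second_countable_topology}"
  assumes st: "0 \<le> s" "s \<le> t" "t \<le> T" and J: "finite J"
    and h: "\<And>i j. i \<in> J \<Longrightarrow> j \<in> J \<Longrightarrow> h i \<bullet> h j = (if i = j then 1 else 0)"
    and B: "B \<in> sets (FF s)" and m: "1 \<le> m"
  shows "(\<integral>\<^sup>+\<omega>. indicator B \<omega> * ennreal (norm (\<Sum>i\<in>J. D s t (h i) \<omega> *\<^sub>R c i) ^ (2 * m)) \<partial>M) \<le>
    (\<integral>\<^sup>+\<omega>. indicator B \<omega> * ennreal (gauss_moment m * ((t - s) * (\<Sum>i\<in>J. (norm (c i))\<^sup>2)) ^ m) \<partial>M)"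
proof -
  have s: "s \<in> {0..T}" using st by auto
  note [measurable] = FF_sets_M[OF s B]
  obtain E where E: "finite E" "\<And>v. v \<in> span (c ` J) \<Longrightarrow> (norm v)\<^sup>2 = (\<Sum>e\<in>E. (v \<bullet> e)\<^sup>2)"
    using finite_orthonormal_cover[of "c ` J"] J by blast
  \<comment> \<open>The coordinate of the sum in direction \<open>e\<close> is almost surely
    \<open>D s t (v e)\<close>, a single Gaussian variable of variance
    \<open>(t - s) * w e\<close>.\<close>
  define v where "v e = (\<Sum>i\<in>J. (c i \<bullet> e) *\<^sub>R h i)" for e
  define w where "w e = (norm (v e))\<^sup>2" for e
  have w: "w e = (\<Sum>i\<in>J. (c i \<bullet> e)\<^sup>2)" for e
  proof -
    have "w e = (\<Sum>i\<in>J. \<Sum>j\<in>J. (c i \<bullet> e) * ((c j \<bullet> e) * (h i \<bullet> h j)))"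
      by (simp add: w_def v_def power2_norm_eq_inner inner_sum_left inner_sum_right sum_distrib_left mult_ac)
        (intro sum.cong refl, simp only: inner_commute)
    also have "\<dots> = (\<Sum>i\<in>J. \<Sum>j\<in>J. if i = j then (c i \<bullet> e)\<^sup>2 else 0)"
      by (intro sum.cong refl) (simp add: h power2_eq_square)
    also have "\<dots> = (\<Sum>i\<in>J. (c i \<bullet> e)\<^sup>2)" using J by simp
    finally show ?thesis .
  qed
  define \<sigma> where "\<sigma> = (\<Sum>i\<in>J. (norm (c i))\<^sup>2)"
  have \<sigma>: "\<sigma> = (\<Sum>e\<in>E. w e)"
  proof -
    have "\<sigma> = (\<Sum>i\<in>J. \<Sum>e\<in>E. (c i \<bullet> e)\<^sup>2)"
      unfolding \<sigma>_def by (intro sum.cong refl E(2) span_base) auto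
    then show ?thesis unfolding w by (subst (asm) sum.swap)
  qed
  \<comment> \<open>Directions of zero variance contribute nothing almost surely and would put a
    zero weight into a denominator.\<close>
  define E' where "E' = {e\<in>E. 0 < w e}"
  have E': "finite E'" "E' \<subseteq> E" using E by (auto simp: E'_def)
  have w0: "0 \<le> w e" for e by (simp add: w_def)
  have \<sigma>': "\<sigma> = (\<Sum>e\<in>E'. w e)"
    unfolding \<sigma> using E' E(1) w0 by (intro sum.mono_neutral_right) (auto simp: E'_def not_less order_antisym)
  let ?\<xi> = "\<lambda>\<omega>. \<Sum>i\<in>J. D s t (h i) \<omega> *\<^sub>R c i"
  have pars: "(norm (?\<xi> \<omega>))\<^sup>2 = (\<Sum>e\<in>E. (\<Sum>i\<in>J. (c i \<bullet> e) * D s t (h i) \<omega>)\<^sup>2)" for \<omega>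
  proof -
    have "?\<xi> \<omega> \<in> span (c ` J)" by (intro span_sum span_scale span_base) auto
    from E(2)[OF this] show ?thesis by (simp add: inner_sum_left mult.commute)
  qed
  have "AE \<omega> in M. \<forall>e\<in>E. D s t (v e) \<omega> = (\<Sum>i\<in>J. (c i \<bullet> e) * D s t (h i) \<omega>)"
    unfolding v_def using E(1) D_sum_AE[OF st(1,2) J] by (intro AE_finite_allI) auto
  moreover have "AE \<omega> in M. \<forall>e\<in>E. w e = 0 \<longrightarrow> D s t (v e) \<omega> = 0"
  proof (rule AE_finite_allI[OF E(1)])
    fix e
    show "AE \<omega> in M. w e = 0 \<longrightarrow> D s t (v e) \<omega> = 0"
      using D_linear_AE[OF st(1,2), of 0 0 0 0] by (auto simp: w_def)
  qed
  ultimately have pt: "AE \<omega> in M. norm (?\<xi> \<omega>) ^ (2 * m) \<le> \<sigma> ^ (m - 1) * (\<Sum>e\<in>E'. D s t (v e) \<omega> ^ (2 * m) / w e ^ (m - 1))"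
  proof eventually_elim
    case (elim \<omega>)
    have "(norm (?\<xi> \<omega>))\<^sup>2 = (\<Sum>e\<in>E. (D s t (v e) \<omega>)\<^sup>2)" unfolding pars using elim(1) by simp
    also have "\<dots> = (\<Sum>e\<in>E'. (D s t (v e) \<omega>)\<^sup>2)"
      using E(1) E' elim(2) w0 by (intro sum.mono_neutral_right) (auto simp: E'_def not_less order_antisym)
    finally have "norm (?\<xi> \<omega>) ^ (2 * m) = (\<Sum>e\<in>E'. (D s t (v e) \<omega>)\<^sup>2) ^ m" by (simp add: power_mult)
    also have "\<dots> \<le> (\<Sum>e\<in>E'. w e) ^ (m - 1) * (\<Sum>e\<in>E'. ((D s t (v e) \<omega>)\<^sup>2) ^ m / w e ^ (m - 1))"
      using E'(1) m by (intro sum_power_le_weighted) (auto simp: E'_def)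
    finally show ?case by (simp add: \<sigma>' power_mult)
  qed
  let ?X = "\<lambda>\<omega>. indicator B \<omega> :: real"
  have X: "?X \<in> borel_measurable (FF s)" "integrable M ?X"
    using B by (auto intro!: integrable_real_indicator simp: less_top[symmetric])
  note mom = D_mult_moment[OF st X, where m=m]
  define R where "R \<omega> = \<sigma> ^ (m - 1) * (\<Sum>e\<in>E'. ?X \<omega> * D s t (v e) \<omega> ^ (2 * m) / w e ^ (m - 1))" for \<omega>
  have iR: "integrable M R" unfolding R_def[abs_def]
    by (intro integrable_mult_right Bochner_Integration.integrable_sum integrable_divide_zero mom(1))
  have \<sigma>0: "0 \<le> \<sigma>" unfolding \<sigma> using w0 by (simp add: sum_nonneg)
  have R0: "0 \<le> R \<omega>" for \<omega> unfolding R_def using \<sigma>0 w0 by (intro mult_nonneg_nonneg sum_nonneg) auto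
  have "(\<integral>\<^sup>+\<omega>. indicator B \<omega> * ennreal (norm (?\<xi> \<omega>) ^ (2 * m)) \<partial>M) \<le> (\<integral>\<^sup>+\<omega>. ennreal (R \<omega>) \<partial>M)"
    using pt by (intro nn_integral_mono_AE) (auto elim!: eventually_mono simp: R_def indicator_def intro!: ennreal_leI)
  also have "\<dots> = ennreal (expectation R)" using iR R0 by (intro nn_integral_eq_integral) auto
  also have "expectation R = \<sigma> ^ (m - 1) * (\<Sum>e\<in>E'. prob B * (gauss_moment m * ((t - s) * w e) ^ m) / w e ^ (m - 1))"
    unfolding R_def[abs_def] using mom
    by (simp add: Bochner_Integration.integral_sum w_def)
  also have "(\<Sum>e\<in>E'. prob B * (gauss_moment m * ((t - s) * w e) ^ m) / w e ^ (m - 1)) =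
    (\<Sum>e\<in>E'. prob B * gauss_moment m * (t - s) ^ m * w e)"
  proof (intro sum.cong refl)
    fix e assume "e \<in> E'"
    then have "w e \<noteq> 0" by (simp add: E'_def)
    moreover obtain k where "m = Suc k" using m by (cases m) auto
    ultimately show "prob B * (gauss_moment m * ((t - s) * w e) ^ m) / w e ^ (m - 1) = prob B * gauss_moment m * (t - s) ^ m * w e"
      by (simp add: power_mult_distrib)
  qed
  also have "\<sigma> ^ (m - 1) * (\<Sum>e\<in>E'. prob B * gauss_moment m * (t - s) ^ m * w e) = prob B * (gauss_moment m * ((t - s) * \<sigma>) ^ m)"
  proof -
    have "\<sigma> ^ (m - 1) * \<sigma> = \<sigma> ^ m" using m by (cases m) auto
    then show ?thesis
      by (simp add: sum_distrib_left[symmetric] \<sigma>'[symmetric] power_mult_distrib)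
  qed
  also have "ennreal \<dots> = (\<integral>\<^sup>+\<omega>. ennreal (gauss_moment m * ((t - s) * \<sigma>) ^ m) * indicator B \<omega> \<partial>M)"
  proof -
    define K where "K = gauss_moment m * ((t - s) * \<sigma>) ^ m"
    have "0 \<le> K" unfolding K_def using gauss_moment_nonneg st \<sigma>0 by simp
    moreover have "(\<integral>\<^sup>+\<omega>. ennreal K * indicator B \<omega> \<partial>M) = ennreal K * ennreal (prob B)"
      by (simp add: nn_integral_cmult_indicator emeasure_eq_measure)
    ultimately show ?thesis unfolding K_def[symmetric] by (simp add: ennreal_mult mult.commute[of "prob B"])
  qed
  finally show ?thesis by (simp add: \<sigma>_def mult.commute)
qed

text \<open>On each of the finitely many past sets where all coefficients are constant, the bound
  for fixed vectors applies; the functions \<open>c\<close> in the finite product \<open>P\<close>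
  enumerate these sets.\<close>

lemma wsum_moment_simple:
  fixes y :: "nat \<Rightarrow> 'w \<Rightarrow> 'y::{real_inner,banach,second_countable_topology}"
  assumes st: "0 \<le> s" "s \<le> t" "t \<le> T" and J: "finite J"
    and h: "\<And>i j. i \<in> J \<Longrightarrow> j \<in> J \<Longrightarrow> h i \<bullet> h j = (if i = j then 1 else 0)"
    and y: "\<And>i. i \<in> J \<Longrightarrow> simple_function (FF s) (y i)"
    and B: "B \<in> sets (FF s)" and m: "1 \<le> m"
  shows "(\<integral>\<^sup>+\<omega>. indicator B \<omega> * ennreal (norm (wsum s t J h y \<omega>) ^ (2 * m)) \<partial>M) \<le>
    (\<integral>\<^sup>+\<omega>. indicator B \<omega> * ennreal (gauss_moment m * ((t - s) * (\<Sum>i\<in>J. (norm (y i \<omega>))\<^sup>2)) ^ m) \<partial>M)"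
proof -
  have s: "s \<in> {0..T}" using st by auto
  have sp: "space (FF s) = space M" using FF_subalgebra[OF s] by (simp add: subalgebra_def)
  define P where "P = (\<Pi>\<^sub>E i\<in>J. y i ` space M)"
  have P: "finite P" unfolding P_def using y by (intro finite_PiE J) (auto simp: simple_function_def sp)
  define A where "A c = B \<inter> (\<Inter>i\<in>J. {\<omega>\<in>space M. y i \<omega> = c i})" for c
  have AF: "A c \<in> sets (FF s)" if "c \<in> P" for c
  proof (cases "J = {}")
    case True then show ?thesis using B by (simp add: A_def)
  next
    case False
    have "{\<omega>\<in>space M. y i \<omega> = c i} \<in> sets (FF s)" if "i \<in> J" for i
      using simple_functionD(2)[OF y[OF that], of "{c i}"] by (simp add: vimage_def sp Int_def conj_commute)
    then show ?thesis unfolding A_def using False J B by (intro sets.Int sets.finite_INT) auto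
  qed
  note AM = FF_sets_M[OF s AF]
  have split: "(\<integral>\<^sup>+\<omega>. indicator B \<omega> * f \<omega> \<partial>M) = (\<Sum>c\<in>P. \<integral>\<^sup>+\<omega>. indicator (A c) \<omega> * f \<omega> \<partial>M)"
    if [measurable]: "f \<in> borel_measurable M" for f
  proof -
    have "(\<integral>\<^sup>+\<omega>. indicator B \<omega> * f \<omega> \<partial>M) = (\<integral>\<^sup>+\<omega>. (\<Sum>c\<in>P. indicator (A c) \<omega> * f \<omega>) \<partial>M)"
    proof (rule nn_integral_cong)
      fix \<omega> assume \<omega>: "\<omega> \<in> space M"
      let ?c = "\<lambda>i\<in>J. y i \<omega>"
      have c: "?c \<in> P" using \<omega> by (auto simp: P_def)
      have "indicator (A c) \<omega> * f \<omega> = (if c = ?c then indicator B \<omega> * f \<omega> else 0)" if "c \<in> P" for c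
      proof -
        have "(\<forall>i\<in>J. y i \<omega> = c i) \<longleftrightarrow> c = ?c"
          using that by (auto simp: P_def PiE_def extensional_def fun_eq_iff)
        then show ?thesis using \<omega> by (auto simp: A_def indicator_def)
      qed
      then show "indicator B \<omega> * f \<omega> = (\<Sum>c\<in>P. indicator (A c) \<omega> * f \<omega>)" using c P by simp
    qed
    also have "\<dots> = (\<Sum>c\<in>P. \<integral>\<^sup>+\<omega>. indicator (A c) \<omega> * f \<omega> \<partial>M)"
      by (intro nn_integral_sum) (use AM in measurable)
    finally show ?thesis .
  qed
  have [measurable]: "y i \<in> borel_measurable M" if "i \<in> J" for i
    by (rule FF_M[OF s borel_measurable_simple_function[OF y[OF that]]])
  have [measurable]: "wsum s t J h y \<in> borel_measurable M" by (intro wsum_measurable) simp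
  have "(\<integral>\<^sup>+\<omega>. indicator B \<omega> * ennreal (norm (wsum s t J h y \<omega>) ^ (2 * m)) \<partial>M) =
    (\<Sum>c\<in>P. \<integral>\<^sup>+\<omega>. indicator (A c) \<omega> * ennreal (norm (\<Sum>i\<in>J. D s t (h i) \<omega> *\<^sub>R c i) ^ (2 * m)) \<partial>M)"
    by (subst split) (auto intro!: sum.cong nn_integral_cong simp: A_def indicator_def wsum_def)
  also have "\<dots> \<le> (\<Sum>c\<in>P. \<integral>\<^sup>+\<omega>. indicator (A c) \<omega> * ennreal (gauss_moment m * ((t - s) * (\<Sum>i\<in>J. (norm (c i))\<^sup>2)) ^ m) \<partial>M)"
    by (intro sum_mono wsum_moment_const st J h AF m)
  also have "\<dots> = (\<integral>\<^sup>+\<omega>. indicator B \<omega> * ennreal (gauss_moment m * ((t - s) * (\<Sum>i\<in>J. (norm (y i \<omega>))\<^sup>2)) ^ m) \<partial>M)"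
    by (subst split) (auto intro!: sum.cong nn_integral_cong simp: A_def indicator_def)
  finally show ?thesis .
qed

text \<open>Simple approximations from the past can be taken dominated by
  \<open>2 * norm (y i)\<close>. Fatou's lemma treats the left side and dominated convergence the
  right side. The factor 2 enters the dominating function only, so the constant of the simple case
  is kept.\<close>

lemma wsum_moment:
  fixes y :: "nat \<Rightarrow> 'w \<Rightarrow> 'y::{real_inner,banach,second_countable_topology}"
  assumes st: "0 \<le> s" "s \<le> t" "t \<le> T" and J: "finite J"
    and h: "\<And>i j. i \<in> J \<Longrightarrow> j \<in> J \<Longrightarrow> h i \<bullet> h j = (if i = j then 1 else 0)"
    and y: "\<And>i. i \<in> J \<Longrightarrow> y i \<in> borel_measurable (FF s)" "\<And>i \<omega>. i \<in> J \<Longrightarrow> norm (y i \<omega>) \<le> L"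
    and B: "B \<in> sets (FF s)" and m: "1 \<le> m"
  shows "(\<integral>\<^sup>+\<omega>. indicator B \<omega> * ennreal (norm (wsum s t J h y \<omega>) ^ (2 * m)) \<partial>M) \<le>
    (\<integral>\<^sup>+\<omega>. indicator B \<omega> * ennreal (gauss_moment m * ((t - s) * (\<Sum>i\<in>J. (norm (y i \<omega>))\<^sup>2)) ^ m) \<partial>M)"
proof -
  have s: "s \<in> {0..T}" using st by auto
  have sp: "space (FF s) = space M" using FF_subalgebra[OF s] by (simp add: subalgebra_def)
  note [measurable] = FF_sets_M[OF s B]
  have "\<exists>f. (\<forall>n. simple_function (FF s) (f n)) \<and> (\<forall>\<omega>\<in>space M. (\<lambda>n. f n \<omega>) \<longlonglongrightarrow> y i \<omega>) \<and>
      (\<forall>n. \<forall>\<omega>\<in>space M. norm (f n \<omega>) \<le> 2 * norm (y i \<omega>))" if "i \<in> J" for i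
    using borel_measurable_implies_sequence_metric[OF y(1)[OF that], of 0] by (simp add: sp)
  then obtain f where f: "\<And>i n. i \<in> J \<Longrightarrow> simple_function (FF s) (f i n)"
    "\<And>i \<omega>. i \<in> J \<Longrightarrow> \<omega> \<in> space M \<Longrightarrow> (\<lambda>n. f i n \<omega>) \<longlonglongrightarrow> y i \<omega>"
    "\<And>i n \<omega>. i \<in> J \<Longrightarrow> \<omega> \<in> space M \<Longrightarrow> norm (f i n \<omega>) \<le> 2 * norm (y i \<omega>)" by metis
  have fM: "f i n \<in> borel_measurable M" if "i \<in> J" for i n
    by (rule FF_M[OF s borel_measurable_simple_function[OF f(1)[OF that]]])
  have yM: "y i \<in> borel_measurable M" if "i \<in> J" for i by (rule FF_M[OF s y(1)[OF that]])
  let ?g = "\<lambda>y \<omega>. indicator B \<omega> * ennreal (gauss_moment m * ((t - s) * (\<Sum>i\<in>J. (norm (y i \<omega>))\<^sup>2)) ^ m)"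
  let ?w = "\<lambda>y \<omega>. indicator B \<omega> * ennreal (norm (wsum s t J h y \<omega>) ^ (2 * m))"
  have cnv: "(\<lambda>n. indicator B \<omega> * ennreal (F n)) \<longlonglongrightarrow> indicator B \<omega> * ennreal l" if "F \<longlonglongrightarrow> l" for F l \<omega>
    using tendsto_ennrealI[OF that] by (cases "\<omega> \<in> B") auto
  have gm: "?g y \<in> borel_measurable M" if "\<And>i. i \<in> J \<Longrightarrow> y i \<in> borel_measurable M" for y :: "nat \<Rightarrow> 'w \<Rightarrow> 'y"
    using that by measurable
  show ?thesis
  proof (rule nn_integral_le_of_AE_limit[where f="\<lambda>n. ?w (\<lambda>i. f i n)" and a="\<lambda>n. \<integral>\<^sup>+\<omega>. ?g (\<lambda>i. f i n) \<omega> \<partial>M"])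
    fix n
    have [measurable]: "wsum s t J h (\<lambda>i. f i n) \<in> borel_measurable M" by (intro wsum_measurable fM)
    show "?w (\<lambda>i. f i n) \<in> borel_measurable M" by measurable
    show "(\<integral>\<^sup>+\<omega>. ?w (\<lambda>i. f i n) \<omega> \<partial>M) \<le> (\<integral>\<^sup>+\<omega>. ?g (\<lambda>i. f i n) \<omega> \<partial>M)"
      by (intro wsum_moment_simple st J h f(1) B m)
  next
    show "AE \<omega> in M. (\<lambda>n. ?w (\<lambda>i. f i n) \<omega>) \<longlonglongrightarrow> ?w y \<omega>"
      by (rule AE_I2, rule cnv) (auto simp: wsum_def intro!: tendsto_intros f(2))
    show "(\<lambda>n. \<integral>\<^sup>+\<omega>. ?g (\<lambda>i. f i n) \<omega> \<partial>M) \<longlonglongrightarrow> (\<integral>\<^sup>+\<omega>. ?g y \<omega> \<partial>M)"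
    proof (rule nn_integral_dominated_convergence[where w="\<lambda>\<omega>. ennreal (gauss_moment m * ((t - s) * (\<Sum>i\<in>J. (2 * L)\<^sup>2)) ^ m)"])
      show "?g (\<lambda>i. f i n) \<in> borel_measurable M" for n by (rule gm[OF fM])
      show "?g y \<in> borel_measurable M" by (rule gm[OF yM])
      show "AE \<omega> in M. (\<lambda>n. ?g (\<lambda>i. f i n) \<omega>) \<longlonglongrightarrow> ?g y \<omega>"
        by (rule AE_I2, rule cnv) (auto intro!: tendsto_intros f(2))
      show "AE \<omega> in M. ?g (\<lambda>i. f i n) \<omega> \<le> ennreal (gauss_moment m * ((t - s) * (\<Sum>i\<in>J. (2 * L)\<^sup>2)) ^ m)" for n
      proof (rule AE_I2)
        fix \<omega> assume \<omega>: "\<omega> \<in> space M"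
        have "norm (f i n \<omega>) \<le> 2 * L" if "i \<in> J" for i
          using f(3)[OF that \<omega>, of n] y(2)[OF that, of \<omega>] by linarith
        then have "gauss_moment m * ((t - s) * (\<Sum>i\<in>J. (norm (f i n \<omega>))\<^sup>2)) ^ m \<le> gauss_moment m * ((t - s) * (\<Sum>i\<in>J. (2 * L)\<^sup>2)) ^ m"
          using st gauss_moment_nonneg by (intro mult_left_mono power_mono sum_mono) (auto intro!: mult_nonneg_nonneg sum_nonneg)
        then show "?g (\<lambda>i. f i n) \<omega> \<le> ennreal (gauss_moment m * ((t - s) * (\<Sum>i\<in>J. (2 * L)\<^sup>2)) ^ m)"
          by (auto simp: indicator_def intro!: ennreal_leI)
      qed
      show "(\<integral>\<^sup>+\<omega>. ennreal (gauss_moment m * ((t - s) * (\<Sum>i\<in>J. (2 * L)\<^sup>2)) ^ m) \<partial>M) < \<infinity>"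
        by (simp add: emeasure_space_1)
    qed simp
  qed
qed

end

locale adapted_increment = cylindrical_noise M T FF W
  for M :: "'w measure" and T FF and W :: "(real \<Rightarrow> 'h::{real_inner,banach,second_countable_topology}) \<Rightarrow> 'w \<Rightarrow> real" +
  fixes s t :: real and I :: "nat set" and h :: "nat \<Rightarrow> 'h"
    and y :: "nat \<Rightarrow> 'w \<Rightarrow> 'y::{real_inner,banach,second_countable_topology}" and \<gamma> :: "'w \<Rightarrow> real" and L :: real
    and Z :: "'w \<Rightarrow> 'y"
  assumes st: "0 \<le> s" "s \<le> t" "t \<le> T"
    and h: "\<And>i j. i \<in> I \<Longrightarrow> j \<in> I \<Longrightarrow> h i \<bullet> h j = (if i = j then 1 else 0)"
    and y: "\<And>i. i \<in> I \<Longrightarrow> y i \<in> borel_measurable (FF s)"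
    and \<gamma>: "\<gamma> \<in> borel_measurable (FF s)" "\<And>\<omega>. 0 \<le> \<gamma> \<omega>" "\<And>\<omega>. \<gamma> \<omega> \<le> L"
    and y\<gamma>: "\<And>n \<omega>. (\<Sum>i\<in>I \<inter> {..<n}. (norm (y i \<omega>))\<^sup>2) \<le> (\<gamma> \<omega>)\<^sup>2"
    and Z: "Z \<in> borel_measurable M"
    and lim: "(\<lambda>n. \<integral>\<^sup>+\<omega>. ennreal ((norm (Z \<omega> - wsum s t (I \<inter> {..<n}) h y \<omega>))\<^sup>2) \<partial>M) \<longlonglongrightarrow> 0"
begin

abbreviation \<xi> :: "nat \<Rightarrow> 'w \<Rightarrow> 'y" where "\<xi> n \<equiv> wsum s t (I \<inter> {..<n}) h y"

lemma s_in: "s \<in> {0..T}" using st by auto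

lemma y_bound: "i \<in> I \<Longrightarrow> norm (y i \<omega>) \<le> L"
proof -
  assume i: "i \<in> I"
  have "(norm (y i \<omega>))\<^sup>2 \<le> (\<Sum>i\<in>I \<inter> {..<Suc i}. (norm (y i \<omega>))\<^sup>2)"
    using i by (intro member_le_sum) auto
  also have "\<dots> \<le> (\<gamma> \<omega>)\<^sup>2" by (rule y\<gamma>)
  finally have "norm (y i \<omega>) \<le> \<gamma> \<omega>" by (rule power2_le_imp_le) (rule \<gamma>(2))
  then show ?thesis using \<gamma>(3)[of \<omega>] by linarith
qed

lemma xi_measurable[measurable]: "\<xi> n \<in> borel_measurable M"
  by (intro wsum_measurable FF_M[OF s_in] y) auto

lemma AE_subseq:
  obtains r where "strict_mono r" "AE \<omega> in M. (\<lambda>n. \<xi> (r n) \<omega>) \<longlonglongrightarrow> Z \<omega>"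
proof -
  note [measurable] = Z
  obtain r where r: "strict_mono r" "AE \<omega> in M. (\<lambda>n. (norm (Z \<omega> - \<xi> (r n) \<omega>))\<^sup>2) \<longlonglongrightarrow> 0"
    by (rule nn_integral_tendsto_0_AE_subseq[OF _ _ lim]) auto
  from r(2) have "AE \<omega> in M. (\<lambda>n. \<xi> (r n) \<omega>) \<longlonglongrightarrow> Z \<omega>"
  proof eventually_elim
    case (elim \<omega>)
    have "(\<lambda>n. sqrt ((norm (Z \<omega> - \<xi> (r n) \<omega>))\<^sup>2)) \<longlonglongrightarrow> sqrt 0" by (rule tendsto_real_sqrt[OF elim])
    then have "(\<lambda>n. norm (\<xi> (r n) \<omega> - Z \<omega>)) \<longlonglongrightarrow> 0" by (simp add: norm_minus_commute)
    then show ?case by (simp add: LIM_zero_cancel tendsto_norm_zero_iff)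
  qed
  then show ?thesis using that r(1) by blast
qed

text \<open>The exact second moments of the partial sums pass to \<open>Z\<close> by Fatou's lemma
  along an almost surely convergent subsequence; the one-step estimate asks for this upper bound
  only.\<close>

lemma increment_var:
  assumes B: "B \<in> sets (FF s)"
  shows "(\<integral>\<^sup>+\<omega>. indicator B \<omega> * ennreal ((norm (Z \<omega>))\<^sup>2) \<partial>M) \<le>
    (\<integral>\<^sup>+\<omega>. indicator B \<omega> * ennreal ((t - s) * (\<gamma> \<omega>)\<^sup>2) \<partial>M)" (is "_ \<le> ?R")
proof -
  note [measurable] = FF_sets_M[OF s_in B]
  obtain r where r: "AE \<omega> in M. (\<lambda>n. \<xi> (r n) \<omega>) \<longlonglongrightarrow> Z \<omega>" using AE_subseq by blast
  show ?thesis
  proof (rule nn_integral_le_of_AE_limit[where a="\<lambda>_. ?R" and f="\<lambda>n \<omega>. indicator B \<omega> * ennreal ((norm (\<xi> (r n) \<omega>))\<^sup>2)"])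
    fix n
    have "(\<integral>\<^sup>+\<omega>. indicator B \<omega> * ennreal ((norm (\<xi> (r n) \<omega>))\<^sup>2) \<partial>M) =
      (\<integral>\<^sup>+\<omega>. indicator B \<omega> * ennreal ((t - s) * (\<Sum>i\<in>I \<inter> {..<r n}. (norm (y i \<omega>))\<^sup>2)) \<partial>M)"
      by (rule wsum_var[OF st _ _ _ _ B, where L=L]) (auto simp: h y y_bound)
    also have "\<dots> \<le> ?R" using st y\<gamma> by (intro nn_integral_mono mult_left_mono ennreal_leI) auto
    finally show "(\<integral>\<^sup>+\<omega>. indicator B \<omega> * ennreal ((norm (\<xi> (r n) \<omega>))\<^sup>2) \<partial>M) \<le> ?R" .
    show "AE \<omega> in M. (\<lambda>n. indicator B \<omega> * ennreal ((norm (\<xi> (r n) \<omega>))\<^sup>2)) \<longlonglongrightarrow> indicator B \<omega> * ennreal ((norm (Z \<omega>))\<^sup>2)"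
      using r
    proof eventually_elim
      case (elim \<omega>)
      then show ?case by (cases "\<omega> \<in> B") (auto intro!: tendsto_intros)
    qed
  qed auto
qed

lemma increment_moment:
  assumes B: "B \<in> sets (FF s)" and m: "1 \<le> m"
  shows "(\<integral>\<^sup>+\<omega>. indicator B \<omega> * ennreal (norm (Z \<omega>) ^ (2 * m)) \<partial>M) \<le>
    (\<integral>\<^sup>+\<omega>. indicator B \<omega> * ennreal (gauss_moment m * ((t - s) * L\<^sup>2) ^ m) \<partial>M)" (is "_ \<le> ?R")
proof -
  note [measurable] = FF_sets_M[OF s_in B]
  obtain r where r: "AE \<omega> in M. (\<lambda>n. \<xi> (r n) \<omega>) \<longlonglongrightarrow> Z \<omega>" using AE_subseq by blast
  show ?thesis
  proof (rule nn_integral_le_of_AE_limit[where a="\<lambda>_. ?R" and f="\<lambda>n \<omega>. indicator B \<omega> * ennreal (norm (\<xi> (r n) \<omega>) ^ (2 * m))"])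
    fix n
    have "(\<integral>\<^sup>+\<omega>. indicator B \<omega> * ennreal (norm (\<xi> (r n) \<omega>) ^ (2 * m)) \<partial>M) \<le>
      (\<integral>\<^sup>+\<omega>. indicator B \<omega> * ennreal (gauss_moment m * ((t - s) * (\<Sum>i\<in>I \<inter> {..<r n}. (norm (y i \<omega>))\<^sup>2)) ^ m) \<partial>M)"
      by (rule wsum_moment[OF st _ _ _ _ B m, where L=L]) (auto simp: h y y_bound)
    also have "\<dots> \<le> ?R"
    proof (intro nn_integral_mono mult_left_mono ennreal_leI power_mono)
      fix \<omega>
      have "(\<gamma> \<omega>)\<^sup>2 \<le> L\<^sup>2" using \<gamma> by (intro power_mono) auto
      then show "(\<Sum>i\<in>I \<inter> {..<r n}. (norm (y i \<omega>))\<^sup>2) \<le> L\<^sup>2" using y\<gamma>[where n="r n" and \<omega>=\<omega>] by linarith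
    qed (use st gauss_moment_nonneg in \<open>auto intro!: mult_nonneg_nonneg sum_nonneg\<close>)
    finally show "(\<integral>\<^sup>+\<omega>. indicator B \<omega> * ennreal (norm (\<xi> (r n) \<omega>) ^ (2 * m)) \<partial>M) \<le> ?R" .
    show "AE \<omega> in M. (\<lambda>n. indicator B \<omega> * ennreal (norm (\<xi> (r n) \<omega>) ^ (2 * m))) \<longlonglongrightarrow> indicator B \<omega> * ennreal (norm (Z \<omega>) ^ (2 * m))"
      using r
    proof eventually_elim
      case (elim \<omega>)
      then show ?case by (cases "\<omega> \<in> B") (auto intro!: tendsto_intros)
    qed
  qed auto
qed

lemma increment_measurable:
  shows "Z \<in> borel_measurable (FF t)"
proof -
  obtain r where r: "AE \<omega> in M. (\<lambda>n. \<xi> (r n) \<omega>) \<longlonglongrightarrow> Z \<omega>" using AE_subseq by blast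
  have t: "t \<in> {0..T}" using st by auto
  have \<xi>t: "\<xi> n \<in> borel_measurable (FF t)" for n
  proof -
    have "y i \<in> borel_measurable (FF t)" if "i \<in> I" for i
      using measurable_from_subalg[OF FF_subalgebra_mono[OF st] y[OF that]] .
    then show ?thesis unfolding wsum_def[abs_def] using D_measurable_FF[OF st]
      by (intro borel_measurable_sum borel_measurable_scaleR) auto
  qed
  \<comment> \<open>\<open>lim\<close> has some value even where the sequence diverges, so this is a
    version of \<open>Z\<close> that is measurable at time \<open>t\<close>; completeness then
    covers \<open>Z\<close> itself.\<close>
  have "(\<lambda>\<omega>. lim (\<lambda>n. \<xi> (r n) \<omega>)) \<in> borel_measurable (FF t)"
    using \<xi>t by (intro borel_measurable_lim_metric)
  then show ?thesis
    by (rule FF_complete[OF t]) (use r in \<open>auto elim!: eventually_mono simp: limI\<close>)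
qed

text \<open>The partial sums have mean zero against \<open>z\<close>, and \<open>z\<close> is
  bounded, so the mean of the pairing with \<open>Z\<close> is controlled by the L2 distance of
  \<open>Z\<close> to the partial sums, which becomes arbitrarily small.\<close>

lemma increment_mean:
  assumes z: "z \<in> borel_measurable (FF s)" "\<And>\<omega>. norm (z \<omega>) \<le> c"
  shows "expectation (\<lambda>\<omega>. z \<omega> \<bullet> Z \<omega>) = 0"
proof (rule ccontr)
  assume nz: "expectation (\<lambda>\<omega>. z \<omega> \<bullet> Z \<omega>) \<noteq> 0"
  note [measurable] = Z FF_M[OF s_in z(1)]
  have c0: "0 \<le> c" using z(2)[of undefined] norm_ge_zero order_trans by blast
  \<comment> \<open>An L2 distance below \<open>d\<close> will bound the expectation by
    \<open>c * d\<close>, while its absolute value is \<open>(c + 1) * d\<close> by this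
    choice.\<close>
  define d where "d = \<bar>expectation (\<lambda>\<omega>. z \<omega> \<bullet> Z \<omega>)\<bar> / (c + 1)"
  have d: "0 < d" using nz c0 by (simp add: d_def)
  have "\<forall>\<^sub>F n in sequentially. (\<integral>\<^sup>+\<omega>. ennreal ((norm (Z \<omega> - \<xi> n \<omega>))\<^sup>2) \<partial>M) < ennreal (d\<^sup>2)"
    using lim d by (intro order_tendstoD(2)) auto
  then obtain n where n: "(\<integral>\<^sup>+\<omega>. ennreal ((norm (Z \<omega> - \<xi> n \<omega>))\<^sup>2) \<partial>M) < ennreal (d\<^sup>2)"
    by (auto simp: eventually_sequentially)
  have i2: "integrable M (\<lambda>\<omega>. (norm (Z \<omega> - \<xi> n \<omega>))\<^sup>2)"
    by (rule integrableI_nonneg) (use n in \<open>auto intro: less_trans\<close>)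
  have e2: "expectation (\<lambda>\<omega>. (norm (Z \<omega> - \<xi> n \<omega>))\<^sup>2) \<le> d\<^sup>2"
    using n nn_integral_eq_integral[OF i2] by (simp add: ennreal_less_iff less_imp_le)
  \<comment> \<open>The pointwise inequality \<open>2 * x \<le> d + x^2 / d\<close> takes the place
    of the Cauchy-Schwarz inequality for integrals.\<close>
  have bd: "\<bar>z \<omega> \<bullet> (Z \<omega> - \<xi> n \<omega>)\<bar> \<le> c * ((d + (norm (Z \<omega> - \<xi> n \<omega>))\<^sup>2 / d) / 2)" for \<omega>
  proof -
    have "2 * norm (Z \<omega> - \<xi> n \<omega>) \<le> d + (norm (Z \<omega> - \<xi> n \<omega>))\<^sup>2 / d"
      using zero_le_power2[of "norm (Z \<omega> - \<xi> n \<omega>) - d"] d by (simp add: power2_eq_square field_simps)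
    then have "norm (z \<omega>) * norm (Z \<omega> - \<xi> n \<omega>) \<le> c * ((d + (norm (Z \<omega> - \<xi> n \<omega>))\<^sup>2 / d) / 2)"
      by (intro mult_mono z(2) c0) auto
    then show ?thesis using Cauchy_Schwarz_ineq2[of "z \<omega>" "Z \<omega> - \<xi> n \<omega>"] by linarith
  qed
  have i1: "integrable M (\<lambda>\<omega>. c * ((d + (norm (Z \<omega> - \<xi> n \<omega>))\<^sup>2 / d) / 2))"
    using i2 by (intro integrable_mult_right integrable_divide_zero Bochner_Integration.integrable_add) auto
  have iz: "integrable M (\<lambda>\<omega>. z \<omega> \<bullet> (Z \<omega> - \<xi> n \<omega>))"
    by (rule Bochner_Integration.integrable_bound[OF i1]) (use bd in \<open>auto intro!: AE_I2 order_trans[OF _ abs_ge_self]\<close>)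
  have m: "integrable M (\<lambda>\<omega>. z \<omega> \<bullet> \<xi> n \<omega>)" "expectation (\<lambda>\<omega>. z \<omega> \<bullet> \<xi> n \<omega>) = 0"
    by (rule wsum_mean[OF st _ _ _ z, where L=L]; auto simp: y y_bound)+
  have "expectation (\<lambda>\<omega>. z \<omega> \<bullet> Z \<omega>) = expectation (\<lambda>\<omega>. z \<omega> \<bullet> (Z \<omega> - \<xi> n \<omega>) + z \<omega> \<bullet> \<xi> n \<omega>)"
    by (simp add: inner_diff_right)
  also have "\<dots> = expectation (\<lambda>\<omega>. z \<omega> \<bullet> (Z \<omega> - \<xi> n \<omega>))" using iz m by simp
  finally have "\<bar>expectation (\<lambda>\<omega>. z \<omega> \<bullet> Z \<omega>)\<bar> \<le> expectation (\<lambda>\<omega>. \<bar>z \<omega> \<bullet> (Z \<omega> - \<xi> n \<omega>)\<bar>)" by simp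
  also have "\<dots> \<le> expectation (\<lambda>\<omega>. c * ((d + (norm (Z \<omega> - \<xi> n \<omega>))\<^sup>2 / d) / 2))"
    by (intro integral_mono integrable_abs iz i1 bd)
  also have "\<dots> = c * ((d + expectation (\<lambda>\<omega>. (norm (Z \<omega> - \<xi> n \<omega>))\<^sup>2) / d) / 2)"
    using i2 by (simp add: prob_space)
  also have "\<dots> \<le> c * ((d + d\<^sup>2 / d) / 2)"
    using e2 d c0 by (intro mult_left_mono divide_right_mono add_left_mono) auto
  also have "\<dots> = c * d" using d by (simp add: power2_eq_square)
  also have "\<dots> < (c + 1) * d" using d by simp
  also have "\<dots> = \<bar>expectation (\<lambda>\<omega>. z \<omega> \<bullet> Z \<omega>)\<bar>" using c0 by (simp add: d_def)
  finally show False by simp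
qed

end

section \<open>The isometry for step processes\<close>

text \<open>Unlike \<open>hs_norm\<close>, the extended real sum is not \<open>0\<close> on operators that are not Hilbert--Schmidt.\<close>

definition hs_sq :: "nat set \<Rightarrow> (nat \<Rightarrow> 'h::real_inner) \<Rightarrow> ('h \<Rightarrow> 'y::real_inner) \<Rightarrow> ennreal" where
  "hs_sq I h R = (\<Sum>n. ennreal (indicator I n * (norm (R (h n)))\<^sup>2))"

lemma hs_sq_sums:
  assumes "(\<lambda>n. (norm (R (h n)))\<^sup>2) summable_on I"
  shows "(\<lambda>n. indicator I n * (norm (R (h n)))\<^sup>2) sums (hs_norm I h R)\<^sup>2"
proof -
  have "((\<lambda>n. (norm (R (h n)))\<^sup>2) has_sum (\<Sum>\<^sub>\<infinity>n\<in>I. (norm (R (h n)))\<^sup>2)) I"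
    using assms by (rule has_sum_infsum)
  then have "((\<lambda>n. indicator I n * (norm (R (h n)))\<^sup>2) has_sum (\<Sum>\<^sub>\<infinity>n\<in>I. (norm (R (h n)))\<^sup>2)) UNIV"
    by (subst has_sum_cong_neutral[where S=I and T=UNIV and g="\<lambda>n. indicator I n * (norm (R (h n)))\<^sup>2" and f="\<lambda>n. (norm (R (h n)))\<^sup>2", symmetric])
      auto
  moreover have "(hs_norm I h R)\<^sup>2 = (\<Sum>\<^sub>\<infinity>n\<in>I. (norm (R (h n)))\<^sup>2)"
    by (simp add: hs_norm_def infsum_nonneg)
  ultimately show ?thesis by (simp add: has_sum_imp_sums)
qed

lemma hs_sq_summable:
  assumes "(\<lambda>n. (norm (R (h n)))\<^sup>2) summable_on I"
  shows "hs_sq I h R = ennreal ((hs_norm I h R)\<^sup>2)"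
  unfolding hs_sq_def by (rule suminf_ennreal_eq[OF _ hs_sq_sums[where R=R and h=h and I=I, OF assms]]) simp

lemma hs_sq_hs_ops: "R \<in> hs_ops I h \<Longrightarrow> hs_sq I h R = ennreal ((hs_norm I h R)\<^sup>2)"
  by (rule hs_sq_summable[where R=R and h=h and I=I]) (simp add: hs_ops_def)

lemma hs_sq_finite_summable:
  assumes "hs_sq I h R < \<infinity>"
  shows "(\<lambda>n. (norm (R (h n)))\<^sup>2) summable_on I"
proof -
  have s: "summable (\<lambda>n. indicator I n * (norm (R (h n)))\<^sup>2)"
    by (rule summable_suminf_not_top) (use assms in \<open>auto simp: hs_sq_def\<close>)
  then have "summable (\<lambda>n. norm (indicator I n * (norm (R (h n)))\<^sup>2))" by simp
  then have "(\<lambda>n. indicator I n * (norm (R (h n)))\<^sup>2) summable_on UNIV"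
    by (rule norm_summable_imp_summable_on)
  then show "(\<lambda>n. (norm (R (h n)))\<^sup>2) summable_on I"
    by (subst summable_on_cong_neutral[where T=UNIV and g="\<lambda>n. indicator I n * (norm (R (h n)))\<^sup>2"]) auto
qed

lemma hs_sq_finite:
  assumes "hs_sq I h R < \<infinity>"
  shows "hs_sq I h R = ennreal ((hs_norm I h R)\<^sup>2)"
  by (rule hs_sq_summable[where R=R and h=h and I=I]) (rule hs_sq_finite_summable[OF assms])

lemma hs_sq_triangle:
  assumes "\<And>n. n \<in> I \<Longrightarrow> norm (R (h n)) \<le> norm (R1 (h n)) + norm (R2 (h n))"
  shows "hs_sq I h R \<le> 2 * hs_sq I h R1 + 2 * hs_sq I h R2"
proof -
  let ?f = "\<lambda>R n. indicator I n * (norm (R (h n)))\<^sup>2"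
  have "hs_sq I h R \<le> (\<Sum>n. 2 * ennreal (?f R1 n) + 2 * ennreal (?f R2 n))"
    unfolding hs_sq_def
  proof (intro suminf_le summableI)
    fix n
    have "?f R n \<le> 2 * ?f R1 n + 2 * ?f R2 n"
    proof (cases "n \<in> I")
      case True
      have "(norm (R (h n)))\<^sup>2 \<le> (norm (R1 (h n)) + norm (R2 (h n)))\<^sup>2" using assms[OF True] by (intro power_mono) auto
      also have "\<dots> \<le> 2 * (norm (R1 (h n)))\<^sup>2 + 2 * (norm (R2 (h n)))\<^sup>2"
        using zero_le_power2[of "norm (R1 (h n)) - norm (R2 (h n))"] by (simp add: power2_eq_square algebra_simps)
      finally show ?thesis using True by simp
    qed simp
    then have "ennreal (?f R n) \<le> ennreal (2 * ?f R1 n + 2 * ?f R2 n)" by (rule ennreal_leI)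
    also have "\<dots> = 2 * ennreal (?f R1 n) + 2 * ennreal (?f R2 n)" by (simp add: ennreal_mult)
    finally show "ennreal (?f R n) \<le> 2 * ennreal (?f R1 n) + 2 * ennreal (?f R2 n)" .
  qed
  also have "\<dots> = 2 * hs_sq I h R1 + 2 * hs_sq I h R2"
    by (simp add: suminf_add[symmetric] hs_sq_def)
  finally show ?thesis .
qed

text \<open>Parseval's identity sums the products
  \<open>(v i \<bullet> h n) * (v j \<bullet> h n)\<close> over the basis to
  \<open>v i \<bullet> v j\<close>, which leaves a finite double sum in which the basis no longer
  occurs.\<close>

lemma hs_sq_finite_rank:
  fixes \<alpha> :: "'i \<Rightarrow> 'y::real_inner" and h :: "nat \<Rightarrow> 'h::real_inner" and c :: "'i \<Rightarrow> real" and v :: "'i \<Rightarrow> 'h"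
  assumes onb: "orthonormal_basis I h" and J: "finite J"
  defines "Q \<equiv> \<Sum>i\<in>J. \<Sum>j\<in>J. (c i * c j * (v i \<bullet> v j)) * (\<alpha> i \<bullet> \<alpha> j)"
  shows "hs_sq I h (\<lambda>u. \<Sum>i\<in>J. (c i * (u \<bullet> v i)) *\<^sub>R \<alpha> i) = ennreal Q" and "0 \<le> Q"
proof -
  have eq: "indicator I n * (norm (\<Sum>i\<in>J. (c i * (h n \<bullet> v i)) *\<^sub>R \<alpha> i))\<^sup>2 =
    (\<Sum>i\<in>J. \<Sum>j\<in>J. (c i * c j * (\<alpha> i \<bullet> \<alpha> j)) * (indicator I n * ((v i \<bullet> h n) * (v j \<bullet> h n))))" for n
    by (simp add: power2_norm_eq_inner inner_sum_left inner_sum_right sum_distrib_left mult_ac inner_commute)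
  have s: "(\<lambda>n. indicator I n * (norm (\<Sum>i\<in>J. (c i * (h n \<bullet> v i)) *\<^sub>R \<alpha> i))\<^sup>2) sums
     (\<Sum>i\<in>J. \<Sum>j\<in>J. (c i * c j * (\<alpha> i \<bullet> \<alpha> j)) * (v i \<bullet> v j))"
    unfolding eq by (intro sums_sum sums_mult parseval_sums onb)
  then have s: "(\<lambda>n. indicator I n * (norm (\<Sum>i\<in>J. (c i * (h n \<bullet> v i)) *\<^sub>R \<alpha> i))\<^sup>2) sums Q"
    by (simp add: Q_def mult_ac)
  show "hs_sq I h (\<lambda>u. \<Sum>i\<in>J. (c i * (u \<bullet> v i)) *\<^sub>R \<alpha> i) = ennreal Q"
    unfolding hs_sq_def by (intro suminf_ennreal_eq s) auto
  show "0 \<le> Q" by (rule sums_le[OF _ sums_zero s]) auto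
qed

lemma integral_indicator_product_interval:
  fixes a b :: real
  assumes "a \<le> r1" "a \<le> r2" "q1 \<le> b" "q2 \<le> b"
  defines "f \<equiv> \<lambda>\<tau>. indicator {r1<..q1} \<tau> * indicator {r2<..q2} \<tau> :: real"
  shows "integrable (restrict_space lborel {a..b}) f"
    and "integral\<^sup>L (restrict_space lborel {a..b}) f = max 0 (min q1 q2 - max r1 r2)"
proof -
  have e: "(\<lambda>\<tau>. indicator {a..b} \<tau> *\<^sub>R f \<tau>) = indicator {max r1 r2<..min q1 q2}"
    using assms(1-4) by (auto simp: f_def indicator_def fun_eq_iff)
  have fin: "emeasure lborel {max r1 r2<..min q1 q2} < \<infinity>"
    by (cases "max r1 r2 \<le> min q1 q2") auto
  have "integrable lborel (\<lambda>\<tau>. indicator {a..b} \<tau> *\<^sub>R f \<tau>)"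
    unfolding e using fin by (intro integrable_real_indicator) auto
  then show "integrable (restrict_space lborel {a..b}) f"
    by (subst integrable_restrict_space) auto
  have "integral\<^sup>L (restrict_space lborel {a..b}) f = (\<integral>\<tau>. indicator {a..b} \<tau> *\<^sub>R f \<tau> \<partial>lborel)"
    by (rule integral_restrict_space) auto
  also have "\<dots> = max 0 (min q1 q2 - max r1 r2)"
    unfolding e by (cases "max r1 r2 \<le> min q1 q2") auto
  finally show "integral\<^sup>L (restrict_space lborel {a..b}) f = max 0 (min q1 q2 - max r1 r2)" .
qed

section \<open>Products of increments over overlapping intervals\<close>

context cylindrical_noise
begin

lemma D_integrable: 
  assumes "0 \<le> s" "s \<le> t" "t \<le> T"
  shows "integrable M (D s t u)"
proof -
  have "integrable M (\<lambda>\<omega>. 1 * D s t u \<omega>)" by (rule D_mult_mean(1)[OF assms]) auto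
  then show ?thesis by simp
qed

text \<open>The first increment is cut at \<open>r2\<close>. The part before \<open>r2\<close>
  belongs to the past and meets a centred increment; the part after \<open>r2\<close> starts
  together with the second increment, where the polarized product formula applies.\<close>

lemma D_product_ordered:
  fixes X :: "'w \<Rightarrow> real"
  assumes r: "0 \<le> r1" "r1 \<le> q1" "q1 \<le> T" "r1 \<le> r2" "r2 \<le> q2" "q2 \<le> T"
    and X: "X \<in> borel_measurable (FF r2)" "\<And>\<omega>. \<bar>X \<omega>\<bar> \<le> c"
  shows "integrable M (\<lambda>\<omega>. X \<omega> * (D r1 q1 v1 \<omega> * D r2 q2 v2 \<omega>))" (is ?A)
    and "expectation (\<lambda>\<omega>. X \<omega> * (D r1 q1 v1 \<omega> * D r2 q2 v2 \<omega>)) =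
      expectation X * (max 0 (min q1 q2 - max r1 r2) * (v1 \<bullet> v2))" (is ?B)
proof -
  have r2: "r2 \<in> {0..T}" "0 \<le> r2" using r by auto
  have XM[measurable]: "X \<in> borel_measurable M" by (rule FF_M[OF r2(1) X(1)])
  have iX: "integrable M X" by (rule integrable_const_bound[where B=c]) (use X in auto)
  have past: "integrable M (\<lambda>\<omega>. X \<omega> * (D r1 q v1 \<omega> * D r2 q2 v2 \<omega>))"
    "expectation (\<lambda>\<omega>. X \<omega> * (D r1 q v1 \<omega> * D r2 q2 v2 \<omega>)) = 0" if q: "r1 \<le> q" "q \<le> r2" for q
  proof -
    have "D r1 q v1 \<in> borel_measurable (FF r2)"
      by (rule measurable_from_subalg[OF FF_subalgebra_mono D_measurable_FF]) (use r q in auto)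
    then have m: "(\<lambda>\<omega>. X \<omega> * D r1 q v1 \<omega>) \<in> borel_measurable (FF r2)" using X by simp
    have i: "integrable M (\<lambda>\<omega>. X \<omega> * D r1 q v1 \<omega>)"
      by (rule integrable_bounded_mult[OF D_integrable XM X(2)]) (use r q in auto)
    show "integrable M (\<lambda>\<omega>. X \<omega> * (D r1 q v1 \<omega> * D r2 q2 v2 \<omega>))"
      "expectation (\<lambda>\<omega>. X \<omega> * (D r1 q v1 \<omega> * D r2 q2 v2 \<omega>)) = 0"
      using D_mult_mean[OF r2(2) r(5,6) m i] by (simp_all add: mult.assoc)
  qed
  have "?A \<and> ?B"
  proof (cases "q1 \<le> r2")
    case True
    then have "max 0 (min q1 q2 - max r1 r2) = 0" using r by simp
    then show ?thesis using past[OF r(2) True] by simp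
  next
    case False
    then have lt: "r2 \<le> q1" by simp
    have e: "X \<omega> * (D r1 q1 v1 \<omega> * D r2 q2 v2 \<omega>) =
      X \<omega> * (D r1 r2 v1 \<omega> * D r2 q2 v2 \<omega>) + X \<omega> * (D r2 q1 v1 \<omega> * D r2 q2 v2 \<omega>)" for \<omega>
      by (simp add: D_def algebra_simps)
    have "max 0 (min q1 q2 - max r1 r2) = min q1 q2 - r2" using r lt by (simp add: max_def min_def)
    then show ?thesis unfolding e
      using past[of r2] r D_mult_product[OF r2(2) lt r(3) r(5,6) X(1) iX] by simp
  qed
  then show ?A ?B by auto
qed

lemma D_product:
  fixes X :: "'w \<Rightarrow> real"
  assumes r: "0 \<le> r1" "r1 \<le> q1" "q1 \<le> T" "0 \<le> r2" "r2 \<le> q2" "q2 \<le> T"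
    and X: "X \<in> borel_measurable (FF (max r1 r2))" "\<And>\<omega>. \<bar>X \<omega>\<bar> \<le> c"
  shows "integrable M (\<lambda>\<omega>. X \<omega> * (D r1 q1 v1 \<omega> * D r2 q2 v2 \<omega>)) \<and>
    expectation (\<lambda>\<omega>. X \<omega> * (D r1 q1 v1 \<omega> * D r2 q2 v2 \<omega>)) =
      expectation X * (max 0 (min q1 q2 - max r1 r2) * (v1 \<bullet> v2))"
proof (cases "r1 \<le> r2")
  case True
  then show ?thesis using D_product_ordered[of r1 q1 r2 q2 X c v1 v2] r X by (simp add: max_def)
next
  case False
  then show ?thesis using D_product_ordered[of r2 q2 r1 q1 X c v2 v1] r X
    by (simp add: max.commute min.commute mult.commute[of "D r1 _ _ _"] inner_commute max_absorb2)
qed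

text \<open>Intervals may overlap, so off-diagonal pairs need not vanish. Both sides reduce to the
  same double sum over pairs: the length of the overlap appears once as a covariance and once as a
  time integral. The index type is left general so that two families of terms can be joined in one
  application.\<close>

lemma step_isometry:
  fixes \<alpha> :: "'i \<Rightarrow> 'w \<Rightarrow> 'y::{real_inner,banach,second_countable_topology}" and h :: "nat \<Rightarrow> 'h"
  assumes onb: "orthonormal_basis I h" and J: "finite J" and ab: "0 \<le> a" "b \<le> T"
    and r: "\<And>i. i \<in> J \<Longrightarrow> a \<le> r i" "\<And>i. i \<in> J \<Longrightarrow> r i \<le> q i" "\<And>i. i \<in> J \<Longrightarrow> q i \<le> b"
    and \<alpha>: "\<And>i. i \<in> J \<Longrightarrow> \<alpha> i \<in> borel_measurable (FF (r i))" "\<And>i \<omega>. i \<in> J \<Longrightarrow> norm (\<alpha> i \<omega>) \<le> L i"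
  shows "(\<integral>\<^sup>+\<omega>. ennreal ((norm (\<Sum>i\<in>J. D (r i) (q i) (v i) \<omega> *\<^sub>R \<alpha> i \<omega>))\<^sup>2) \<partial>M) =
    (\<integral>\<^sup>+(\<tau>, \<omega>). hs_sq I h (\<lambda>u. \<Sum>i\<in>J. (indicator {r i<..q i} \<tau> * (u \<bullet> v i)) *\<^sub>R \<alpha> i \<omega>)
       \<partial>(restrict_space lborel {a..b} \<Otimes>\<^sub>M M))"
proof -
  let ?N = "restrict_space lborel {a..b}"
  have rT: "r i \<in> {0..T}" "0 \<le> r i" "q i \<le> T" if "i \<in> J" for i using r[OF that] ab by auto
  have [measurable]: "\<alpha> i \<in> borel_measurable M" if "i \<in> J" for i by (rule FF_M[OF rT(1)[OF that] \<alpha>(1)[OF that]])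
  let ?ind = "\<lambda>i \<tau>. indicator {r i<..q i} \<tau> :: real"
  let ?X = "\<lambda>i j \<omega>. \<alpha> i \<omega> \<bullet> \<alpha> j \<omega>"
  have L0: "0 \<le> L i" if "i \<in> J" for i using \<alpha>(2)[OF that, of undefined] norm_ge_zero order_trans by blast
  have Xb: "\<bar>?X i j \<omega>\<bar> \<le> L i * L j" if "i \<in> J" "j \<in> J" for i j \<omega>
    using Cauchy_Schwarz_ineq2[of "\<alpha> i \<omega>" "\<alpha> j \<omega>"] mult_mono[OF \<alpha>(2)[OF that(1)] \<alpha>(2)[OF that(2)] L0[OF that(1)] norm_ge_zero]
    by (meson order_trans)
  have Xm: "?X i j \<in> borel_measurable (FF (max (r i) (r j)))" if "i \<in> J" "j \<in> J" for i j
  proof -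
    have "\<alpha> k \<in> borel_measurable (FF (max (r i) (r j)))" if "k \<in> {i, j}" for k
      by (rule measurable_from_subalg[OF FF_subalgebra_mono \<alpha>(1)])
        (use that \<open>i \<in> J\<close> \<open>j \<in> J\<close> rT[of i] rT[of j] in auto)
    then show ?thesis by simp
  qed
  have iX: "integrable M (?X i j)" if "i \<in> J" "j \<in> J" for i j
    by (rule integrable_const_bound[where B="L i * L j"]) (use Xb[OF that] that in auto)
  define len where "len i j = max 0 (min (q i) (q j) - max (r i) (r j))" for i j
  have P: "integrable M (\<lambda>\<omega>. ?X i j \<omega> * (D (r i) (q i) (v i) \<omega> * D (r j) (q j) (v j) \<omega>))"
    "expectation (\<lambda>\<omega>. ?X i j \<omega> * (D (r i) (q i) (v i) \<omega> * D (r j) (q j) (v j) \<omega>)) = expectation (?X i j) * (len i j * (v i \<bullet> v j))"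
    if "i \<in> J" "j \<in> J" for i j
    using D_product[OF rT(2)[OF that(1)] r(2)[OF that(1)] rT(3)[OF that(1)] rT(2)[OF that(2)] r(2)[OF that(2)] rT(3)[OF that(2)] Xm[OF that] Xb[OF that]]
    unfolding len_def by auto
  define S where "S = (\<Sum>i\<in>J. \<Sum>j\<in>J. expectation (?X i j) * (len i j * (v i \<bullet> v j)))"
  have sq: "(norm (\<Sum>i\<in>J. D (r i) (q i) (v i) \<omega> *\<^sub>R \<alpha> i \<omega>))\<^sup>2 =
    (\<Sum>i\<in>J. \<Sum>j\<in>J. ?X i j \<omega> * (D (r i) (q i) (v i) \<omega> * D (r j) (q j) (v j) \<omega>))" for \<omega>
    by (simp add: power2_norm_eq_inner inner_sum_left inner_sum_right mult_ac inner_commute)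
  have "integrable M (\<lambda>\<omega>. (norm (\<Sum>i\<in>J. D (r i) (q i) (v i) \<omega> *\<^sub>R \<alpha> i \<omega>))\<^sup>2)"
    unfolding sq using P(1) by (intro Bochner_Integration.integrable_sum) auto
  then have lhs: "(\<integral>\<^sup>+\<omega>. ennreal ((norm (\<Sum>i\<in>J. D (r i) (q i) (v i) \<omega> *\<^sub>R \<alpha> i \<omega>))\<^sup>2) \<partial>M) =
    ennreal (expectation (\<lambda>\<omega>. (norm (\<Sum>i\<in>J. D (r i) (q i) (v i) \<omega> *\<^sub>R \<alpha> i \<omega>))\<^sup>2))"
    by (intro nn_integral_eq_integral) auto
  have "expectation (\<lambda>\<omega>. (norm (\<Sum>i\<in>J. D (r i) (q i) (v i) \<omega> *\<^sub>R \<alpha> i \<omega>))\<^sup>2) = S"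
    unfolding sq S_def using P by (simp add: Bochner_Integration.integral_sum)
  note lhs = lhs[unfolded this]
  define Q where "Q \<tau> \<omega> = (\<Sum>i\<in>J. \<Sum>j\<in>J. (?ind i \<tau> * ?ind j \<tau> * (v i \<bullet> v j)) * ?X i j \<omega>)" for \<tau> \<omega>
  have Q: "hs_sq I h (\<lambda>u. \<Sum>i\<in>J. (?ind i \<tau> * (u \<bullet> v i)) *\<^sub>R \<alpha> i \<omega>) = ennreal (Q \<tau> \<omega>)" "0 \<le> Q \<tau> \<omega>" for \<tau> \<omega>
    using hs_sq_finite_rank[OF onb J, of "\<lambda>i. ?ind i \<tau>" v "\<lambda>i. \<alpha> i \<omega>"] unfolding Q_def by auto
  have [measurable]: "?ind i \<in> borel_measurable ?N" for i by (rule measurable_restrict_space1) measurable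
  have e: "expectation (Q \<tau>) = (\<Sum>i\<in>J. \<Sum>j\<in>J. (?ind i \<tau> * ?ind j \<tau>) * ((v i \<bullet> v j) * expectation (?X i j)))" for \<tau>
  proof -
    have "expectation (Q \<tau>) = (\<Sum>i\<in>J. expectation (\<lambda>\<omega>. \<Sum>j\<in>J. (?ind i \<tau> * ?ind j \<tau> * (v i \<bullet> v j)) * ?X i j \<omega>))"
      unfolding Q_def[abs_def]
      by (intro Bochner_Integration.integral_sum Bochner_Integration.integrable_sum integrable_mult_right iX)
    also have "\<dots> = (\<Sum>i\<in>J. \<Sum>j\<in>J. expectation (\<lambda>\<omega>. (?ind i \<tau> * ?ind j \<tau> * (v i \<bullet> v j)) * ?X i j \<omega>))"
      by (intro sum.cong refl Bochner_Integration.integral_sum integrable_mult_right iX)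
    also have "\<dots> = (\<Sum>i\<in>J. \<Sum>j\<in>J. (?ind i \<tau> * ?ind j \<tau> * (v i \<bullet> v j)) * expectation (?X i j))"
      by (intro sum.cong refl integral_mult_right_zero)
    finally show ?thesis by (simp only: mult.assoc)
  qed
  have Qm: "(\<lambda>x. ennreal (Q (fst x) (snd x))) \<in> borel_measurable (?N \<Otimes>\<^sub>M M)"
    unfolding Q_def by measurable
  have "(\<integral>\<^sup>+(\<tau>, \<omega>). hs_sq I h (\<lambda>u. \<Sum>i\<in>J. (?ind i \<tau> * (u \<bullet> v i)) *\<^sub>R \<alpha> i \<omega>) \<partial>(?N \<Otimes>\<^sub>M M)) =
    (\<integral>\<^sup>+\<tau>. \<integral>\<^sup>+\<omega>. ennreal (Q \<tau> \<omega>) \<partial>M \<partial>?N)"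
    using nn_integral_fst[OF Qm, symmetric] by (simp add: Q(1) case_prod_unfold)
  also have "\<dots> = (\<integral>\<^sup>+\<tau>. ennreal (expectation (Q \<tau>)) \<partial>?N)"
  proof (intro nn_integral_cong nn_integral_eq_integral)
    fix \<tau>
    show "integrable M (Q \<tau>)" unfolding Q_def[abs_def]
      by (intro Bochner_Integration.integrable_sum integrable_mult_right iX)
    show "AE \<omega> in M. 0 \<le> Q \<tau> \<omega>" using Q(2) by simp
  qed
  also have "\<dots> = ennreal (\<integral>\<tau>. expectation (Q \<tau>) \<partial>?N)"
  proof (intro nn_integral_eq_integral)
    show "integrable ?N (\<lambda>\<tau>. expectation (Q \<tau>))"
      unfolding e using r by (intro Bochner_Integration.integrable_sum integrable_mult_left integral_indicator_product_interval(1)) auto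
    show "AE \<tau> in ?N. 0 \<le> expectation (Q \<tau>)" using Q(2) by simp
  qed
  also have "(\<integral>\<tau>. expectation (Q \<tau>) \<partial>?N) = S"
  proof -
    have i: "integrable ?N (\<lambda>\<tau>. ?ind i \<tau> * ?ind j \<tau>)" "(\<integral>\<tau>. ?ind i \<tau> * ?ind j \<tau> \<partial>?N) = len i j" if "i \<in> J" "j \<in> J" for i j
      unfolding len_def using integral_indicator_product_interval[of a "r i" "r j" "q i" b "q j"] r that by auto
    have "(\<integral>\<tau>. expectation (Q \<tau>) \<partial>?N) = (\<Sum>i\<in>J. \<Sum>j\<in>J. (\<integral>\<tau>. (?ind i \<tau> * ?ind j \<tau>) * ((v i \<bullet> v j) * expectation (?X i j)) \<partial>?N))"
    proof -
      have "(\<integral>\<tau>. expectation (Q \<tau>) \<partial>?N) = (\<Sum>i\<in>J. (\<integral>\<tau>. (\<Sum>j\<in>J. (?ind i \<tau> * ?ind j \<tau>) * ((v i \<bullet> v j) * expectation (?X i j))) \<partial>?N))"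
        unfolding e by (intro Bochner_Integration.integral_sum Bochner_Integration.integrable_sum integrable_mult_left i(1))
      also have "\<dots> = (\<Sum>i\<in>J. \<Sum>j\<in>J. (\<integral>\<tau>. (?ind i \<tau> * ?ind j \<tau>) * ((v i \<bullet> v j) * expectation (?X i j)) \<partial>?N))"
        by (intro sum.cong refl Bochner_Integration.integral_sum integrable_mult_left i(1))
      finally show ?thesis .
    qed
    also have "\<dots> = S"
      unfolding S_def
    proof (intro sum.cong refl)
      fix i j assume ij: "i \<in> J" "j \<in> J"
      have "(\<integral>\<tau>. (?ind i \<tau> * ?ind j \<tau>) * ((v i \<bullet> v j) * expectation (?X i j)) \<partial>?N) =
        (\<integral>\<tau>. ?ind i \<tau> * ?ind j \<tau> \<partial>?N) * ((v i \<bullet> v j) * expectation (?X i j))" by (rule integral_mult_left_zero)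
      then show "(\<integral>\<tau>. (?ind i \<tau> * ?ind j \<tau>) * ((v i \<bullet> v j) * expectation (?X i j)) \<partial>?N) =
        expectation (?X i j) * (len i j * (v i \<bullet> v j))" unfolding i(2)[OF ij] by (simp only: mult_ac)
    qed
    finally show ?thesis .
  qed
  finally show ?thesis using lhs by simp
qed

end

section \<open>The Ito integral of a constant integrand\<close>

lemma hs_norm_nonneg: "0 \<le> hs_norm I h R"
  by (simp add: hs_norm_def infsum_nonneg)

lemma hs_norm_partial_sum_le:
  assumes "R \<in> hs_ops I h"
  shows "(\<Sum>i\<in>I \<inter> {..<n}. (norm (R (h i)))\<^sup>2) \<le> (hs_norm I h R)\<^sup>2"
proof -
  have s: "(\<lambda>n. indicator I n * (norm (R (h n)))\<^sup>2) sums (hs_norm I h R)\<^sup>2"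
    using assms by (intro hs_sq_sums) (simp add: hs_ops_def)
  have "(\<Sum>i\<in>I \<inter> {..<n}. (norm (R (h i)))\<^sup>2) = (\<Sum>i<n. indicator I i * (norm (R (h i)))\<^sup>2)"
    using sum_lessThan_indicator[of I "\<lambda>i. (norm (R (h i)))\<^sup>2" n] by simp
  also have "\<dots> \<le> (\<Sum>i. indicator I i * (norm (R (h i)))\<^sup>2)"
    by (rule sum_le_suminf[OF sums_summable[OF s]]) auto
  also have "\<dots> = (hs_norm I h R)\<^sup>2" by (rule sums_unique[OF s, symmetric])
  finally show ?thesis .
qed

lemma hs_norm_ge:
  assumes "R \<in> hs_ops I h" "i \<in> I"
  shows "norm (R (h i)) \<le> hs_norm I h R"
proof -
  have "(norm (R (h i)))\<^sup>2 \<le> (\<Sum>i\<in>I \<inter> {..<Suc i}. (norm (R (h i)))\<^sup>2)" using assms by (intro member_le_sum) auto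
  also have "\<dots> \<le> (hs_norm I h R)\<^sup>2" by (rule hs_norm_partial_sum_le[OF assms(1)])
  finally show ?thesis by (rule power2_le_imp_le) (rule hs_norm_nonneg)
qed

text \<open>For an orthonormal basis this is \<open>R\<close> composed with the orthogonal
  projection onto the first basis vectors; held constant in time, its stochastic integral is the
  corresponding \<open>wsum\<close>.\<close>

definition hs_trunc :: "nat set \<Rightarrow> (nat \<Rightarrow> 'h::real_inner) \<Rightarrow> nat \<Rightarrow> ('h \<Rightarrow> 'y::real_inner) \<Rightarrow> 'h \<Rightarrow> 'y" where
  "hs_trunc I h n R u = (\<Sum>i\<in>I \<inter> {..<n}. (u \<bullet> h i) *\<^sub>R R (h i))"

lemma hs_trunc_basis:
  assumes "orthonormal_basis I h" "i \<in> I"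
  shows "hs_trunc I h n R (h i) = (if i < n then R (h i) else 0)"
proof -
  have "hs_trunc I h n R (h i) = (\<Sum>j\<in>I \<inter> {..<n}. if j = i then R (h j) else 0)"
    unfolding hs_trunc_def using assms by (intro sum.cong) (auto simp: orthonormal_basis_def)
  then show ?thesis using assms(2) by simp
qed

lemma hs_sq_trunc:
  assumes onb: "orthonormal_basis I h" and R: "R \<in> hs_ops I h"
  shows "hs_sq I h (\<lambda>u. R u - hs_trunc I h n R u) =
    ennreal ((hs_norm I h R)\<^sup>2 - (\<Sum>i<n. indicator I i * (norm (R (h i)))\<^sup>2))"
proof -
  let ?f = "\<lambda>i. indicator I i * (norm (R (h i)))\<^sup>2"
  have "?f sums (hs_norm I h R)\<^sup>2" using R by (intro hs_sq_sums) (simp add: hs_ops_def)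
  from sums_diff[OF this sums_If_finite_set[of "{..<n}" ?f]]
  have s: "(\<lambda>i. ?f i - (if i \<in> {..<n} then ?f i else 0)) sums ((hs_norm I h R)\<^sup>2 - (\<Sum>i<n. ?f i))" by simp
  have e: "indicator I i * (norm (R (h i) - hs_trunc I h n R (h i)))\<^sup>2 = ?f i - (if i \<in> {..<n} then ?f i else 0)" for i
    by (cases "i \<in> I") (auto simp: hs_trunc_basis[OF onb])
  show ?thesis unfolding hs_sq_def e by (rule suminf_ennreal_eq[OF _ s]) (auto simp: indicator_def)
qed

lemma hs_sq_trunc_tendsto:
  assumes onb: "orthonormal_basis I h" and R: "R \<in> hs_ops I h"
  shows "(\<lambda>n. hs_sq I h (\<lambda>u. R u - hs_trunc I h n R u)) \<longlonglongrightarrow> 0"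
proof -
  have "(\<lambda>i. indicator I i * (norm (R (h i)))\<^sup>2) sums (hs_norm I h R)\<^sup>2" using R by (intro hs_sq_sums) (simp add: hs_ops_def)
  then have "(\<lambda>n. (hs_norm I h R)\<^sup>2 - (\<Sum>i<n. indicator I i * (norm (R (h i)))\<^sup>2)) \<longlonglongrightarrow> (hs_norm I h R)\<^sup>2 - (hs_norm I h R)\<^sup>2"
    unfolding sums_def by (intro tendsto_intros)
  from tendsto_ennrealI[OF this] show ?thesis unfolding hs_sq_trunc[OF onb R] by simp
qed

lemma hs_sq_measurable:
  fixes R :: "'x \<Rightarrow> 'h::real_inner \<Rightarrow> 'y::{real_inner,banach,second_countable_topology}"
  assumes "\<And>i. i \<in> I \<Longrightarrow> (\<lambda>x. R x (h i)) \<in> borel_measurable N"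
  shows "(\<lambda>x. hs_sq I h (R x)) \<in> borel_measurable N"
  unfolding hs_sq_def
proof (rule borel_measurable_suminf_order)
  fix i
  show "(\<lambda>x. ennreal (indicator I i * (norm (R x (h i)))\<^sup>2)) \<in> borel_measurable N"
    using assms[of i] by (cases "i \<in> I") auto
qed

text \<open>The increment over \<open>[s,t]\<close> of an integral over the interval from
  \<open>r\<close> to \<open>q\<close> sees only the part inside \<open>[s,t]\<close>;
  \<open>indicator_clamp\<close> is the counterpart for the integrand.\<close>

lemma clamp_increment:
  fixes f :: "real \<Rightarrow> real"
  assumes "s \<le> t"
  shows "(f (min q t) - f (min r t)) - (f (min q s) - f (min r s)) = f (max s (min q t)) - f (max s (min r t))"
proof -
  have "f (min z t) - f (min z s) = f (max s (min z t)) - f s" for z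
    using assms by (cases "z \<le> s") (auto simp: min_def max_def)
  from this[of q] this[of r] show ?thesis by simp
qed

lemma indicator_clamp:
  fixes s t r q \<tau> :: real
  shows "s \<le> t \<Longrightarrow> indicator {max s (min r t)<..max s (min q t)} \<tau> = indicator {s<..t} \<tau> * (indicator {r<..q} \<tau> :: real)"
proof -
  assume "s \<le> t"
  then have "max s (min r t) < \<tau> \<and> \<tau> \<le> max s (min q t) \<longleftrightarrow> (s < \<tau> \<and> \<tau> \<le> t) \<and> (r < \<tau> \<and> \<tau> \<le> q)"
    by (auto simp: min_less_iff_disj le_max_iff_disj)
  then show ?thesis by (simp add: indicator_def)
qed

lemma norm_three_square_le:
  fixes p1 p2 p3 :: "'a::real_inner"
  shows "(norm (p1 - p2 + p3))\<^sup>2 \<le> 3 * (norm p1)\<^sup>2 + 3 * (norm p2)\<^sup>2 + 3 * (norm p3)\<^sup>2"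
proof -
  have "norm (p1 - p2 + p3) \<le> norm p1 + norm p2 + norm p3"
    using norm_triangle_ineq[of "p1 - p2" p3] norm_triangle_ineq4[of p1 p2] by linarith
  then have "(norm (p1 - p2 + p3))\<^sup>2 \<le> (norm p1 + norm p2 + norm p3)\<^sup>2" by (intro power_mono) auto
  also have "\<dots> \<le> 3 * (norm p1)\<^sup>2 + 3 * (norm p2)\<^sup>2 + 3 * (norm p3)\<^sup>2"
    using zero_le_power2[of "norm p1 - norm p2"] zero_le_power2[of "norm p1 - norm p3"] zero_le_power2[of "norm p2 - norm p3"]
    by (simp add: power2_eq_square algebra_simps)
  finally show ?thesis .
qed

context cylindrical_noise
begin

text \<open>The variable on the left is itself the integral over \<open>(s,t]\<close> of the step
  process minus the truncated operator. The isometry gives its second moment, and \<open>R\<close>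
  is inserted between the two integrands.\<close>

lemma step_integral_approx:
  fixes R :: "'w \<Rightarrow> 'h \<Rightarrow> 'y::{real_inner,banach,second_countable_topology}"
    and es :: "('w, 'h, 'y) step_process"
  assumes onb: "orthonormal_basis I h" and ab: "0 \<le> a" "b \<le> T"
    and Rops: "\<And>\<omega>. R \<omega> \<in> hs_ops I h"
    and Rm: "\<And>i. i \<in> I \<Longrightarrow> (\<lambda>\<omega>. R \<omega> (h i)) \<in> borel_measurable (FF a)"
    and RL: "\<And>\<omega>. hs_norm I h (R \<omega>) \<le> L"
    and st: "a \<le> s" "s \<le> t" "t \<le> b" and es: "adapted_step FF a b es"
  shows "(\<integral>\<^sup>+\<omega>. ennreal ((norm (step_integral W es t \<omega> - step_integral W es s \<omega> - wsum s t (I \<inter> {..<n}) h (\<lambda>i \<omega>. R \<omega> (h i)) \<omega>))\<^sup>2) \<partial>M)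
    \<le> 2 * (\<integral>\<^sup>+(\<tau>, \<omega>). ennreal ((hs_norm I h (\<lambda>u. R \<omega> u - step_value es \<tau> \<omega> u))\<^sup>2) \<partial>(restrict_space lborel {a..b} \<Otimes>\<^sub>M M))
     + 2 * (\<integral>\<^sup>+(\<tau>, \<omega>). hs_sq I h (\<lambda>u. R \<omega> u - hs_trunc I h n (R \<omega>) u) \<partial>(restrict_space lborel {a..b} \<Otimes>\<^sub>M M))"
proof -
  let ?N = "restrict_space lborel {a..b}"
  define len where "len = length es"
  define r where "r j = fst (es ! j)" for j
  define q where "q j = fst (snd (es ! j))" for j
  define A where "A j = fst (snd (snd (es ! j)))" for j
  define v where "v j = fst (snd (snd (snd (es ! j))))" for j
  define x where "x j = snd (snd (snd (snd (es ! j))))" for j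
  have ad: "a \<le> r j" "r j \<le> q j" "q j \<le> b" "A j \<in> sets (FF (r j))" if "j < len" for j
    using es nth_mem[of j es] that unfolding adapted_step_def len_def r_def q_def A_def by (auto simp: case_prod_unfold)
  have SI: "step_integral W es t \<omega> = (\<Sum>j<len. (indicator (A j) \<omega> * (BM_at W (min (q j) t) (v j) \<omega> - BM_at W (min (r j) t) (v j) \<omega>)) *\<^sub>R x j)" for t \<omega>
    unfolding step_integral_def len_def r_def q_def A_def v_def x_def
    by (simp add: sum_list_sum_nth atLeast0LessThan case_prod_unfold)
  have SV: "step_value es \<tau> \<omega> u = (\<Sum>j<len. (indicator {r j<..q j} \<tau> * indicator (A j) \<omega> * (u \<bullet> v j)) *\<^sub>R x j)" for \<tau> \<omega> u
    unfolding step_value_def len_def r_def q_def A_def v_def x_def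
    by (simp add: sum_list_sum_nth atLeast0LessThan case_prod_unfold)
  define cl where "cl z = max s (min z t)" for z
  have cl: "s \<le> cl z" "cl z \<le> t" "z \<le> z' \<Longrightarrow> cl z \<le> cl z'" for z z' using st by (auto simp: cl_def)
  \<comment> \<open>Left summands index the clamped terms of the step process, right summands the
    basis directions with coefficient \<open>- R \<omega> (h i)\<close>, so one application of the
    isometry treats the difference.\<close>
  define J where "J = {..<len} <+> (I \<inter> {..<n})"
  define rr where "rr = case_sum (\<lambda>j. cl (r j)) (\<lambda>_::nat. s)"
  define qq where "qq = case_sum (\<lambda>j. cl (q j)) (\<lambda>_::nat. t)"
  define vv where "vv = case_sum v h"
  \<comment> \<open>Terms starting after \<open>t\<close> vanish after clamping and are dropped: their coefficients are not adapted at the clamped time.\<close>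
  define \<alpha> where "\<alpha> = case_sum (\<lambda>j \<omega>. (if r j \<le> t then indicator (A j) \<omega> else 0) *\<^sub>R x j) (\<lambda>i \<omega>. - R \<omega> (h i))"
  define LL where "LL = case_sum (\<lambda>j. norm (x j)) (\<lambda>_::nat. L)"
  have J: "finite J" by (simp add: J_def)
  have iso: "(\<integral>\<^sup>+\<omega>. ennreal ((norm (\<Sum>i\<in>J. D (rr i) (qq i) (vv i) \<omega> *\<^sub>R \<alpha> i \<omega>))\<^sup>2) \<partial>M) =
    (\<integral>\<^sup>+(\<tau>, \<omega>). hs_sq I h (\<lambda>u. \<Sum>i\<in>J. (indicator {rr i<..qq i} \<tau> * (u \<bullet> vv i)) *\<^sub>R \<alpha> i \<omega>) \<partial>(?N \<Otimes>\<^sub>M M))"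
  proof (rule step_isometry[OF onb J ab, where L=LL])
    fix i assume "i \<in> J"
    then consider (l) j where "i = Inl j" "j < len" | (r) k where "i = Inr k" "k \<in> I" by (auto simp: J_def)
    then have "a \<le> rr i \<and> rr i \<le> qq i \<and> qq i \<le> b \<and> \<alpha> i \<in> borel_measurable (FF (rr i)) \<and> (\<forall>\<omega>. norm (\<alpha> i \<omega>) \<le> LL i)"
    proof cases
      case l
      have "\<alpha> i \<in> borel_measurable (FF (rr i))"
      proof (cases "r j \<le> t")
        case True
        then have "r j \<le> cl (r j)" by (simp add: cl_def)
        then have "sets (FF (r j)) \<subseteq> sets (FF (cl (r j)))"
          using ad(1)[OF l(2)] ab st cl(2)[of "r j"] by (intro FF_mono) auto
        from subsetD[OF this ad(4)[OF l(2)]] have [measurable]: "A j \<in> sets (FF (cl (r j)))" .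
        have "(\<lambda>\<omega>. indicator (A j) \<omega> *\<^sub>R x j) \<in> borel_measurable (FF (cl (r j)))" by measurable
        then show ?thesis using True by (simp add: \<alpha>_def l(1) rr_def)
      qed (simp add: \<alpha>_def l(1))
      then show ?thesis using st cl[of "r j"] cl[of "q j"] cl(3)[OF ad(2)[OF l(2)]]
        by (auto simp: l(1) rr_def qq_def \<alpha>_def LL_def indicator_def)
    next
      case r
      have "(\<lambda>\<omega>. R \<omega> (h k)) \<in> borel_measurable (FF s)"
        by (rule measurable_from_subalg[OF FF_subalgebra_mono Rm[OF r(2)]]) (use ab st in auto)
      moreover have "norm (R \<omega> (h k)) \<le> L" for \<omega> using hs_norm_ge[OF Rops r(2)] RL order_trans by blast
      ultimately show ?thesis using st by (simp add: r(1) rr_def qq_def \<alpha>_def LL_def)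
    qed
    then show "a \<le> rr i" "rr i \<le> qq i" "qq i \<le> b" "\<alpha> i \<in> borel_measurable (FF (rr i))" "\<And>\<omega>. norm (\<alpha> i \<omega>) \<le> LL i"
      by auto
  qed
  have lhs: "(\<Sum>i\<in>J. D (rr i) (qq i) (vv i) \<omega> *\<^sub>R \<alpha> i \<omega>) =
    step_integral W es t \<omega> - step_integral W es s \<omega> - wsum s t (I \<inter> {..<n}) h (\<lambda>i \<omega>. R \<omega> (h i)) \<omega>" for \<omega>
  proof -
    have "(\<Sum>i\<in>J. D (rr i) (qq i) (vv i) \<omega> *\<^sub>R \<alpha> i \<omega>) =
      (\<Sum>j<len. D (cl (r j)) (cl (q j)) (v j) \<omega> *\<^sub>R ((if r j \<le> t then indicator (A j) \<omega> else 0) *\<^sub>R x j))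
      - wsum s t (I \<inter> {..<n}) h (\<lambda>i \<omega>. R \<omega> (h i)) \<omega>"
      unfolding J_def by (simp add: sum.Plus rr_def qq_def vv_def \<alpha>_def wsum_def sum_negf)
    also have "(\<Sum>j<len. D (cl (r j)) (cl (q j)) (v j) \<omega> *\<^sub>R ((if r j \<le> t then indicator (A j) \<omega> else 0) *\<^sub>R x j)) =
      step_integral W es t \<omega> - step_integral W es s \<omega>"
      unfolding SI sum_subtractf[symmetric]
    proof (intro sum.cong refl)
      fix j assume "j \<in> {..<len}"
      then have rq: "r j \<le> q j" using ad by simp
      have "D (cl (r j)) (cl (q j)) (v j) \<omega> *\<^sub>R ((if r j \<le> t then indicator (A j) \<omega> else 0) *\<^sub>R x j) =
        (indicator (A j) \<omega> * D (cl (r j)) (cl (q j)) (v j) \<omega>) *\<^sub>R x j"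
        using rq st by (auto simp: cl_def D_def)
      moreover have "D (cl (r j)) (cl (q j)) (v j) \<omega> = (BM_at W (min (q j) t) (v j) \<omega> - BM_at W (min (r j) t) (v j) \<omega>)
         - (BM_at W (min (q j) s) (v j) \<omega> - BM_at W (min (r j) s) (v j) \<omega>)"
        unfolding D_def cl_def using clamp_increment[OF st(2), of "\<lambda>z. BM_at W z (v j) \<omega>"] by simp
      ultimately show "D (cl (r j)) (cl (q j)) (v j) \<omega> *\<^sub>R ((if r j \<le> t then indicator (A j) \<omega> else 0) *\<^sub>R x j) =
        (indicator (A j) \<omega> * (BM_at W (min (q j) t) (v j) \<omega> - BM_at W (min (r j) t) (v j) \<omega>)) *\<^sub>R x j -
        (indicator (A j) \<omega> * (BM_at W (min (q j) s) (v j) \<omega> - BM_at W (min (r j) s) (v j) \<omega>)) *\<^sub>R x j"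
        by (simp only: right_diff_distrib scaleR_diff_left)
    qed
    finally show ?thesis .
  qed
  have val: "(\<Sum>i\<in>J. (indicator {rr i<..qq i} \<tau> * (u \<bullet> vv i)) *\<^sub>R \<alpha> i \<omega>) =
    indicator {s<..t} \<tau> *\<^sub>R (step_value es \<tau> \<omega> u - hs_trunc I h n (R \<omega>) u)" for \<tau> \<omega> u
  proof -
    have "(\<Sum>i\<in>J. (indicator {rr i<..qq i} \<tau> * (u \<bullet> vv i)) *\<^sub>R \<alpha> i \<omega>) =
      (\<Sum>j<len. (indicator {cl (r j)<..cl (q j)} \<tau> * (u \<bullet> v j)) *\<^sub>R ((if r j \<le> t then indicator (A j) \<omega> else 0) *\<^sub>R x j))
      - indicator {s<..t} \<tau> *\<^sub>R hs_trunc I h n (R \<omega>) u"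
      unfolding J_def by (simp add: sum.Plus rr_def qq_def vv_def \<alpha>_def hs_trunc_def sum_negf scaleR_sum_right)
    also have "(\<Sum>j<len. (indicator {cl (r j)<..cl (q j)} \<tau> * (u \<bullet> v j)) *\<^sub>R ((if r j \<le> t then indicator (A j) \<omega> else 0) *\<^sub>R x j)) =
      indicator {s<..t} \<tau> *\<^sub>R step_value es \<tau> \<omega> u"
      unfolding SV scaleR_sum_right cl_def indicator_clamp[OF st(2)]
      by (intro sum.cong refl) (auto simp: indicator_def)
    finally show ?thesis by (simp add: scaleR_diff_right)
  qed
  \<comment> \<open>A Hilbert--Schmidt operator minus one of finite rank has a finite square sum, so
    \<open>hs_norm\<close> is the genuine norm here and not the default value of a divergent
    sum.\<close>
  have fin: "hs_sq I h (\<lambda>u. R \<omega> u - step_value es \<tau> \<omega> u) = ennreal ((hs_norm I h (\<lambda>u. R \<omega> u - step_value es \<tau> \<omega> u))\<^sup>2)" for \<tau> \<omega>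
  proof (rule hs_sq_finite)
    have "hs_sq I h (step_value es \<tau> \<omega>) < \<infinity>"
      using hs_sq_finite_rank(1)[OF onb, of "{..<len}" "\<lambda>j. indicator {r j<..q j} \<tau> * indicator (A j) \<omega>" v x]
      by (simp add: SV[abs_def])
    moreover have "hs_sq I h (R \<omega>) < \<infinity>" by (simp add: hs_sq_hs_ops[OF Rops])
    moreover have "hs_sq I h (\<lambda>u. R \<omega> u - step_value es \<tau> \<omega> u) \<le> 2 * hs_sq I h (R \<omega>) + 2 * hs_sq I h (step_value es \<tau> \<omega>)"
      by (rule hs_sq_triangle) (rule norm_triangle_ineq4)
    ultimately show "hs_sq I h (\<lambda>u. R \<omega> u - step_value es \<tau> \<omega> u) < \<infinity>"
      by (auto simp: ennreal_mult_less_top intro: le_less_trans)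
  qed
  have le: "hs_sq I h (\<lambda>u. \<Sum>i\<in>J. (indicator {rr i<..qq i} \<tau> * (u \<bullet> vv i)) *\<^sub>R \<alpha> i \<omega>) \<le>
    2 * ennreal ((hs_norm I h (\<lambda>u. R \<omega> u - step_value es \<tau> \<omega> u))\<^sup>2) + 2 * hs_sq I h (\<lambda>u. R \<omega> u - hs_trunc I h n (R \<omega>) u)" for \<tau> \<omega>
    unfolding val fin[symmetric]
  proof (rule hs_sq_triangle)
    fix k
    have "norm (indicator {s<..t} \<tau> *\<^sub>R (step_value es \<tau> \<omega> (h k) - hs_trunc I h n (R \<omega>) (h k))) \<le>
      norm (step_value es \<tau> \<omega> (h k) - hs_trunc I h n (R \<omega>) (h k))" by (simp add: indicator_def)
    also have "\<dots> \<le> norm (R \<omega> (h k) - step_value es \<tau> \<omega> (h k)) + norm (R \<omega> (h k) - hs_trunc I h n (R \<omega>) (h k))"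
      using norm_triangle_ineq4[of "R \<omega> (h k) - hs_trunc I h n (R \<omega>) (h k)" "R \<omega> (h k) - step_value es \<tau> \<omega> (h k)"] by simp
    finally show "norm (indicator {s<..t} \<tau> *\<^sub>R (step_value es \<tau> \<omega> (h k) - hs_trunc I h n (R \<omega>) (h k))) \<le>
      norm (R \<omega> (h k) - step_value es \<tau> \<omega> (h k)) + norm (R \<omega> (h k) - hs_trunc I h n (R \<omega>) (h k))" .
  qed
  have aT: "a \<in> {0..T}" using ab st by auto
  have RM[measurable]: "(\<lambda>\<omega>. R \<omega> (h i)) \<in> borel_measurable M" if "i \<in> I" for i by (rule FF_M[OF aT Rm[OF that]])
  have [measurable]: "A j \<in> sets M" if "j < len" for j
    by (rule FF_sets_M[OF _ ad(4)[OF that]]) (use ad[OF that] ab in auto)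
  have [measurable]: "(indicator {r j<..q j} :: real \<Rightarrow> real) \<in> borel_measurable ?N" for j by (rule measurable_restrict_space1) measurable
  have svm: "(\<lambda>z. step_value es (fst z) (snd z) u) \<in> borel_measurable (?N \<Otimes>\<^sub>M M)" for u
    unfolding SV by measurable
  have R2m: "(\<lambda>z. R (snd z) (h i)) \<in> borel_measurable (?N \<Otimes>\<^sub>M M)" if "i \<in> I" for i
    using measurable_compose[OF measurable_snd RM[OF that]] .
  have m1: "(\<lambda>z. hs_sq I h (\<lambda>u. R (snd z) u - step_value es (fst z) (snd z) u)) \<in> borel_measurable (?N \<Otimes>\<^sub>M M)"
    by (rule hs_sq_measurable) (intro borel_measurable_diff R2m svm)
  have m2: "(\<lambda>z. hs_sq I h (\<lambda>u. R (snd z) u - hs_trunc I h n (R (snd z)) u)) \<in> borel_measurable (?N \<Otimes>\<^sub>M M)"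
    unfolding hs_trunc_def by (rule hs_sq_measurable) (intro borel_measurable_diff borel_measurable_sum borel_measurable_scaleR borel_measurable_const R2m; simp)
  have "(\<integral>\<^sup>+(\<tau>, \<omega>). hs_sq I h (\<lambda>u. \<Sum>i\<in>J. (indicator {rr i<..qq i} \<tau> * (u \<bullet> vv i)) *\<^sub>R \<alpha> i \<omega>) \<partial>(?N \<Otimes>\<^sub>M M)) \<le>
    (\<integral>\<^sup>+z. 2 * hs_sq I h (\<lambda>u. R (snd z) u - step_value es (fst z) (snd z) u) + 2 * hs_sq I h (\<lambda>u. R (snd z) u - hs_trunc I h n (R (snd z)) u) \<partial>(?N \<Otimes>\<^sub>M M))"
    unfolding case_prod_unfold by (intro nn_integral_mono) (use le fin in simp)
  also have "\<dots> = 2 * (\<integral>\<^sup>+z. hs_sq I h (\<lambda>u. R (snd z) u - step_value es (fst z) (snd z) u) \<partial>(?N \<Otimes>\<^sub>M M)) +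
     2 * (\<integral>\<^sup>+z. hs_sq I h (\<lambda>u. R (snd z) u - hs_trunc I h n (R (snd z)) u) \<partial>(?N \<Otimes>\<^sub>M M))"
    using m1 m2 by (simp add: nn_integral_add nn_integral_cmult)
  finally show ?thesis unfolding iso[unfolded lhs] fin case_prod_unfold .
qed

lemma step_integral_measurable:
  fixes es :: "('w, 'h, 'y::{real_inner,banach,second_countable_topology}) step_process"
  assumes es: "adapted_step FF a b es" and ab: "0 \<le> a" "b \<le> T"
  shows "step_integral W es t \<in> borel_measurable M"
proof -
  have term_meas: "(\<lambda>\<omega>. (indicator A \<omega> * (BM_at W (min s t) v \<omega> - BM_at W (min r t) v \<omega>)) *\<^sub>R x) \<in> borel_measurable M"
    if "(r, s, A, v, x) \<in> set es" for r s A v x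
  proof -
    have "A \<in> sets (FF r)" "r \<in> {0..T}" using es that ab by (auto simp: adapted_step_def)
    then have [measurable]: "A \<in> sets M" using FF_sets_M by blast
    have [measurable]: "BM_at W z v \<in> borel_measurable M" for z
      unfolding BM_at_def[abs_def] by (intro W_measurable L2_time_step)
    show ?thesis by measurable
  qed
  have "(\<lambda>\<omega>. (\<Sum>j<length es. (case es ! j of (r, s, A, v, x) \<Rightarrow> (indicator A \<omega> * (BM_at W (min s t) v \<omega> - BM_at W (min r t) v \<omega>)) *\<^sub>R x))) \<in> borel_measurable M"
  proof (intro borel_measurable_sum)
    fix j assume "j \<in> {..<length es}"
    then have "es ! j \<in> set es" by simp
    moreover obtain r s A v x where e: "es ! j = (r, s, A, v, x)" by (cases "es ! j")
    ultimately show "(\<lambda>\<omega>. (case es ! j of (r, s, A, v, x) \<Rightarrow> (indicator A \<omega> * (BM_at W (min s t) v \<omega> - BM_at W (min r t) v \<omega>)) *\<^sub>R x)) \<in> borel_measurable M"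
      using term_meas[of r s A v x] by simp
  qed
  then show ?thesis unfolding step_integral_def[abs_def] by (simp add: sum_list_sum_nth atLeast0LessThan)
qed

text \<open>As \<open>R\<close> is constant in time and known at time \<open>a\<close>, its integral
  over \<open>[s,t]\<close> must be \<open>R\<close> applied to the increment of the noise. For
  fixed \<open>n\<close> the approximating step processes are sent to their limit, which leaves a
  multiple of the truncation error \<open>E n\<close>; this error tends to zero by dominated
  convergence.\<close>

lemma ito_constant_increment:
  fixes R :: "'w \<Rightarrow> 'h \<Rightarrow> 'y::{real_inner,banach,second_countable_topology}"
  assumes onb: "orthonormal_basis I h" and ab: "0 \<le> a" "b \<le> T"
    and Rops: "\<And>\<omega>. R \<omega> \<in> hs_ops I h"
    and Rm: "\<And>i. i \<in> I \<Longrightarrow> (\<lambda>\<omega>. R \<omega> (h i)) \<in> borel_measurable (FF a)"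
    and RL: "\<And>\<omega>. hs_norm I h (R \<omega>) \<le> L"
    and ito: "ito_integral M FF W I h a b (\<lambda>_ \<omega>. R \<omega>) X"
    and st: "a \<le> s" "s \<le> t" "t \<le> b"
  shows "(\<lambda>n. \<integral>\<^sup>+\<omega>. ennreal ((norm (X t \<omega> - X s \<omega> - wsum s t (I \<inter> {..<n}) h (\<lambda>i \<omega>. R \<omega> (h i)) \<omega>))\<^sup>2) \<partial>M) \<longlonglongrightarrow> 0"
proof -
  let ?N = "restrict_space lborel {a..b}"
  have "\<exists>es :: nat \<Rightarrow> ('w, 'h, 'y) step_process.
        (\<forall>l. adapted_step FF a b (es l)) \<and>
        (\<lambda>l. \<integral>\<^sup>+(t, \<omega>). ennreal ((hs_norm I h (\<lambda>u. R \<omega> u - step_value (es l) t \<omega> u))\<^sup>2) \<partial>(?N \<Otimes>\<^sub>M M)) \<longlonglongrightarrow> 0 \<and>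
        (\<forall>t\<in>{a..b}. (\<lambda>l. \<integral>\<^sup>+\<omega>. ennreal ((norm (X t \<omega> - step_integral W (es l) t \<omega>))\<^sup>2) \<partial>M) \<longlonglongrightarrow> 0)"
    using ito unfolding ito_integral_def by blast
  then obtain es :: "nat \<Rightarrow> ('w, 'h, 'y) step_process" where es: "\<And>l. adapted_step FF a b (es l)"
    and C: "(\<lambda>l. \<integral>\<^sup>+(t, \<omega>). ennreal ((hs_norm I h (\<lambda>u. R \<omega> u - step_value (es l) t \<omega> u))\<^sup>2) \<partial>(?N \<Otimes>\<^sub>M M)) \<longlonglongrightarrow> 0"
    and A: "\<And>t. t \<in> {a..b} \<Longrightarrow> (\<lambda>l. \<integral>\<^sup>+\<omega>. ennreal ((norm (X t \<omega> - step_integral W (es l) t \<omega>))\<^sup>2) \<partial>M) \<longlonglongrightarrow> 0"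
    by blast
  have XM[measurable]: "X z \<in> borel_measurable M" if "z \<in> {a..b}" for z
    by (rule FF_M[of z]) (use ito ab that in \<open>auto simp: ito_integral_def\<close>)
  note [measurable] = step_integral_measurable[OF es ab]
  have aT: "a \<in> {0..T}" "0 \<le> s" "t \<le> T" using ab st by auto
  have RM[measurable]: "(\<lambda>\<omega>. R \<omega> (h i)) \<in> borel_measurable M" if "i \<in> I" for i by (rule FF_M[OF aT(1) Rm[OF that]])
  define E where "E n = (\<integral>\<^sup>+(\<tau>, \<omega>). hs_sq I h (\<lambda>u. R \<omega> u - hs_trunc I h n (R \<omega>) u) \<partial>(?N \<Otimes>\<^sub>M M))" for n
  define V where "V n = (\<integral>\<^sup>+\<omega>. ennreal ((norm (X t \<omega> - X s \<omega> - wsum s t (I \<inter> {..<n}) h (\<lambda>i \<omega>. R \<omega> (h i)) \<omega>))\<^sup>2) \<partial>M)" for n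
  have E: "E \<longlonglongrightarrow> 0"
  proof -
    have R2m: "(\<lambda>z. R (snd z) (h i)) \<in> borel_measurable (?N \<Otimes>\<^sub>M M)" if "i \<in> I" for i
      using measurable_compose[OF measurable_snd RM[OF that]] .
    have "(\<lambda>n. \<integral>\<^sup>+z. hs_sq I h (\<lambda>u. R (snd z) u - hs_trunc I h n (R (snd z)) u) \<partial>(?N \<Otimes>\<^sub>M M)) \<longlonglongrightarrow> (\<integral>\<^sup>+z. 0 \<partial>(?N \<Otimes>\<^sub>M M))"
    proof (rule nn_integral_dominated_convergence[where w="\<lambda>_. ennreal (L\<^sup>2)"])
      show "(\<lambda>z. hs_sq I h (\<lambda>u. R (snd z) u - hs_trunc I h n (R (snd z)) u)) \<in> borel_measurable (?N \<Otimes>\<^sub>M M)" for n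
        unfolding hs_trunc_def by (rule hs_sq_measurable) (intro borel_measurable_diff borel_measurable_sum borel_measurable_scaleR borel_measurable_const R2m; simp)
      show "AE z in ?N \<Otimes>\<^sub>M M. hs_sq I h (\<lambda>u. R (snd z) u - hs_trunc I h n (R (snd z)) u) \<le> ennreal (L\<^sup>2)" for n
      proof (rule AE_I2)
        fix z
        have "(hs_norm I h (R (snd z)))\<^sup>2 - (\<Sum>i<n. indicator I i * (norm (R (snd z) (h i)))\<^sup>2) \<le> (hs_norm I h (R (snd z)))\<^sup>2"
          by (simp add: sum_nonneg)
        also have "\<dots> \<le> L\<^sup>2" using RL hs_norm_nonneg by (intro power_mono) auto
        finally show "hs_sq I h (\<lambda>u. R (snd z) u - hs_trunc I h n (R (snd z)) u) \<le> ennreal (L\<^sup>2)"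
          unfolding hs_sq_trunc[OF onb Rops] by (rule ennreal_leI)
      qed
      have "emeasure (?N \<Otimes>\<^sub>M M) (space ?N \<times> space M) = emeasure ?N (space ?N) * emeasure M (space M)"
        by (rule emeasure_pair_measure_Times[OF sets.top sets.top])
      also have "\<dots> < \<infinity>" using st by (simp add: emeasure_space_1 space_restrict_space emeasure_restrict_space)
      finally show "(\<integral>\<^sup>+z. ennreal (L\<^sup>2) \<partial>(?N \<Otimes>\<^sub>M M)) < \<infinity>"
        by (simp add: space_pair_measure ennreal_mult_less_top)
      show "AE z in ?N \<Otimes>\<^sub>M M. (\<lambda>n. hs_sq I h (\<lambda>u. R (snd z) u - hs_trunc I h n (R (snd z)) u)) \<longlonglongrightarrow> 0"
        by (rule AE_I2) (rule hs_sq_trunc_tendsto[OF onb Rops])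
    qed auto
    then show ?thesis unfolding E_def[abs_def] case_prod_unfold by simp
  qed
  have "V n \<le> 6 * E n" for n
  proof -
    let ?w = "wsum s t (I \<inter> {..<n}) h (\<lambda>i \<omega>. R \<omega> (h i))"
    have [measurable]: "?w \<in> borel_measurable M" by (intro wsum_measurable RM) auto
    define a1 where "a1 l = (\<integral>\<^sup>+\<omega>. ennreal ((norm (X t \<omega> - step_integral W (es l) t \<omega>))\<^sup>2) \<partial>M)" for l
    define a2 where "a2 l = (\<integral>\<^sup>+\<omega>. ennreal ((norm (X s \<omega> - step_integral W (es l) s \<omega>))\<^sup>2) \<partial>M)" for l
    define a3 where "a3 l = (\<integral>\<^sup>+(t, \<omega>). ennreal ((hs_norm I h (\<lambda>u. R \<omega> u - step_value (es l) t \<omega> u))\<^sup>2) \<partial>(?N \<Otimes>\<^sub>M M))" for l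
    have ts: "t \<in> {a..b}" "s \<in> {a..b}" using st by auto
    note [measurable] = XM[OF ts(1)] XM[OF ts(2)]
    have bound: "V n \<le> 3 * a1 l + 3 * a2 l + 3 * (2 * a3 l + 2 * E n)" for l
    proof -
      let ?p1 = "\<lambda>\<omega>. X t \<omega> - step_integral W (es l) t \<omega>" and ?p2 = "\<lambda>\<omega>. X s \<omega> - step_integral W (es l) s \<omega>"
        and ?p3 = "\<lambda>\<omega>. step_integral W (es l) t \<omega> - step_integral W (es l) s \<omega> - ?w \<omega>"
      have "V n \<le> (\<integral>\<^sup>+\<omega>. 3 * ennreal ((norm (?p1 \<omega>))\<^sup>2) + 3 * ennreal ((norm (?p2 \<omega>))\<^sup>2) + 3 * ennreal ((norm (?p3 \<omega>))\<^sup>2) \<partial>M)"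
        unfolding V_def
      proof (rule nn_integral_mono)
        fix \<omega>
        have e: "X t \<omega> - X s \<omega> - ?w \<omega> = ?p1 \<omega> - ?p2 \<omega> + ?p3 \<omega>" by simp
        have "ennreal ((norm (X t \<omega> - X s \<omega> - ?w \<omega>))\<^sup>2) \<le> ennreal (3 * (norm (?p1 \<omega>))\<^sup>2 + 3 * (norm (?p2 \<omega>))\<^sup>2 + 3 * (norm (?p3 \<omega>))\<^sup>2)"
          unfolding e by (rule ennreal_leI[OF norm_three_square_le])
        also have "\<dots> = 3 * ennreal ((norm (?p1 \<omega>))\<^sup>2) + 3 * ennreal ((norm (?p2 \<omega>))\<^sup>2) + 3 * ennreal ((norm (?p3 \<omega>))\<^sup>2)"
          by (simp add: ennreal_mult)
        finally show "ennreal ((norm (X t \<omega> - X s \<omega> - ?w \<omega>))\<^sup>2) \<le>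
          3 * ennreal ((norm (?p1 \<omega>))\<^sup>2) + 3 * ennreal ((norm (?p2 \<omega>))\<^sup>2) + 3 * ennreal ((norm (?p3 \<omega>))\<^sup>2)" .
      qed
      also have "\<dots> = 3 * a1 l + 3 * a2 l + 3 * (\<integral>\<^sup>+\<omega>. ennreal ((norm (?p3 \<omega>))\<^sup>2) \<partial>M)"
        by (simp add: a1_def a2_def nn_integral_add nn_integral_cmult)
      also have "\<dots> \<le> 3 * a1 l + 3 * a2 l + 3 * (2 * a3 l + 2 * E n)"
        unfolding a3_def E_def by (intro add_left_mono mult_left_mono step_integral_approx[where L=L] onb ab Rops Rm RL st es) auto
      finally show ?thesis .
    qed
    have "(\<lambda>l. 3 * a1 l + 3 * a2 l + 3 * (2 * a3 l + 2 * E n)) \<longlonglongrightarrow> 3 * 0 + 3 * 0 + 3 * (2 * 0 + 2 * E n)"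
      unfolding a1_def a2_def a3_def by (intro tendsto_add ennreal_tendsto_cmult tendsto_const A C ts) auto
    then have "V n \<le> 3 * 0 + 3 * 0 + 3 * (2 * 0 + 2 * E n)" by (rule LIMSEQ_le_const) (use bound in auto)
    also have "\<dots> = (3 * 2) * E n" by (simp add: mult.assoc[symmetric])
    finally show ?thesis by simp
  qed
  moreover have "(\<lambda>n. 6 * E n) \<longlonglongrightarrow> 6 * 0" by (intro ennreal_tendsto_cmult E) auto
  ultimately have "V \<longlonglongrightarrow> 0"
    by (intro tendsto_sandwich[of "\<lambda>_. 0" V sequentially "\<lambda>n. 6 * E n"]) auto
  then show ?thesis unfolding V_def[abs_def] .
qed

end

section \<open>Chaining over dyadic points\<close>

text \<open>A dyadic point of level \<open>n + 1\<close> either has level \<open>n\<close> or lies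
  one step of level \<open>n + 1\<close> to the right of such a point, so each level adds at most
  one increment.\<close>

lemma dyadic_chain_bound:
  fixes X :: "real \<Rightarrow> 'y::real_normed_vector" and a c :: real and d :: "nat \<Rightarrow> real"
  assumes X0: "X a = 0" and d0: "\<And>l. 0 \<le> d l"
    and d: "\<And>l i. i < 2 ^ l \<Longrightarrow> norm (X (a + c * (real (Suc i) / 2 ^ l)) - X (a + c * (real i / 2 ^ l))) \<le> d l"
  shows "i \<le> 2 ^ n \<Longrightarrow> norm (X (a + c * (real i / 2 ^ n))) \<le> (\<Sum>l\<le>n. d l)"
proof (induction n arbitrary: i)
  case 0
  then consider "i = 0" | "i = 1" by fastforce
  then show ?case
  proof cases
    case 2 then show ?thesis using d[of 0 0] X0 by simp
  qed (use X0 d0 in simp)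
next
  case (Suc n)
  show ?case
  proof (cases "even i")
    case True
    then obtain j where i: "i = 2 * j" by blast
    have "norm (X (a + c * (real j / 2 ^ n))) \<le> (\<Sum>l\<le>n. d l)" using Suc i by auto
    also have "\<dots> \<le> (\<Sum>l\<le>Suc n. d l)" using d0[of "Suc n"] by simp
    finally show ?thesis by (simp add: i)
  next
    case False
    then obtain j where i: "i = Suc (2 * j)" by (metis oddE Suc_eq_plus1)
    have j: "j \<le> 2 ^ n" "2 * j < 2 ^ Suc n" using Suc.prems i by auto
    let ?u = "X (a + c * (real (Suc (2 * j)) / 2 ^ Suc n))" and ?v = "X (a + c * (real (2 * j) / 2 ^ Suc n))"
    have "norm ?u \<le> norm ?v + norm (?u - ?v)" by (metis add.commute norm_triangle_sub)
    also have "norm (?u - ?v) \<le> d (Suc n)" by (rule d[OF j(2)])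
    also have "?v = X (a + c * (real j / 2 ^ n))" by simp
    also have "norm \<dots> \<le> (\<Sum>l\<le>n. d l)" by (rule Suc.IH[OF j(1)])
    finally show ?thesis unfolding i by simp
  qed
qed

text \<open>
  With the weights \<open>(9/10)\<^sup>l\<close> for the dyadic level \<open>l\<close>, the sum over the levels of the \<open>2m\<close>-th moments
  is geometric with this ratio.
\<close>

definition chain_ratio :: "nat \<Rightarrow> real" where
  "chain_ratio m = 2 / 2 ^ m / (9 / 10) ^ (2 * m - 1)"

text \<open>For \<open>m = 2\<close> the ratio is \<open>1 / (2 * (9/10)^3) < 1\<close>, and each
  further unit of \<open>m\<close> divides it by \<open>2 * (9/10)^2 > 1\<close>. For
  \<open>m = 1\<close> it would be \<open>10/9\<close>, hence the lower bound on
  \<open>m\<close>.\<close>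

lemma chain_ratio_bounds:
  assumes "2 \<le> m"
  shows "0 < chain_ratio m" "chain_ratio m < 1"
proof -
  obtain k where m: "m = Suc (Suc k)" using assms by (metis One_nat_def Suc_1 Suc_le_D le_SucE not0_implies_Suc not_less_eq_eq)
  have "2 * m - 1 = 2 * k + 3" by (simp add: m)
  then have "(9 / 10 :: real) ^ (2 * m - 1) = (81 / 100) ^ k * (9 / 10) ^ 3"
    by (simp only: power_add power_mult) (simp add: power2_eq_square)
  then have "2 / 2 ^ m / (9 / 10 :: real) ^ (2 * m - 1) = 1 / (2 * (9 / 10) ^ 3) / (2 ^ k * (81 / 100) ^ k)"
    by (simp add: m)
  also have "\<dots> = 1 / (2 * (9 / 10) ^ 3) / (2 * (81 / 100)) ^ k" by (simp only: power_mult_distrib)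
  also have "\<dots> \<le> 1 / (2 * (9 / 10) ^ 3) / 1"
    by (intro divide_left_mono one_le_power) auto
  also have "\<dots> < 1" by (simp add: power3_eq_cube)
  finally show "chain_ratio m < 1" by (simp add: chain_ratio_def)
qed (simp add: chain_ratio_def)

text \<open>The base 10 is the sum of the weights \<open>(9/10)^l\<close>, and the denominator sums
  the geometric series over the levels.\<close>

definition chain_const :: "nat \<Rightarrow> real" where
  "chain_const m = 10 ^ (2 * m - 1) / (1 - chain_ratio m)"

lemma chain_const_nonneg: "2 \<le> m \<Longrightarrow> 0 \<le> chain_const m"
  using chain_ratio_bounds[of m] by (simp add: chain_const_def)

text \<open>Jensen's inequality with geometric weights costs the same bounded factor for any number
  of levels; equal weights would lose a power of \<open>n\<close>.\<close>

lemma weighted_levels_power_le: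
  fixes d :: "nat \<Rightarrow> real"
  assumes "\<And>l. 0 \<le> d l" "1 \<le> p"
  shows "(\<Sum>l\<le>n. d l) ^ p \<le> 10 ^ (p - 1) * (\<Sum>l\<le>n. d l ^ p / (9 / 10) ^ (l * (p - 1)))"
proof -
  have "(\<Sum>l\<le>n. d l) ^ p \<le> (\<Sum>l\<le>n. (9 / 10) ^ l) ^ (p - 1) * (\<Sum>l\<le>n. d l ^ p / ((9 / 10) ^ l) ^ (p - 1))"
    using assms by (intro sum_power_le_weighted) auto
  also have "\<dots> \<le> 10 ^ (p - 1) * (\<Sum>l\<le>n. d l ^ p / ((9 / 10) ^ l) ^ (p - 1))"
  proof (intro mult_right_mono power_mono)
    have "(\<Sum>l\<le>n. (9 / 10 :: real) ^ l) \<le> (\<Sum>l. (9 / 10) ^ l)"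
      by (intro sum_le_suminf) auto
    also have "\<dots> = 10" by (simp add: suminf_geometric)
    finally show "(\<Sum>l\<le>n. (9 / 10 :: real) ^ l) \<le> 10" .
  qed (use assms in \<open>auto intro!: sum_nonneg\<close>)
  finally show ?thesis by (simp add: power_mult)
qed

text \<open>Level \<open>l\<close> has \<open>2^l\<close> increments with moments of order
  \<open>2^(-l m)\<close>, so the moment sum of a level decays geometrically even after division by
  the weights. The measurable majorant \<open>Y\<close> is stated in place of the supremum over the
  uncountable set of times, whose measurability is thereby left aside.\<close>

lemma chaining:
  fixes X :: "real \<Rightarrow> 'w \<Rightarrow> 'y::{real_normed_vector,second_countable_topology}"
  assumes m: "2 \<le> m" and ab: "a < b" and K: "0 \<le> K"
    and Xm: "\<And>t. t \<in> {a..b} \<Longrightarrow> X t \<in> borel_measurable M"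
    and cont: "AE \<omega> in M. continuous_on {a..b} (\<lambda>t. X t \<omega>)" and X0: "AE \<omega> in M. X a \<omega> = 0"
    and mom: "\<And>s t. a \<le> s \<Longrightarrow> s \<le> t \<Longrightarrow> t \<le> b \<Longrightarrow>
      (\<integral>\<^sup>+\<omega>. ennreal (norm (X t \<omega> - X s \<omega>) ^ (2 * m)) \<partial>M) \<le> ennreal (K * (t - s) ^ m)"
  obtains Y where "Y \<in> borel_measurable M" "AE \<omega> in M. \<forall>t\<in>{a..b}. ennreal (norm (X t \<omega>) ^ (2 * m)) \<le> Y \<omega>"
    "(\<integral>\<^sup>+\<omega>. Y \<omega> \<partial>M) \<le> ennreal (chain_const m * (K * (b - a) ^ m))"
proof -
  define c where "c = b - a"
  have c: "0 < c" using ab by (simp add: c_def)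
  define p where "p = 2 * m - 1"
  have pm: "2 * m - 1 = p" "1 \<le> 2 * m" using m by (auto simp: p_def)
  define z where "z l i = a + c * (real i / 2 ^ l)" for l i
  have zin: "z l i \<in> {a..b}" if "i \<le> 2 ^ l" for l i
  proof -
    have "real i \<le> real (2 ^ l)" using that by (simp only: of_nat_le_iff)
    then have "real i / 2 ^ l \<le> 1" by simp
    then have "c * (real i / 2 ^ l) \<le> c * 1" using c by (intro mult_left_mono) auto
    then show ?thesis using c by (auto simp: z_def c_def)
  qed
  have zd: "z l (Suc i) - z l i = c / 2 ^ l" "z l i \<le> z l (Suc i)" for l i
    using c by (simp_all add: z_def divide_right_mono add_divide_distrib algebra_simps)
  define dl where "dl l \<omega> = (\<Sum>i<2 ^ l. norm (X (z l (Suc i)) \<omega> - X (z l i) \<omega>) ^ (2 * m))" for l \<omega>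
  have Xz: "X (z l i) \<in> borel_measurable M" if "i \<le> 2 ^ l" for l i using Xm zin[OF that] by blast
  have Xd[measurable]: "(\<lambda>\<omega>. norm (X (z l (Suc i)) \<omega> - X (z l i) \<omega>) ^ (2 * m)) \<in> borel_measurable M" if "i < 2 ^ l" for l i
  proof -
    have [measurable]: "X (z l i) \<in> borel_measurable M" "X (z l (Suc i)) \<in> borel_measurable M" using that by (auto intro: Xz)
    show ?thesis by measurable
  qed
  have dlm[measurable]: "dl l \<in> borel_measurable M" for l
    unfolding dl_def[abs_def] by (intro borel_measurable_sum Xd) simp
  have dl0: "0 \<le> dl l \<omega>" for l \<omega> by (simp add: dl_def sum_nonneg)
  let ?c = "\<lambda>l. 10 ^ p / (9 / 10 :: real) ^ (l * p)"
  define Y where "Y \<omega> = (\<Sum>l. ennreal (?c l * dl l \<omega>))" for \<omega>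
  have Ym: "Y \<in> borel_measurable M" unfolding Y_def[abs_def] by measurable
  have dyad: "ennreal (norm (X (z n i) \<omega>) ^ (2 * m)) \<le> Y \<omega>" if X0: "X a \<omega> = 0" and i: "i \<le> 2 ^ n" for \<omega> n i
  proof -
    \<comment> \<open>The sum of the powers dominates each of them, so its root bounds the largest
      increment on the level.\<close>
    define d where "d l = root (2 * m) (dl l \<omega>)" for l
    have dp: "d l ^ (2 * m) = dl l \<omega>" "0 \<le> d l" for l
      using dl0 m by (auto simp: d_def)
    have "norm (X (z n i) \<omega>) \<le> (\<Sum>l\<le>n. d l)"
      unfolding z_def
    proof (rule dyadic_chain_bound[where X="\<lambda>t. X t \<omega>"])
      fix l i :: nat assume i: "i < 2 ^ l"
      have "norm (X (z l (Suc i)) \<omega> - X (z l i) \<omega>) ^ (2 * m) \<le> dl l \<omega>"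
        unfolding dl_def using i by (intro member_le_sum) auto
      then have "norm (X (z l (Suc i)) \<omega> - X (z l i) \<omega>) ^ (2 * m) \<le> d l ^ (2 * m)" by (simp add: dp)
      then have "norm (X (z l (Suc i)) \<omega> - X (z l i) \<omega>) \<le> d l"
        using m dp(2)[of l] by (subst (asm) power_mono_iff) auto
      then show "norm (X (a + c * (real (Suc i) / 2 ^ l)) \<omega> - X (a + c * (real i / 2 ^ l)) \<omega>) \<le> d l"
        unfolding z_def .
    qed (use X0 i dp in auto)
    then have "norm (X (z n i) \<omega>) ^ (2 * m) \<le> (\<Sum>l\<le>n. d l) ^ (2 * m)" by (intro power_mono) auto
    also have "\<dots> \<le> 10 ^ p * (\<Sum>l\<le>n. d l ^ (2 * m) / (9 / 10) ^ (l * p))"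
      using weighted_levels_power_le[of d "2 * m" n] dp(2) m unfolding p_def by simp
    also have "\<dots> = (\<Sum>l\<le>n. ?c l * dl l \<omega>)" by (simp add: dp sum_distrib_left)
    finally have "ennreal (norm (X (z n i) \<omega>) ^ (2 * m)) \<le> ennreal (\<Sum>l\<le>n. ?c l * dl l \<omega>)" by (rule ennreal_leI)
    also have "\<dots> = (\<Sum>l\<le>n. ennreal (?c l * dl l \<omega>))" using dl0 by (intro sum_ennreal[symmetric]) auto
    also have "\<dots> \<le> Y \<omega>" unfolding Y_def by (intro sum_le_suminf summableI) auto
    finally show ?thesis .
  qed
  have all: "AE \<omega> in M. \<forall>t\<in>{a..b}. ennreal (norm (X t \<omega>) ^ (2 * m)) \<le> Y \<omega>"
    using cont X0
  proof eventually_elim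
    case (elim \<omega>)
    show ?case
    proof
      fix t assume t: "t \<in> {a..b}"
      define x where "x = (t - a) / c"
      have x: "0 \<le> x" "x \<le> 1" "t = a + c * x" using t c by (auto simp: x_def c_def)
      \<comment> \<open>Rounding down yields dyadic points that converge to \<open>t\<close>;
        continuity of the path carries the bound by \<open>Y\<close> from them to
        \<open>t\<close>.\<close>
      define i where "i n = nat \<lfloor>x * 2 ^ n\<rfloor>" for n
      have xi: "real (i n) = of_int \<lfloor>x * 2 ^ n\<rfloor>" for n using x by (simp add: i_def)
      have i2: "i n \<le> 2 ^ n" for n
      proof -
        have "x * 2 ^ n \<le> 2 ^ n" using x by (simp add: mult_left_le_one_le)
        moreover have "real (i n) \<le> x * 2 ^ n" unfolding xi by (rule of_int_floor_le)
        ultimately have "real (i n) \<le> 2 ^ n" by linarith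
        then have "real (i n) \<le> real (2 ^ n)" by (simp only: of_nat_power of_nat_numeral)
        then show ?thesis by (simp only: of_nat_le_iff)
      qed
      have "(\<lambda>n. real (i n) / 2 ^ n) \<longlonglongrightarrow> x"
      proof (rule LIMSEQ_I)
        fix e :: real assume "0 < e"
        then obtain n0 where n0: "(1 / 2) ^ n0 < e" using real_arch_pow_inv[of e "1/2"] by auto
        have "norm (real (i n) / 2 ^ n - x) < e" if "n0 \<le> n" for n
        proof -
          have "\<bar>real (i n) - x * 2 ^ n\<bar> \<le> 1" unfolding xi by linarith
          then have "\<bar>real (i n) / 2 ^ n - x\<bar> \<le> 1 / 2 ^ n"
            using abs_divide[of "real (i n) - x * 2 ^ n" "2 ^ n"] by (simp add: diff_divide_distrib divide_right_mono)
          also have "\<dots> \<le> (1 / 2) ^ n0" using that by (simp add: power_one_over[symmetric] power_decreasing)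
          finally show ?thesis using n0 by simp
        qed
        then show "\<exists>no. \<forall>n\<ge>no. norm (real (i n) / 2 ^ n - x) < e" by blast
      qed
      then have lim: "(\<lambda>n. z n (i n)) \<longlonglongrightarrow> t" unfolding z_def x(3) by (intro tendsto_intros)
      have "(\<lambda>n. X (z n (i n)) \<omega>) \<longlonglongrightarrow> X t \<omega>"
        by (rule continuous_on_tendsto_compose[OF elim(1) lim t]) (use zin i2 in auto)
      then have "(\<lambda>n. ennreal (norm (X (z n (i n)) \<omega>) ^ (2 * m))) \<longlonglongrightarrow> ennreal (norm (X t \<omega>) ^ (2 * m))"
        by (intro tendsto_ennrealI tendsto_power tendsto_norm)
      then show "ennreal (norm (X t \<omega>) ^ (2 * m)) \<le> Y \<omega>"
        by (rule LIMSEQ_le_const2) (use dyad[OF elim(2) i2] in auto)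
    qed
  qed
  define \<rho> where "\<rho> = chain_ratio m"
  have \<rho>: "0 < \<rho>" "\<rho> < 1" using chain_ratio_bounds[OF m] by (auto simp: \<rho>_def)
  have lev: "(\<integral>\<^sup>+\<omega>. ennreal (?c l * dl l \<omega>) \<partial>M) \<le> ennreal (10 ^ p * (K * c ^ m) * \<rho> ^ l)" for l
  proof -
    have "(\<integral>\<^sup>+\<omega>. ennreal (dl l \<omega>) \<partial>M) = (\<integral>\<^sup>+\<omega>. (\<Sum>i<2 ^ l. ennreal (norm (X (z l (Suc i)) \<omega> - X (z l i) \<omega>) ^ (2 * m))) \<partial>M)"
      by (intro nn_integral_cong) (simp add: dl_def sum_ennreal)
    also have "\<dots> = (\<Sum>i<2 ^ l. \<integral>\<^sup>+\<omega>. ennreal (norm (X (z l (Suc i)) \<omega> - X (z l i) \<omega>) ^ (2 * m)) \<partial>M)"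
      by (intro nn_integral_sum measurable_compose[OF Xd measurable_ennreal]) simp
    also have "\<dots> \<le> (\<Sum>i<(2::nat) ^ l. ennreal (K * (c / 2 ^ l) ^ m))"
    proof (intro sum_mono)
      fix i :: nat assume "i \<in> {..<2 ^ l}"
      then have "a \<le> z l i" "z l (Suc i) \<le> b" using zin[of i l] zin[of "Suc i" l] by auto
      then show "(\<integral>\<^sup>+\<omega>. ennreal (norm (X (z l (Suc i)) \<omega> - X (z l i) \<omega>) ^ (2 * m)) \<partial>M) \<le> ennreal (K * (c / 2 ^ l) ^ m)"
        using mom[OF _ zd(2)[of l i]] unfolding zd(1) by blast
    qed
    also have "\<dots> = ennreal (2 ^ l * (K * (c / 2 ^ l) ^ m))"
      using K c by (simp add: ennreal_mult ennreal_power[symmetric])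
    finally have "ennreal (?c l) * (\<integral>\<^sup>+\<omega>. ennreal (dl l \<omega>) \<partial>M) \<le> ennreal (?c l) * ennreal (2 ^ l * (K * (c / 2 ^ l) ^ m))"
      by (intro mult_left_mono) auto
    also have "\<dots> = ennreal (?c l * (2 ^ l * (K * (c / 2 ^ l) ^ m)))" using K c by (intro ennreal_mult[symmetric]) auto
    also have "?c l * (2 ^ l * (K * (c / 2 ^ l) ^ m)) = 10 ^ p * (K * c ^ m) * \<rho> ^ l"
    proof -
      have "\<rho> = 2 / 2 ^ m / (9 / 10) ^ p" by (simp only: \<rho>_def chain_ratio_def p_def)
      then show ?thesis
        by (simp add: power_divide power_mult_distrib power_mult[symmetric] mult.commute)
    qed
    also have "ennreal (?c l) * (\<integral>\<^sup>+\<omega>. ennreal (dl l \<omega>) \<partial>M) = (\<integral>\<^sup>+\<omega>. ennreal (?c l * dl l \<omega>) \<partial>M)"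
      using dl0 by (subst nn_integral_cmult[symmetric]) (auto intro!: nn_integral_cong simp: ennreal_mult[symmetric])
    finally show ?thesis .
  qed
  have "(\<integral>\<^sup>+\<omega>. Y \<omega> \<partial>M) = (\<Sum>l. \<integral>\<^sup>+\<omega>. ennreal (?c l * dl l \<omega>) \<partial>M)"
    unfolding Y_def by (intro nn_integral_suminf) measurable
  also have "\<dots> \<le> (\<Sum>l. ennreal (10 ^ p * (K * c ^ m) * \<rho> ^ l))" by (intro suminf_le summableI lev)
  also have "\<dots> = ennreal (10 ^ p * (K * c ^ m) * (1 / (1 - \<rho>)))"
    using K c \<rho> by (intro suminf_ennreal_eq sums_mult geometric_sums) auto
  also have "10 ^ p * (K * c ^ m) * (1 / (1 - \<rho>)) = chain_const m * (K * (b - a) ^ m)"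
    by (simp add: chain_const_def \<rho>_def c_def p_def)
  finally show ?thesis using that Ym all by blast
qed

section \<open>Moments of extended random variables\<close>

lemma ennreal_powr_ennreal: "0 \<le> x \<Longrightarrow> ennreal_powr (ennreal x) p = ennreal (x powr p)"
  by (simp add: ennreal_powr_def)

lemma ennreal_powr_mono: "0 \<le> p \<Longrightarrow> x \<le> y \<Longrightarrow> ennreal_powr x p \<le> ennreal_powr y p"
  by (cases x; cases y) (auto simp: ennreal_powr_def top_unique intro!: ennreal_leI powr_mono2)

lemma powr_one_plus_le:
  fixes e s :: real
  assumes "0 \<le> e" "0 \<le> s" "s \<le> 1"
  shows "(1 + e) powr s \<le> 1 + e powr s"
proof (cases "e = 0")
  case False
  then have e: "0 < e" using assms by simp
  have "(1 + e) powr s = (1 + e) * (1 + e) powr (s - 1)"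
    using e powr_add[of "1 + e" 1 "s - 1"] by simp
  also have "\<dots> = (1 + e) powr (s - 1) + e * (1 + e) powr (s - 1)" by (simp add: distrib_right)
  also have "\<dots> \<le> 1 + e powr s"
  proof (rule add_mono)
    show "(1 + e) powr (s - 1) \<le> 1" using e assms powr_mono[of "s - 1" 0 "1 + e"] by simp
    have "e * (1 + e) powr (s - 1) \<le> e * e powr (s - 1)"
      using e assms by (intro mult_left_mono powr_mono2') auto
    also have "\<dots> = e powr s" using e powr_add[of e 1 "s - 1"] by simp
    finally show "e * (1 + e) powr (s - 1) \<le> e powr s" .
  qed
  finally show ?thesis .
qed simp

text \<open>Passing from the integral to the norm takes a root, which is subadditive because
  \<open>1 / q \<le> 1\<close>; this separates the constant 1 from the norm of
  \<open>Z0\<close>.\<close>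

lemma Lq_norm_le:
  assumes q: "1 \<le> q" and c: "0 \<le> c"
    and Z: "Z \<in> borel_measurable M" and le: "AE \<omega> in M. ennreal_powr (Z \<omega>) q \<le> B \<omega>"
    and B: "(\<integral>\<^sup>+\<omega>. B \<omega> \<partial>M) \<le> ennreal c * (1 + (\<integral>\<^sup>+\<omega>. ennreal_powr (Z0 \<omega>) q \<partial>M))"
    and Z0: "Lq_norm M q Z0 < \<infinity>"
  shows "Lq_norm M q Z \<le> ennreal (c powr (1 / q)) * (1 + Lq_norm M q Z0)"
proof -
  define e where "e = (\<integral>\<^sup>+\<omega>. ennreal_powr (Z0 \<omega>) q \<partial>M)"
  have L0: "Lq_norm M q Z0 = ennreal_powr e (1 / q)" using Z0 by (auto simp: Lq_norm_def e_def split: if_splits)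
  then have "e \<noteq> \<infinity>" using Z0 by (auto simp: ennreal_powr_def)
  then obtain e' where e': "e = ennreal e'" "0 \<le> e'" by (cases e) auto
  have "(\<integral>\<^sup>+\<omega>. ennreal_powr (Z \<omega>) q \<partial>M) \<le> ennreal c * (1 + ennreal e')"
    using nn_integral_mono_AE[OF le] B by (simp add: e_def[symmetric] e')
  also have "\<dots> = ennreal (c * (1 + e'))" using c e' by (simp add: ennreal_mult ennreal_plus[symmetric] del: ennreal_plus) (simp add: ennreal_1[symmetric] del: ennreal_1)
  finally have "ennreal_powr (\<integral>\<^sup>+\<omega>. ennreal_powr (Z \<omega>) q \<partial>M) (1 / q) \<le> ennreal_powr (ennreal (c * (1 + e'))) (1 / q)"
    using q by (intro ennreal_powr_mono) auto
  also have "\<dots> = ennreal (c powr (1 / q) * (1 + e') powr (1 / q))"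
    using c e' by (simp add: ennreal_powr_ennreal powr_mult)
  also have "\<dots> \<le> ennreal (c powr (1 / q) * (1 + e' powr (1 / q)))"
    using q e' by (intro ennreal_leI mult_left_mono powr_one_plus_le) auto
  also have "\<dots> = ennreal (c powr (1 / q)) * (1 + Lq_norm M q Z0)"
    unfolding L0 e'(1) using e'(2) by (simp add: ennreal_powr_ennreal ennreal_mult)
  finally show ?thesis using Z by (simp add: Lq_norm_def)
qed

lemma ennreal_powr_SUP_le:
  fixes f :: "'t \<Rightarrow> real"
  assumes q: "0 < q" and f: "\<And>t. t \<in> A \<Longrightarrow> 0 \<le> f t" and le: "\<And>t. t \<in> A \<Longrightarrow> ennreal (f t powr q) \<le> B"
  shows "ennreal_powr (SUP t\<in>A. ennreal (f t)) q \<le> B"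
proof (cases B)
  case (real b)
  have "(SUP t\<in>A. ennreal (f t)) \<le> ennreal (b powr (1 / q))"
  proof (rule SUP_least)
    fix t assume t: "t \<in> A"
    have "f t powr q \<le> b" using le[OF t] real by (simp add: ennreal_le_iff)
    then have "(f t powr q) powr (1 / q) \<le> b powr (1 / q)" using q by (intro powr_mono2) auto
    then show "ennreal (f t) \<le> ennreal (b powr (1 / q))" using f[OF t] q by (simp add: powr_powr ennreal_leI)
  qed
  then have "ennreal_powr (SUP t\<in>A. ennreal (f t)) q \<le> ennreal_powr (ennreal (b powr (1 / q))) q"
    using q by (intro ennreal_powr_mono) auto
  also have "\<dots> = B" using real q by (simp add: ennreal_powr_ennreal powr_powr)
  finally show ?thesis .
qed (simp add: top_unique)

lemma powr_sum3_le:
  fixes x y z q :: real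
  assumes "0 \<le> x" "0 \<le> y" "0 \<le> z" "0 \<le> q"
  shows "(x + y + z) powr q \<le> 3 powr q * (x powr q + y powr q + z powr q)"
proof -
  define w where "w = max x (max y z)"
  have "(x + y + z) powr q \<le> (3 * w) powr q" using assms by (intro powr_mono2) (auto simp: w_def)
  also have "\<dots> = 3 powr q * w powr q" using assms by (intro powr_mult)
  also have "w powr q \<le> x powr q + y powr q + z powr q"
    unfolding w_def max_def by (auto intro: add_nonneg_nonneg)
  finally show ?thesis by (simp add: mult_left_mono)
qed

lemma powr_le_one_plus_power:
  fixes x q :: real
  assumes "0 \<le> x" "q \<le> real n" "0 < q"
  shows "x powr q \<le> 1 + x ^ n"
proof (cases "x \<le> 1")
  case True
  then have "x powr q \<le> 1 powr q" using assms by (intro powr_mono2) auto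
  then show ?thesis using assms by (simp add: add_increasing2)
next
  case False
  then have "x powr q \<le> x powr real n" using assms by (intro powr_mono) auto
  then show ?thesis using False by (simp add: powr_realpow)
qed

lemma one_plus_square_powr_le:
  fixes y q :: real
  assumes "0 \<le> y" "0 < q"
  shows "(1 + y\<^sup>2) powr (q / 2) \<le> 2 powr (q / 2) * (1 + y powr q)"
proof -
  have "(1 + y\<^sup>2) powr (q / 2) \<le> (2 * (max 1 y)\<^sup>2) powr (q / 2)"
    using assms by (intro powr_mono2) (auto simp: max_def power_mono abs_square_le_1)
  also have "\<dots> = 2 powr (q / 2) * ((max 1 y)\<^sup>2) powr (q / 2)" by (intro powr_mult)
  also have "((max 1 y)\<^sup>2) powr (q / 2) = (max 1 y) powr q"
  proof -
    have "(max 1 y)\<^sup>2 = (max 1 y) powr 2" using assms by simp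
    then show ?thesis by (simp only: powr_powr) simp
  qed
  also have "\<dots> \<le> 1 + y powr q" by (simp add: max_def)
  finally show ?thesis by (simp add: mult_left_mono)
qed

section \<open>Measurability of Hilbert--Schmidt valued maps\<close>

lemma hs_ops_diff:
  assumes "R \<in> hs_ops I h" "R' \<in> hs_ops I h"
  shows "(\<lambda>u. R' u - R u) \<in> hs_ops I h"
proof -
  have "hs_sq I h (\<lambda>u. R' u - R u) \<le> 2 * hs_sq I h R' + 2 * hs_sq I h R"
    by (rule hs_sq_triangle) (rule norm_triangle_ineq4)
  also have "\<dots> < \<infinity>" using assms by (simp add: hs_sq_hs_ops ennreal_mult_less_top)
  finally have "(\<lambda>n. (norm (R' (h n) - R (h n)))\<^sup>2) summable_on I"
    using hs_sq_finite_summable[where R="\<lambda>u. R' u - R u" and h=h and I=I] by simp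
  then show ?thesis using assms by (auto simp: hs_ops_def intro: bounded_linear_sub)
qed

lemma space_hs_borel: "space (hs_borel I h) = hs_ops I h"
  unfolding hs_borel_def by (rule space_measure_of) auto

text \<open>Evaluation at a basis vector is 1-Lipschitz for the Hilbert--Schmidt norm, so preimages
  of open sets are among the generators of \<open>hs_borel\<close>.\<close>

lemma hs_eval_measurable:
  fixes h :: "nat \<Rightarrow> 'h::real_inner"
  assumes "i \<in> I"
  shows "(\<lambda>R :: 'h \<Rightarrow> 'y::real_inner. R (h i)) \<in> hs_borel I h \<rightarrow>\<^sub>M borel"
proof (rule borel_measurableI)
  fix S :: "'y set" assume S: "open S"
  let ?V = "{R \<in> hs_ops I h. R (h i) \<in> S}"
  have "\<exists>e>0. \<forall>R'\<in>hs_ops I h. hs_norm I h (\<lambda>u. R' u - R u) < e \<longrightarrow> R' \<in> ?V" if R: "R \<in> ?V" for R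
  proof -
    obtain e where e: "0 < e" "\<And>y. dist y (R (h i)) < e \<Longrightarrow> y \<in> S"
      using S R unfolding open_dist by auto
    have "R' \<in> ?V" if R': "R' \<in> hs_ops I h" "hs_norm I h (\<lambda>u. R' u - R u) < e" for R'
    proof -
      have "norm (R' (h i) - R (h i)) \<le> hs_norm I h (\<lambda>u. R' u - R u)"
        using hs_norm_ge[OF hs_ops_diff[OF _ R'(1), of R] assms] R by simp
      then show ?thesis using R' e(2)[of "R' (h i)"] by (simp add: dist_norm)
    qed
    then show ?thesis using e(1) by blast
  qed
  then have "?V \<in> sets (hs_borel I h)"
    unfolding hs_borel_def by (subst sets_measure_of) (auto intro!: sigma_sets.Basic)
  moreover have "(\<lambda>R. R (h i)) -` S \<inter> space (hs_borel I h) = ?V" by (auto simp: space_hs_borel)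
  ultimately show "(\<lambda>R. R (h i)) -` S \<inter> space (hs_borel I h) \<in> sets (hs_borel I h)" by simp
qed

text \<open>Through \<open>hs_sq\<close> the norm is the root of a countable series of nonnegative
  terms, so measurable evaluations at the basis vectors suffice.\<close>

lemma hs_norm_measurable:
  fixes G :: "'x \<Rightarrow> 'h::real_inner \<Rightarrow> 'y::{real_inner,banach,second_countable_topology}"
  assumes "\<And>x. G x \<in> hs_ops I h" "\<And>i. i \<in> I \<Longrightarrow> (\<lambda>x. G x (h i)) \<in> borel_measurable N"
  shows "(\<lambda>x. hs_norm I h (G x)) \<in> borel_measurable N"
proof -
  have "hs_norm I h (G x) = sqrt (enn2real (hs_sq I h (G x)))" for x
    by (simp add: hs_sq_hs_ops[OF assms(1)] hs_norm_nonneg)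
  moreover have "(\<lambda>x. sqrt (enn2real (hs_sq I h (G x)))) \<in> borel_measurable N"
    using hs_sq_measurable[of I G h N] assms(2) by simp
  ultimately show ?thesis by simp
qed

lemma hs_ops_stop:
  assumes "R \<in> hs_ops I h" "c = 0 \<or> c = 1"
  shows "(\<lambda>u. c *\<^sub>R R u) \<in> hs_ops I h" "hs_norm I h (\<lambda>u. c *\<^sub>R R u) = c * hs_norm I h R"
  using assms by (auto simp: hs_ops_def hs_norm_def)

section \<open>Step size\<close>

text \<open>Chosen to dominate both 1 and \<open>sqrt k\<close> for every \<open>k \<le> T\<close>,
  which covers step sizes on both sides of 1.\<close>

definition step_const :: "real \<Rightarrow> real" where
  "step_const T = 1 + sqrt T"

definition step_power_const :: "real \<Rightarrow> nat \<Rightarrow> real" where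
  "step_power_const T m = (step_const T)\<^sup>2 * (step_const T * sqrt T) ^ (m - 2)"

text \<open>Here \<open>\<theta> \<le> 1/4\<close> acts: for \<open>k \<le> 1\<close> it gives
  \<open>k * L^2 = k powr (1 - 2 * \<theta>) \<le> sqrt k\<close>. Steps longer than 1 occur for
  large \<open>T\<close>, and then \<open>L \<le> 1\<close>. In a power of order
  \<open>m \<ge> 2\<close> two factors \<open>sqrt k\<close> produce \<open>k\<close>, and the
  remaining factors are bounded in terms of \<open>T\<close>. No bound involves \<theta>.\<close>

lemma step_size_bounds:
  fixes k T \<theta> :: real
  assumes k: "0 < k" "k \<le> T" and \<theta>: "0 < \<theta>" "\<theta> \<le> 1 / 4"
  defines "L \<equiv> k powr (- \<theta>)"
  shows "k * L\<^sup>2 \<le> step_const T * sqrt T" and "2 \<le> m \<Longrightarrow> (k * L\<^sup>2) ^ m \<le> step_power_const T m * k"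
proof -
  have sk: "sqrt k \<le> sqrt T" "0 < sqrt k" using k by auto
  have L2: "L\<^sup>2 = k powr (- (2 * \<theta>))" by (simp add: L_def power2_eq_square powr_add[symmetric])
  have c1: "1 \<le> step_const T" using k by (simp add: step_const_def)
  have skc: "sqrt k \<le> step_const T" unfolding step_const_def using sk(1) by linarith
  have main: "k * L\<^sup>2 \<le> step_const T * sqrt k"
  proof (cases "k \<le> 1")
    case True
    have "L\<^sup>2 \<le> k powr (- 1 / 2)" unfolding L2 using True \<theta> k by (intro powr_mono') auto
    then have "k * L\<^sup>2 \<le> k * k powr (- 1 / 2)" using k by simp
    also have "\<dots> = k powr (1 / 2)" using k powr_add[of k 1 "- 1 / 2"] by simp
    also have "\<dots> = 1 * sqrt k" using k by (simp add: powr_half_sqrt)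
    also have "\<dots> \<le> step_const T * sqrt k" using c1 sk by (intro mult_right_mono) auto
    finally show ?thesis .
  next
    case False
    have "L\<^sup>2 \<le> k powr 0" unfolding L2 using False \<theta> by (intro powr_mono) auto
    then have "k * L\<^sup>2 \<le> k * 1" using k by (intro mult_left_mono) auto
    also have "\<dots> = sqrt k * sqrt k" using k by simp
    also have "\<dots> \<le> step_const T * sqrt k" by (rule mult_right_mono[OF skc]) (use k in simp)
    finally show ?thesis .
  qed
  also have "\<dots> \<le> step_const T * sqrt T" using sk c1 by (intro mult_left_mono) auto
  finally show kL: "k * L\<^sup>2 \<le> step_const T * sqrt T" .
  assume m: "2 \<le> m"
  have nn: "0 \<le> k * L\<^sup>2" using k by simp
  have "(k * L\<^sup>2) ^ m = (k * L\<^sup>2)\<^sup>2 * (k * L\<^sup>2) ^ (m - 2)" 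
    by (simp only: power_add[symmetric] le_add_diff_inverse[OF m])
  also have "\<dots> \<le> (step_const T * sqrt k)\<^sup>2 * (step_const T * sqrt T) ^ (m - 2)"
    by (rule mult_mono[OF power_mono[OF main nn] power_mono[OF kL nn]]) (use nn in simp_all)
  also have "\<dots> = step_power_const T m * k" using k by (simp add: step_power_const_def power_mult_distrib)
  finally show "(k * L\<^sup>2) ^ m \<le> step_power_const T m * k" .
qed

lemma grid_Suc: "grid T N (Suc j) = grid T N j + T / real N"
  by (simp add: grid_def add_divide_distrib algebra_simps)

lemma grid_bounds:
  assumes "0 < T" "1 \<le> N" "j \<le> N"
  shows "0 \<le> grid T N j" "grid T N j \<le> T"
proof -
  have "real j * (T / real N) \<le> real N * (T / real N)" using assms by (intro mult_right_mono) auto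
  then show "grid T N j \<le> T" using assms by (simp add: grid_def)
qed (use assms in \<open>simp add: grid_def\<close>)

lemma grid_cover:
  assumes T: "0 < T" and N: "1 \<le> N" and t: "0 \<le> t" "t < T"
  obtains j where "j < N" "t \<in> {grid T N j..<grid T N (Suc j)}"
proof -
  define k where "k = T / real N"
  have k: "0 < k" "real N * k = T" using T N by (auto simp: k_def)
  define j where "j = nat \<lfloor>t / k\<rfloor>"
  have j: "real j = of_int \<lfloor>t / k\<rfloor>" using t k by (simp add: j_def)
  have "real j \<le> t / k" "t / k < real j + 1" unfolding j by linarith+
  then have 1: "real j * k \<le> t" "t < (real j + 1) * k" using k by (auto simp: field_simps)
  then have "real j * k < real N * k" using t k by linarith
  then have "real j < real N" using k(1) by (simp only: mult_less_cancel_right_pos)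
  then have "j < N" by simp
  then show ?thesis using that 1 by (simp add: grid_def k_def[symmetric] algebra_simps)
qed

section \<open>The stopped scheme\<close>

text \<open>The factor of \<open>k\<close> in the part of a step that coercivity does not absorb:
  the squared drift from Young's inequality and the powers of order \<open>2m\<close> of drift and
  noise.\<close>

definition increment_const :: "real \<Rightarrow> nat \<Rightarrow> real \<Rightarrow> real \<Rightarrow> real \<Rightarrow> real" where
  "increment_const T m a d C = a * (1 + 1 / d) * (step_const T * sqrt T) +
     C * 4 ^ m * (T ^ m * step_power_const T m + gauss_moment m * step_power_const T m)"

lemma step_const_nonneg: "0 \<le> T \<Longrightarrow> 0 \<le> step_const T"
  by (simp add: step_const_def)

lemma step_power_const_nonneg: "0 \<le> T \<Longrightarrow> 0 \<le> step_power_const T m"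
  by (simp add: step_power_const_def step_const_nonneg)

lemma increment_const_nonneg:
  "0 \<le> T \<Longrightarrow> 0 \<le> a \<Longrightarrow> 0 < d \<Longrightarrow> 0 \<le> C \<Longrightarrow> 0 \<le> increment_const T m a d C"
  unfolding increment_const_def
  by (intro add_nonneg_nonneg mult_nonneg_nonneg) (auto simp: step_const_nonneg step_power_const_nonneg gauss_moment_nonneg)

text \<open>
  The moments of order \<open>q + \<epsilon>/2\<close> are propagated: half of the slack \<open>\<epsilon>\<close> raises the exponent above \<open>q\<close>, the other half
  is consumed by the errors \<open>a - r (r - 1) / 2\<close> and \<open>d\<close> of the Taylor expansion and of Young's inequality.
\<close>

locale euler_scheme = cylindrical_noise M T FF W
  for M :: "'w measure" and T FF and W :: "(real \<Rightarrow> 'h::{real_inner,banach,second_countable_topology}) \<Rightarrow> 'w \<Rightarrow> real" +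
  fixes I :: "nat set" and h :: "nat \<Rightarrow> 'h"
    and S :: "real \<Rightarrow> 'y::{real_inner,banach,second_countable_topology} \<Rightarrow> 'y"
    and F :: "'y \<Rightarrow> 'y" and G :: "'y \<Rightarrow> 'h \<Rightarrow> 'y" and \<theta> :: real and u0 :: "'w \<Rightarrow> 'y" and N :: nat and U :: "nat \<Rightarrow> 'w \<Rightarrow> 'y"
    and q \<epsilon> Cq a d C :: real and m :: nat
  assumes q: "2 \<le> q" "0 < \<epsilon>" "0 \<le> Cq"
    and onb: "orthonormal_basis I h"
    and S_linear: "\<And>t. 0 \<le> t \<Longrightarrow> bounded_linear (S t)"
    and S_contr: "\<And>t x. 0 \<le> t \<Longrightarrow> norm (S t x) \<le> norm x"
    and S_cont: "\<And>x. continuous_on {0..} (\<lambda>t. S t x)"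
    and F_meas: "F \<in> borel_measurable borel" and G_meas: "G \<in> borel \<rightarrow>\<^sub>M hs_borel I h"
    and coer: "\<And>x. x \<bullet> F x + (q + \<epsilon> - 1) / 2 * (hs_norm I h (G x))\<^sup>2 \<le> Cq * (1 + (norm x)\<^sup>2)"
    and \<theta>: "0 < \<theta>" "\<theta> \<le> 1 / 4"
    and u0: "u0 \<in> borel_measurable (FF 0)"
    and N: "1 \<le> N"
    and scheme: "stopped_exponential_euler M W I h S F G \<theta> T N u0 U"
    and coeffs: "0 \<le> a" "0 < d" "0 \<le> C" "a * (1 + d) = (q + \<epsilon> / 2) * (q + \<epsilon> - 1) / 2"
    and expan: "\<And>x y :: 'y. (1 + (norm (x + y))\<^sup>2) powr ((q + \<epsilon> / 2) / 2) \<le> (1 + (norm x)\<^sup>2) powr ((q + \<epsilon> / 2) / 2 - 1) *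
         (1 + (norm x)\<^sup>2 + (q + \<epsilon> / 2) * (x \<bullet> y) + a * (norm y)\<^sup>2 + C * norm y ^ (2 * m))"
    and m: "2 \<le> m" "q \<le> real (2 * m)"
begin

definition r where "r = q + \<epsilon> / 2"
definition k where "k = T / real N"
definition L where "L = k powr (- \<theta>)"
definition cc where "cc = r * Cq + increment_const T m a d C"

abbreviation g where "g \<equiv> grid T N"
abbreviation st where "st \<equiv> stop_ind I h F G k \<theta>"
abbreviation R where "R j \<omega> \<equiv> (\<lambda>v. st (U j \<omega>) *\<^sub>R G (U j \<omega>) v)"
abbreviation \<gamma> where "\<gamma> j \<omega> \<equiv> st (U j \<omega>) * hs_norm I h (G (U j \<omega>))"
abbreviation f where "f j \<omega> \<equiv> st (U j \<omega>) *\<^sub>R F (U j \<omega>)"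

lemma k: "0 < k" "k \<le> T" "real N * k = T"
  using T_pos N by (auto simp: k_def divide_le_eq)

lemma L0: "0 \<le> L" by (simp add: L_def)

lemma r: "2 \<le> r" "q < r" using q by (auto simp: r_def)

lemma cc0: "0 \<le> cc"
  using q r coeffs T_pos increment_const_nonneg[of T a d C m] by (simp add: cc_def)

lemma g_bounds: "j \<le> N \<Longrightarrow> g j \<in> {0..T}"
  using grid_bounds[OF T_pos N] by auto

lemma g_Suc: "g (Suc j) = g j + k" by (simp add: grid_Suc k_def)

lemma G_ops: "G x \<in> hs_ops I h"
  using measurable_space[OF G_meas, of x] by (simp add: space_hs_borel)

lemma G_eval[measurable]: "i \<in> I \<Longrightarrow> (\<lambda>x. G x (h i)) \<in> borel_measurable borel"
  using measurable_compose[OF G_meas hs_eval_measurable] by blast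

lemma hsG_meas[measurable]: "(\<lambda>x. hs_norm I h (G x)) \<in> borel_measurable borel"
  by (rule hs_norm_measurable) (auto intro: G_ops)

lemma st_meas[measurable]: "st \<in> borel_measurable borel"
proof -
  note [measurable] = F_meas
  show ?thesis unfolding stop_ind_def[abs_def] by measurable
qed

lemma st_cases: "st x = 0 \<or> st x = 1" by (simp add: stop_ind_def)

lemma stop_bounds: "norm (st x *\<^sub>R F x) \<le> L" "0 \<le> st x * hs_norm I h (G x)" "st x * hs_norm I h (G x) \<le> L"
proof -
  have 0: "0 \<le> hs_norm I h (G x)" by (rule hs_norm_nonneg)
  have "norm (F x) \<le> L \<and> hs_norm I h (G x) \<le> L" if "norm (F x) + hs_norm I h (G x) \<le> L"
    using that 0 norm_ge_zero[of "F x"] by linarith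
  then show "norm (st x *\<^sub>R F x) \<le> L" "0 \<le> st x * hs_norm I h (G x)" "st x * hs_norm I h (G x) \<le> L"
    using 0 L0 unfolding stop_ind_def L_def by auto
qed

lemma R_ops: "R j \<omega> \<in> hs_ops I h" and R_norm: "hs_norm I h (R j \<omega>) = \<gamma> j \<omega>"
  using hs_ops_stop[OF G_ops st_cases] by auto

lemma U_M[measurable]: "j \<le> N \<Longrightarrow> U j \<in> borel_measurable M"
  using scheme by (simp add: stopped_exponential_euler_def Let_def)

lemma U_0: "AE \<omega> in M. U 0 \<omega> = u0 \<omega>"
  using scheme by (simp add: stopped_exponential_euler_def Let_def)

lemma noise:
  assumes "j < N"
  obtains Z where "Z \<in> borel_measurable M"
    "(\<lambda>n. \<integral>\<^sup>+\<omega>. ennreal ((norm (Z \<omega> - wsum (g j) (g (Suc j)) (I \<inter> {..<n}) h (\<lambda>i \<omega>. R j \<omega> (h i)) \<omega>))\<^sup>2) \<partial>M) \<longlonglongrightarrow> 0"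
    "AE \<omega> in M. U (Suc j) \<omega> = S k (U j \<omega>) + k *\<^sub>R S k (f j \<omega>) + S k (Z \<omega>)"
proof -
  obtain Z where Z: "noise_increment M W I h (g j) (g (Suc j)) (\<lambda>\<omega> v. st (U j \<omega>) *\<^sub>R G (U j \<omega>) v) Z"
    "AE \<omega> in M. U (Suc j) \<omega> = S k (U j \<omega>) + k *\<^sub>R S k (f j \<omega>) + S k (Z \<omega>)"
    using scheme assms unfolding stopped_exponential_euler_def Let_def k_def by blast
  show ?thesis
    by (rule that[OF _ _ Z(2)]) (use Z(1) in \<open>simp_all add: noise_increment_def wsum_def D_def\<close>)
qed

text \<open>Subintervals of a step are included since chaining requires the increments of the
  stochastic integral between arbitrary times of the step.\<close>

lemma adapted:
  assumes U: "U j \<in> borel_measurable (FF (g j))" and j: "j < N"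
    and st: "g j \<le> s" "s \<le> t" "t \<le> g (Suc j)" and Z: "Z \<in> borel_measurable M"
    and lim: "(\<lambda>n. \<integral>\<^sup>+\<omega>. ennreal ((norm (Z \<omega> - wsum s t (I \<inter> {..<n}) h (\<lambda>i \<omega>. R j \<omega> (h i)) \<omega>))\<^sup>2) \<partial>M) \<longlonglongrightarrow> 0"
  shows "adapted_increment M T FF W s t I h (\<lambda>i \<omega>. R j \<omega> (h i)) (\<gamma> j) L Z"
proof -
  have b: "0 \<le> g j" "g (Suc j) \<le> T" using g_bounds[of j] g_bounds[of "Suc j"] j by auto
  have [measurable]: "U j \<in> borel_measurable (FF s)"
    by (rule measurable_from_subalg[OF FF_subalgebra_mono U]) (use b st in auto)
  show ?thesis
  proof (intro adapted_increment.intro adapted_increment_axioms.intro cylindrical_noise_axioms)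
    show "0 \<le> s" "s \<le> t" "t \<le> T" using b st by auto
    show "h i \<bullet> h j = (if i = j then 1 else 0)" if "i \<in> I" "j \<in> I" for i j
      using onb that by (simp add: orthonormal_basis_def)
    show "(\<lambda>\<omega>. R j \<omega> (h i)) \<in> borel_measurable (FF s)" if "i \<in> I" for i
    proof -
      note [measurable] = G_eval[OF that]
      show ?thesis by measurable
    qed
    show "\<gamma> j \<in> borel_measurable (FF s)" by measurable
    show "0 \<le> \<gamma> j \<omega>" "\<gamma> j \<omega> \<le> L" for \<omega> using stop_bounds by auto
    show "(\<Sum>i\<in>I \<inter> {..<n}. (norm (R j \<omega> (h i)))\<^sup>2) \<le> (\<gamma> j \<omega>)\<^sup>2" for n \<omega>
      using hs_norm_partial_sum_le[OF R_ops[of j \<omega>], of n] unfolding R_norm by simp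
  qed (use Z lim in auto)
qed

lemma S_measurable[measurable]: "0 \<le> t \<Longrightarrow> S t \<in> borel_measurable borel"
  by (intro borel_measurable_continuous_onI linear_continuous_on S_linear)

text \<open>The scheme supplies only measurability with respect to \<open>M\<close> and almost sure
  identities. Inductively, the noise term is a limit of variables known at the next grid time, and
  completeness transfers this to \<open>U (Suc j)\<close>.\<close>

lemma U_adapted: "j \<le> N \<Longrightarrow> U j \<in> borel_measurable (FF (g j))"
proof (induction j)
  case 0
  have "g 0 = 0" by (simp add: grid_def)
  moreover have "AE \<omega> in M. u0 \<omega> = U 0 \<omega>" using U_0 by eventually_elim simp
  ultimately show ?case using FF_complete[of 0 u0 "U 0"] u0 T_pos by simp
next
  case (Suc j)
  then have j: "j < N" and UF: "U j \<in> borel_measurable (FF (g j))" by auto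
  obtain Z where Z: "Z \<in> borel_measurable M"
    "(\<lambda>n. \<integral>\<^sup>+\<omega>. ennreal ((norm (Z \<omega> - wsum (g j) (g (Suc j)) (I \<inter> {..<n}) h (\<lambda>i \<omega>. R j \<omega> (h i)) \<omega>))\<^sup>2) \<partial>M) \<longlonglongrightarrow> 0"
    "AE \<omega> in M. U (Suc j) \<omega> = S k (U j \<omega>) + k *\<^sub>R S k (f j \<omega>) + S k (Z \<omega>)"
    using noise[OF j] by blast
  interpret Z: adapted_increment M T FF W "g j" "g (Suc j)" I h "\<lambda>i \<omega>. R j \<omega> (h i)" "\<gamma> j" L Z
    by (rule adapted[OF UF j _ _ _ Z(1,2)]) (use k g_Suc in auto)
  have [measurable]: "Z \<in> borel_measurable (FF (g (Suc j)))" by (rule Z.increment_measurable)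
  have [measurable]: "U j \<in> borel_measurable (FF (g (Suc j)))"
    by (rule measurable_from_subalg[OF FF_subalgebra_mono UF])
      (use g_bounds[of j] g_bounds[of "Suc j"] Suc.prems k g_Suc in auto)
  note [measurable] = F_meas S_measurable[OF less_imp_le[OF k(1)]]
  have "(\<lambda>\<omega>. S k (U j \<omega>) + k *\<^sub>R S k (f j \<omega>) + S k (Z \<omega>)) \<in> borel_measurable (FF (g (Suc j)))" by measurable
  then show ?case
    by (rule FF_complete[OF g_bounds[OF Suc.prems]]) (use Z(3) in \<open>auto elim!: eventually_mono\<close>)
qed

text \<open>Writing \<open>(k * L)^2 = k * (k * L^2)\<close> shows that each drift term has a power
  of \<open>k\<close> to spare, while for the noise the factor \<open>k\<close> comes from
  \<open>(k * L^2) ^ m\<close>.\<close>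

lemma small_increment:
  "a * (1 + 1 / d) * (k * L)\<^sup>2 + C * 4 ^ m * ((k * L) ^ (2 * m) + gauss_moment m * (k * L\<^sup>2) ^ m)
    \<le> increment_const T m a d C * k"
proof -
  note sb = step_size_bounds[OF k(1,2) \<theta>, folded L_def]
  have "(k * L)\<^sup>2 = k * (k * L\<^sup>2)" by (simp add: power2_eq_square)
  also have "\<dots> \<le> k * (step_const T * sqrt T)" using sb(1) k by (intro mult_left_mono) auto
  finally have 1: "(k * L)\<^sup>2 \<le> (step_const T * sqrt T) * k" by (simp add: mult.commute)
  have "(k * L) ^ (2 * m) = k ^ m * (k * L\<^sup>2) ^ m"
    unfolding power_mult power_mult_distrib[symmetric] by (simp add: power2_eq_square mult_ac)
  also have "\<dots> \<le> T ^ m * (step_power_const T m * k)"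
    using sb(2)[OF m(1)] k by (intro mult_mono power_mono) auto
  finally have 2: "(k * L) ^ (2 * m) \<le> T ^ m * (step_power_const T m * k)" .
  have "a * (1 + 1 / d) * (k * L)\<^sup>2 + C * 4 ^ m * ((k * L) ^ (2 * m) + gauss_moment m * (k * L\<^sup>2) ^ m)
    \<le> a * (1 + 1 / d) * ((step_const T * sqrt T) * k) +
      C * 4 ^ m * (T ^ m * (step_power_const T m * k) + gauss_moment m * (step_power_const T m * k))"
    using 1 2 sb(2)[OF m(1)] coeffs gauss_moment_nonneg by (intro add_mono mult_left_mono) auto
  also have "\<dots> = increment_const T m a d C * k" by (simp add: increment_const_def algebra_simps)
  finally show ?thesis .
qed

text \<open>The indicator takes the values 0 and 1, hence equals its square and factors out of both
  terms; where it is 0, nonnegativity of \<open>Cq\<close> gives the bound.\<close>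

lemma coercive: "r * (U j \<omega> \<bullet> f j \<omega>) + a * (1 + d) * (\<gamma> j \<omega>)\<^sup>2 \<le> r * Cq * (1 + (norm (U j \<omega>))\<^sup>2)"
proof -
  let ?x = "U j \<omega>"
  have "r * (?x \<bullet> f j \<omega>) + a * (1 + d) * (\<gamma> j \<omega>)\<^sup>2 =
    r * (st ?x * (?x \<bullet> F ?x + (q + \<epsilon> - 1) / 2 * (hs_norm I h (G ?x))\<^sup>2))"
    using st_cases[of ?x] unfolding coeffs(4) r_def by (auto simp: field_simps)
  also have "\<dots> \<le> r * (Cq * (1 + (norm ?x)\<^sup>2))"
    using st_cases[of ?x] coer[of ?x] q r by (intro mult_left_mono) auto
  finally show ?thesis by (simp add: mult.assoc)
qed

text \<open>Linearity gathers the three terms of the recursion under a single \<open>S k\<close>,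
  and contractivity leaves exactly the increment treated by
  \<open>euler_step_moment\<close>.\<close>

lemma step_moment:
  assumes j: "j < N" and B: "B \<in> sets (FF (g j))"
  shows "(\<integral>\<^sup>+\<omega>. indicator B \<omega> * ennreal ((1 + (norm (U (Suc j) \<omega>))\<^sup>2) powr (r / 2)) \<partial>M) \<le>
    (\<integral>\<^sup>+\<omega>. indicator B \<omega> * ennreal ((1 + cc * k) * (1 + (norm (U j \<omega>))\<^sup>2) powr (r / 2)) \<partial>M)"
proof -
  have UF[measurable]: "U j \<in> borel_measurable (FF (g j))" using U_adapted j by simp
  obtain Z where Z: "Z \<in> borel_measurable M"
    "(\<lambda>n. \<integral>\<^sup>+\<omega>. ennreal ((norm (Z \<omega> - wsum (g j) (g (Suc j)) (I \<inter> {..<n}) h (\<lambda>i \<omega>. R j \<omega> (h i)) \<omega>))\<^sup>2) \<partial>M) \<longlonglongrightarrow> 0"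
    "AE \<omega> in M. U (Suc j) \<omega> = S k (U j \<omega>) + k *\<^sub>R S k (f j \<omega>) + S k (Z \<omega>)"
    using noise[OF j] by blast
  interpret Z: adapted_increment M T FF W "g j" "g (Suc j)" I h "\<lambda>i \<omega>. R j \<omega> (h i)" "\<gamma> j" L Z
    by (rule adapted[OF UF j _ _ _ Z(1,2)]) (use k g_Suc in auto)
  have len: "g (Suc j) - g j = k" by (simp add: g_Suc)
  have gj: "g j \<in> {0..T}" using g_bounds j by simp
  have "AE \<omega> in M. indicator B \<omega> * ennreal ((1 + (norm (U (Suc j) \<omega>))\<^sup>2) powr (r / 2)) \<le>
    indicator B \<omega> * ennreal ((1 + (norm (U j \<omega> + (k *\<^sub>R f j \<omega> + Z \<omega>)))\<^sup>2) powr (r / 2))"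
    using Z(3)
  proof eventually_elim
    case (elim \<omega>)
    interpret Sk: bounded_linear "S k" using S_linear k by simp
    have "U (Suc j) \<omega> = S k (U j \<omega> + (k *\<^sub>R f j \<omega> + Z \<omega>))"
      unfolding elim by (simp add: Sk.add Sk.scaleR)
    then have "norm (U (Suc j) \<omega>) \<le> norm (U j \<omega> + (k *\<^sub>R f j \<omega> + Z \<omega>))" using S_contr k by simp
    then show ?case using r by (intro mult_left_mono ennreal_leI powr_mono2 add_left_mono power_mono) auto
  qed
  then have "(\<integral>\<^sup>+\<omega>. indicator B \<omega> * ennreal ((1 + (norm (U (Suc j) \<omega>))\<^sup>2) powr (r / 2)) \<partial>M) \<le>
    (\<integral>\<^sup>+\<omega>. indicator B \<omega> * ennreal ((1 + (norm (U j \<omega> + (k *\<^sub>R f j \<omega> + Z \<omega>)))\<^sup>2) powr (r / 2)) \<partial>M)"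
    by (rule nn_integral_mono_AE)
  also have "\<dots> \<le> (\<integral>\<^sup>+\<omega>. indicator B \<omega> * ennreal ((1 + (r * Cq + increment_const T m a d C) * k) * (1 + (norm (U j \<omega>))\<^sup>2) powr (r / 2)) \<partial>M)"
  proof (rule euler_step_moment[OF FF_subalgebra[OF gj], where \<gamma>="\<gamma> j" and L=L and b="gauss_moment m * (k * L\<^sup>2) ^ m" and a=a and d=d and C=C and m=m])
    note [measurable] = F_meas
    show "f j \<in> borel_measurable (FF (g j))" by measurable
    show "\<gamma> j \<in> borel_measurable (FF (g j))" by measurable
    show "norm (f j \<omega>) \<le> L" "0 \<le> \<gamma> j \<omega>" "\<gamma> j \<omega> \<le> L" for \<omega> using stop_bounds by auto
    show "(LINT \<omega>|M. y \<omega> \<bullet> Z \<omega>) = 0" if "y \<in> borel_measurable (FF (g j))" "\<And>\<omega>. norm (y \<omega>) \<le> c" for y c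
      by (rule Z.increment_mean[OF that])
    show "(\<integral>\<^sup>+\<omega>. indicator B \<omega> * ennreal ((norm (Z \<omega>))\<^sup>2) \<partial>M) \<le> (\<integral>\<^sup>+\<omega>. indicator B \<omega> * ennreal (k * (\<gamma> j \<omega>)\<^sup>2) \<partial>M)"
      if "B \<in> sets (FF (g j))" for B using Z.increment_var[OF that] unfolding len .
    show "(\<integral>\<^sup>+\<omega>. indicator B \<omega> * ennreal (norm (Z \<omega>) ^ (2 * m)) \<partial>M) \<le>
      (\<integral>\<^sup>+\<omega>. indicator B \<omega> * ennreal (gauss_moment m * (k * L\<^sup>2) ^ m) \<partial>M)"
      if "B \<in> sets (FF (g j))" for B using Z.increment_moment[OF that, of m] m unfolding len by simp
    show "0 \<le> gauss_moment m * (k * L\<^sup>2) ^ m" using gauss_moment_nonneg k by simp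
    show "0 \<le> increment_const T m a d C" using increment_const_nonneg coeffs T_pos by simp
    show "0 \<le> r * Cq" using r q by simp
    show "(1 + (norm (x + y))\<^sup>2) powr (r / 2) \<le> (1 + (norm x)\<^sup>2) powr (r / 2 - 1) *
         (1 + (norm x)\<^sup>2 + r * (x \<bullet> y) + a * (norm y)\<^sup>2 + C * norm y ^ (2 * m))" for x y :: 'y
      using expan unfolding r_def .
    show "r * (U j \<omega> \<bullet> f j \<omega>) + a * (1 + d) * (\<gamma> j \<omega>)\<^sup>2 \<le> r * Cq * (1 + (norm (U j \<omega>))\<^sup>2)" for \<omega> by (rule coercive)
    show "a * (1 + 1 / d) * (k * L)\<^sup>2 + C * 4 ^ m * ((k * L) ^ (2 * m) + gauss_moment m * (k * L\<^sup>2) ^ m)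
      \<le> increment_const T m a d C * k" by (rule small_increment)
  qed (use k r coeffs Z(1) B UF in auto)
  finally show ?thesis by (simp add: cc_def)
qed

text \<open>The factors come from undoing the discount,
  \<open>(1 + cc * k) ^ j \<le> exp (cc * T)\<close>, to the power \<open>q / r\<close>, from the
  maximal inequality, and from \<open>(1 + y^2) powr (q / 2)\<close> at time zero.\<close>

definition max_const :: real where
  "max_const = exp (cc * T * (q / r)) * (1 / (1 - q / r)) * 2 powr (q / 2)"

lemma max_const_nonneg: "0 \<le> max_const"
  using r q by (simp add: max_const_def)

text \<open>The power \<open>p = q / r\<close>, applied after the supermartingale estimate, brings
  the order \<open>r\<close> back to \<open>q\<close>, so at time zero only the \<open>q\<close>-th
  moment of \<open>u0\<close> appears.\<close>

lemma maximal_bound: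
  obtains V where "V \<in> borel_measurable M" "\<And>j \<omega>. j \<le> N \<Longrightarrow> ennreal (norm (U j \<omega>) powr q) \<le> V \<omega>"
    "(\<integral>\<^sup>+\<omega>. V \<omega> \<partial>M) \<le> ennreal max_const * (1 + (\<integral>\<^sup>+\<omega>. ennreal (norm (u0 \<omega>) powr q) \<partial>M))"
proof -
  define p where "p = q / r"
  have p: "0 < p" "p < 1" using r q by (auto simp: p_def)
  define e where "e = 1 + cc * k"
  have e: "1 \<le> e" using cc0 k by (simp add: e_def)
  \<comment> \<open>Division by \<open>e ^ j\<close> turns the growth factor
    \<open>1 + cc * k\<close> of one step into the supermartingale property.\<close>
  define Z where "Z j \<omega> = (1 + (norm (U j \<omega>))\<^sup>2) powr (r / 2) / e ^ j" for j \<omega>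
  have Zpos: "0 < Z j \<omega>" for j \<omega>
  proof -
    have "0 < 1 + (norm (U j \<omega>))\<^sup>2" by (simp add: add_pos_nonneg)
    then show ?thesis using e unfolding Z_def by (intro divide_pos_pos) auto
  qed
  have ZF: "Z j \<in> borel_measurable (FF (g j))" if "j \<le> N" for j
    using U_adapted[OF that] unfolding Z_def[abs_def] by measurable
  have max: "(\<integral>\<^sup>+\<omega>. ennreal (Max ((\<lambda>j. Z j \<omega>) ` {..N}) powr p) \<partial>M) \<le> ennreal (1 / (1 - p)) * (\<integral>\<^sup>+\<omega>. ennreal (Z 0 \<omega> powr p) \<partial>M)"
  proof (rule supermartingale_maximal_powr[OF p, where F="\<lambda>j. FF (g j)"])
    show "subalgebra M (FF (g j))" if "j \<le> N" for j by (rule FF_subalgebra[OF g_bounds[OF that]])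
    show "sets (FF (g j)) \<subseteq> sets (FF (g (Suc j)))" if "j < N" for j
      by (rule FF_mono) (use g_bounds[of j] g_bounds[of "Suc j"] that k g_Suc in auto)
    fix j B assume j: "j < N" and B: "B \<in> sets (FF (g j))"
    have [measurable]: "U j \<in> borel_measurable M" "U (Suc j) \<in> borel_measurable M" "B \<in> events"
      using j FF_sets_M[OF g_bounds B] by auto
    have "(\<integral>\<^sup>+\<omega>. indicator B \<omega> * ennreal (Z (Suc j) \<omega>) \<partial>M) =
      (\<integral>\<^sup>+\<omega>. ennreal (1 / e ^ Suc j) * (indicator B \<omega> * ennreal ((1 + (norm (U (Suc j) \<omega>))\<^sup>2) powr (r / 2))) \<partial>M)"
      using e by (intro nn_integral_cong) (auto simp: Z_def indicator_def ennreal_mult[symmetric])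
    also have "\<dots> = ennreal (1 / e ^ Suc j) * (\<integral>\<^sup>+\<omega>. indicator B \<omega> * ennreal ((1 + (norm (U (Suc j) \<omega>))\<^sup>2) powr (r / 2)) \<partial>M)"
      by (intro nn_integral_cmult) measurable
    also have "\<dots> \<le> ennreal (1 / e ^ Suc j) * (\<integral>\<^sup>+\<omega>. indicator B \<omega> * ennreal (e * (1 + (norm (U j \<omega>))\<^sup>2) powr (r / 2)) \<partial>M)"
      using step_moment[OF j B] unfolding e_def by (intro mult_left_mono) auto
    also have "\<dots> = (\<integral>\<^sup>+\<omega>. ennreal (1 / e ^ Suc j) * (indicator B \<omega> * ennreal (e * (1 + (norm (U j \<omega>))\<^sup>2) powr (r / 2))) \<partial>M)"
      by (intro nn_integral_cmult[symmetric]) measurable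
    also have "\<dots> = (\<integral>\<^sup>+\<omega>. indicator B \<omega> * ennreal (Z j \<omega>) \<partial>M)"
      using e by (intro nn_integral_cong) (auto simp: Z_def indicator_def ennreal_mult[symmetric])
    finally show "(\<integral>\<^sup>+\<omega>. indicator B \<omega> * ennreal (Z (Suc j) \<omega>) \<partial>M) \<le> (\<integral>\<^sup>+\<omega>. indicator B \<omega> * ennreal (Z j \<omega>) \<partial>M)" .
  qed (use ZF Zpos in auto)
  define X where "X \<omega> = Max ((\<lambda>j. Z j \<omega>) ` {..N})" for \<omega>
  have XM: "X \<in> borel_measurable M"
    unfolding X_def[abs_def] by (intro borel_measurable_Max) (auto intro!: FF_M[OF g_bounds] ZF)
  define V where "V \<omega> = ennreal (exp (cc * T * p)) * ennreal (X \<omega> powr p)" for \<omega>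
  have eN: "e ^ j \<le> exp (cc * T)" if "j \<le> N" for j
  proof -
    have "e ^ j \<le> e ^ N" using e that by (intro power_increasing) auto
    also have "\<dots> \<le> exp (cc * k) ^ N" using e exp_ge_add_one_self[of "cc * k"] by (intro power_mono) (auto simp: e_def)
    also have "\<dots> = exp (real N * (cc * k))" by (simp add: exp_of_nat_mult)
    also have "real N * (cc * k) = cc * T" using k(3) by (simp add: mult.left_commute)
    finally show ?thesis .
  qed
  have bound: "ennreal (norm (U j \<omega>) powr q) \<le> V \<omega>" if j: "j \<le> N" for j \<omega>
  proof -
    have "norm (U j \<omega>) powr q = ((norm (U j \<omega>))\<^sup>2) powr (q / 2)"
    proof -
      have "(norm (U j \<omega>))\<^sup>2 = norm (U j \<omega>) powr 2" by simp
      then show ?thesis by (simp only: powr_powr) simp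
    qed
    also have "\<dots> \<le> (1 + (norm (U j \<omega>))\<^sup>2) powr (q / 2)" using q by (intro powr_mono2) auto
    also have "\<dots> = ((1 + (norm (U j \<omega>))\<^sup>2) powr (r / 2)) powr p" using r q by (simp add: powr_powr p_def)
    also have "(1 + (norm (U j \<omega>))\<^sup>2) powr (r / 2) = e ^ j * Z j \<omega>" using e by (simp add: Z_def)
    also have "(e ^ j * Z j \<omega>) powr p \<le> (exp (cc * T) * X \<omega>) powr p"
    proof (rule powr_mono2)
      have "Z j \<omega> \<le> X \<omega>" unfolding X_def using j by (intro Max_ge) auto
      then show "e ^ j * Z j \<omega> \<le> exp (cc * T) * X \<omega>" using eN[OF j] Zpos[of j \<omega>] by (intro mult_mono) auto
    qed (use p e Zpos[of j \<omega>] in auto)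
    also have "\<dots> = exp (cc * T * p) * X \<omega> powr p"
      by (simp add: powr_mult exp_powr_real)
    finally show ?thesis unfolding V_def by (subst ennreal_mult[symmetric]) (auto intro!: ennreal_leI)
  qed
  have "(\<integral>\<^sup>+\<omega>. V \<omega> \<partial>M) = ennreal (exp (cc * T * p)) * (\<integral>\<^sup>+\<omega>. ennreal (X \<omega> powr p) \<partial>M)"
    unfolding V_def using XM by (intro nn_integral_cmult) measurable
  also have "\<dots> \<le> ennreal (exp (cc * T * p)) * (ennreal (1 / (1 - p)) * (\<integral>\<^sup>+\<omega>. ennreal (Z 0 \<omega> powr p) \<partial>M))"
    using max unfolding X_def by (intro mult_left_mono) auto
  also have "\<dots> \<le> ennreal (exp (cc * T * p)) * (ennreal (1 / (1 - p)) * (ennreal (2 powr (q / 2)) * (1 + (\<integral>\<^sup>+\<omega>. ennreal (norm (u0 \<omega>) powr q) \<partial>M))))"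
  proof (intro mult_left_mono)
    have u0M[measurable]: "u0 \<in> borel_measurable M" using FF_M[OF _ u0] T_pos by simp
    have "AE \<omega> in M. ennreal (Z 0 \<omega> powr p) \<le> ennreal (2 powr (q / 2)) * (1 + ennreal (norm (u0 \<omega>) powr q))"
      using U_0
    proof eventually_elim
      case (elim \<omega>)
      have "Z 0 \<omega> powr p = (1 + (norm (u0 \<omega>))\<^sup>2) powr (q / 2)" using r q elim by (simp add: Z_def powr_powr p_def)
      also have "\<dots> \<le> 2 powr (q / 2) * (1 + norm (u0 \<omega>) powr q)" using q by (intro one_plus_square_powr_le) auto
      finally have "ennreal (Z 0 \<omega> powr p) \<le> ennreal (2 powr (q / 2) * (1 + norm (u0 \<omega>) powr q))" by (rule ennreal_leI)
      then show ?case by (simp add: ennreal_mult)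
    qed
    then have "(\<integral>\<^sup>+\<omega>. ennreal (Z 0 \<omega> powr p) \<partial>M) \<le> (\<integral>\<^sup>+\<omega>. ennreal (2 powr (q / 2)) * (1 + ennreal (norm (u0 \<omega>) powr q)) \<partial>M)"
      by (rule nn_integral_mono_AE)
    also have "\<dots> = ennreal (2 powr (q / 2)) * (1 + (\<integral>\<^sup>+\<omega>. ennreal (norm (u0 \<omega>) powr q) \<partial>M))"
      by (simp add: nn_integral_cmult nn_integral_add emeasure_space_1)
    finally show "(\<integral>\<^sup>+\<omega>. ennreal (Z 0 \<omega> powr p) \<partial>M) \<le> ennreal (2 powr (q / 2)) * (1 + (\<integral>\<^sup>+\<omega>. ennreal (norm (u0 \<omega>) powr q) \<partial>M))" .
  qed auto
  also have "\<dots> = ennreal max_const * (1 + (\<integral>\<^sup>+\<omega>. ennreal (norm (u0 \<omega>) powr q) \<partial>M))"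
    using p unfolding max_const_def p_def[symmetric] by (simp add: ennreal_mult mult.assoc del: times_divide_eq_right times_divide_eq_left)
  finally show ?thesis using XM by (intro that[of V]) (auto simp: V_def[abs_def] bound[unfolded V_def])
qed

text \<open>The moment bound for the noise series gives the increments of \<open>X\<close> the power
  \<open>(t - s) ^ m\<close> that chaining asks for. Over the whole step this becomes
  \<open>(k * L^2) ^ m\<close>, which is of order \<open>k\<close>.\<close>

lemma integral_sup_bound:
  assumes j: "j < N" and ito: "ito_integral M FF W I h (g j) (g (Suc j)) (\<lambda>_ \<omega>. R j \<omega>) X"
  obtains Y where "Y \<in> borel_measurable M" "AE \<omega> in M. \<forall>t\<in>{g j..g (Suc j)}. ennreal (norm (X t \<omega>) ^ (2 * m)) \<le> Y \<omega>"
    "(\<integral>\<^sup>+\<omega>. Y \<omega> \<partial>M) \<le> ennreal (chain_const m * gauss_moment m * step_power_const T m * k)"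
proof -
  have UF[measurable]: "U j \<in> borel_measurable (FF (g j))" using U_adapted j by simp
  have gb: "0 \<le> g j" "g (Suc j) \<le> T" "g j < g (Suc j)" using g_bounds[of j] g_bounds[of "Suc j"] j k g_Suc[of j] by auto
  have XF: "X t \<in> borel_measurable (FF t)" if "t \<in> {g j..g (Suc j)}" for t
    using ito that by (simp add: ito_integral_def)
  have XM: "X t \<in> borel_measurable M" if "t \<in> {g j..g (Suc j)}" for t
    by (rule FF_M[OF _ XF[OF that]]) (use gb that in auto)
  have Rm: "(\<lambda>\<omega>. R j \<omega> (h i)) \<in> borel_measurable (FF (g j))" if "i \<in> I" for i
  proof -
    note [measurable] = G_eval[OF that]
    show ?thesis by measurable
  qed
  have incr: "(\<integral>\<^sup>+\<omega>. ennreal (norm (X t \<omega> - X s \<omega>) ^ (2 * m)) \<partial>M) \<le> ennreal (gauss_moment m * (L\<^sup>2) ^ m * (t - s) ^ m)"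
    if st: "g j \<le> s" "s \<le> t" "t \<le> g (Suc j)" for s t
  proof -
    have [measurable]: "X t \<in> borel_measurable M" "X s \<in> borel_measurable M" using XM st by auto
    have "(\<lambda>n. \<integral>\<^sup>+\<omega>. ennreal ((norm (X t \<omega> - X s \<omega> - wsum s t (I \<inter> {..<n}) h (\<lambda>i \<omega>. R j \<omega> (h i)) \<omega>))\<^sup>2) \<partial>M) \<longlonglongrightarrow> 0"
      by (rule ito_constant_increment[OF onb gb(1,2) R_ops Rm _ ito st, where L=L]) (use stop_bounds in \<open>auto simp: R_norm\<close>)
    then interpret Z: adapted_increment M T FF W s t I h "\<lambda>i \<omega>. R j \<omega> (h i)" "\<gamma> j" L "\<lambda>\<omega>. X t \<omega> - X s \<omega>"
      by (intro adapted[OF UF j st]) auto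
    have sp: "space (FF s) = space M" using FF_subalgebra[OF Z.s_in] by (simp add: subalgebra_def)
    have "(\<integral>\<^sup>+\<omega>. ennreal (norm (X t \<omega> - X s \<omega>) ^ (2 * m)) \<partial>M) = (\<integral>\<^sup>+\<omega>. indicator (space (FF s)) \<omega> * ennreal (norm (X t \<omega> - X s \<omega>) ^ (2 * m)) \<partial>M)"
      by (intro nn_integral_cong) (simp add: sp)
    also have "\<dots> \<le> (\<integral>\<^sup>+\<omega>. indicator (space (FF s)) \<omega> * ennreal (gauss_moment m * ((t - s) * L\<^sup>2) ^ m) \<partial>M)"
      using m by (intro Z.increment_moment) auto
    also have "\<dots> = (\<integral>\<^sup>+\<omega>. ennreal (gauss_moment m * ((t - s) * L\<^sup>2) ^ m) \<partial>M)"
      by (intro nn_integral_cong) (simp add: sp)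
    also have "\<dots> = ennreal (gauss_moment m * (L\<^sup>2) ^ m * (t - s) ^ m)"
      by (simp add: emeasure_space_1 power_mult_distrib mult_ac)
    finally show ?thesis .
  qed
  obtain Y where Y: "Y \<in> borel_measurable M" "AE \<omega> in M. \<forall>t\<in>{g j..g (Suc j)}. ennreal (norm (X t \<omega>) ^ (2 * m)) \<le> Y \<omega>"
    "(\<integral>\<^sup>+\<omega>. Y \<omega> \<partial>M) \<le> ennreal (chain_const m * (gauss_moment m * (L\<^sup>2) ^ m * (g (Suc j) - g j) ^ m))"
  proof (rule chaining[OF m(1) gb(3) _ XM _ _ incr])
    show "0 \<le> gauss_moment m * (L\<^sup>2) ^ m" using gauss_moment_nonneg by simp
    show "AE \<omega> in M. continuous_on {g j..g (Suc j)} (\<lambda>t. X t \<omega>)" using ito by (simp add: ito_integral_def)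
    show "AE \<omega> in M. X (g j) \<omega> = 0"
    proof -
      have [measurable]: "X (g j) \<in> borel_measurable M" using XM gb by simp
      obtain es :: "nat \<Rightarrow> ('w, 'h, 'y) step_process" where es: "\<And>n. adapted_step FF (g j) (g (Suc j)) (es n)"
        and lim: "\<And>t. t \<in> {g j..g (Suc j)} \<Longrightarrow> (\<lambda>n. \<integral>\<^sup>+\<omega>. ennreal ((norm (X t \<omega> - step_integral W (es n) t \<omega>))\<^sup>2) \<partial>M) \<longlonglongrightarrow> 0"
        using ito unfolding ito_integral_def by blast
      \<comment> \<open>At the left end point both times of every term are clamped to
        \<open>g j\<close>, so all approximating integrals vanish there and so does their
        limit.\<close>
      have "step_integral W (es n) (g j) \<omega> = 0" for n \<omega>
      proof -
        have "(\<lambda>(r, s, A, v, x). (indicator A \<omega> * (BM_at W (min s (g j)) v \<omega> - BM_at W (min r (g j)) v \<omega>)) *\<^sub>R x) e = 0"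
          if "e \<in> set (es n)" for e
          using es[of n] that unfolding adapted_step_def by (auto simp: min_def split: prod.splits)
        then have "map (\<lambda>(r, s, A, v, x). (indicator A \<omega> * (BM_at W (min s (g j)) v \<omega> - BM_at W (min r (g j)) v \<omega>)) *\<^sub>R x) (es n) = map (\<lambda>_. 0) (es n)"
          by (intro map_cong refl)
        from arg_cong[OF this, of sum_list] show ?thesis unfolding step_integral_def by (simp only: sum_list_0)
      qed
      then have "(\<lambda>n::nat. \<integral>\<^sup>+\<omega>. ennreal ((norm (X (g j) \<omega>))\<^sup>2) \<partial>M) \<longlonglongrightarrow> 0" using lim[of "g j"] gb by simp
      then have "(\<integral>\<^sup>+\<omega>. ennreal ((norm (X (g j) \<omega>))\<^sup>2) \<partial>M) = 0" by (simp add: LIMSEQ_const_iff)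
      then have "AE \<omega> in M. ennreal ((norm (X (g j) \<omega>))\<^sup>2) = 0" by (subst (asm) nn_integral_0_iff_AE) auto
      then show ?thesis by eventually_elim (simp add: ennreal_eq_0_iff)
    qed
  qed
  note Y(3)
  also have "chain_const m * (gauss_moment m * (L\<^sup>2) ^ m * (g (Suc j) - g j) ^ m) = chain_const m * gauss_moment m * (k * L\<^sup>2) ^ m"
    by (simp add: g_Suc power_mult_distrib mult_ac)
  also have "ennreal \<dots> \<le> ennreal (chain_const m * gauss_moment m * (step_power_const T m * k))"
    using step_size_bounds(2)[OF k(1,2) \<theta> m(1)] chain_const_nonneg[OF m(1)] gauss_moment_nonneg
    unfolding L_def by (intro ennreal_leI mult_left_mono) auto
  finally show ?thesis using that[OF Y(1,2)] by (simp add: mult.assoc)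
qed

end

section \<open>From the grid points to all times\<close>

context euler_scheme
begin

text \<open>The summand 1 does not stem from the drift: it pays for bounding the \<open>q\<close>-th
  power of the stochastic integral by \<open>1 + x ^ (2 * m)\<close>.\<close>

definition drift_const :: real where
  "drift_const = sqrt (T * (step_const T * sqrt T)) powr q + 1"

text \<open>The bounds of order \<open>k\<close>, one for each of the \<open>N\<close> steps, add up
  through \<open>N * k = T\<close>.\<close>

definition integral_const :: real where
  "integral_const = chain_const m * gauss_moment m * step_power_const T m * T"

definition total_const :: real where
  "total_const = 3 powr q * (max_const + drift_const + integral_const)"

lemma const_nonneg: "0 \<le> drift_const" "0 \<le> integral_const" "0 \<le> total_const"
proof -
  show "0 \<le> drift_const" by (simp add: drift_const_def)
  moreover show "0 \<le> integral_const"
    using chain_const_nonneg[OF m(1)] gauss_moment_nonneg step_power_const_nonneg T_pos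
    by (simp add: integral_const_def)
  ultimately show "0 \<le> total_const" using max_const_nonneg by (simp add: total_const_def)
qed

lemma drift_bound: "k * L \<le> sqrt (T * (step_const T * sqrt T))"
proof (rule real_le_rsqrt)
  have "(k * L)\<^sup>2 = k * (k * L\<^sup>2)" by (simp add: power2_eq_square)
  also have "\<dots> \<le> T * (step_const T * sqrt T)"
    by (rule mult_mono[OF k(2) step_size_bounds(1)[OF k(1,2) \<theta>, folded L_def]]) (use k T_pos in auto)
  finally show "(k * L)\<^sup>2 \<le> T * (step_const T * sqrt T)" .
qed

text \<open>Contractivity controls the moving vector uniformly in time, strong continuity the moving
  time.\<close>

lemma S_tendsto:
  assumes \<tau>: "\<tau> \<longlonglongrightarrow> t" "\<And>n. 0 \<le> \<tau> n" "0 \<le> t" and v: "v \<longlonglongrightarrow> w"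
  shows "(\<lambda>n. S (\<tau> n) (v n)) \<longlonglongrightarrow> S t w"
proof -
  have "(\<lambda>n. S (\<tau> n) (v n - w)) \<longlonglongrightarrow> 0"
  proof (rule Lim_null_comparison)
    show "\<forall>\<^sub>F n in sequentially. norm (S (\<tau> n) (v n - w)) \<le> norm (v n - w)"
      using S_contr \<tau> by (intro always_eventually) auto
    show "(\<lambda>n. norm (v n - w)) \<longlonglongrightarrow> 0" using v by (simp add: tendsto_norm_zero LIM_zero)
  qed
  moreover have "(\<lambda>n. S (\<tau> n) w) \<longlonglongrightarrow> S t w"
    by (rule continuous_on_tendsto_compose[OF S_cont \<tau>(1)]) (use \<tau> in auto)
  ultimately have "(\<lambda>n. S (\<tau> n) (v n - w) + S (\<tau> n) w) \<longlonglongrightarrow> 0 + S t w" by (rule tendsto_add)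
  moreover have "S (\<tau> n) (v n - w) + S (\<tau> n) w = S (\<tau> n) (v n)" for n
  proof -
    interpret bounded_linear "S (\<tau> n)" using S_linear \<tau> by simp
    show ?thesis by (simp add: diff)
  qed
  ultimately show ?thesis by simp
qed

lemma scheme_bounds:
  assumes fin: "Lq_norm M q (\<lambda>\<omega>. ennreal (norm (u0 \<omega>))) < \<infinity>"
    and pc: "piecewise_constant_extension M T N U Uk"
    and ce: "continuous_extension M FF W I h S F G \<theta> T N U Uhat"
  defines "B0 \<equiv> ennreal (total_const powr (1 / q)) * (1 + Lq_norm M q (\<lambda>\<omega>. ennreal (norm (u0 \<omega>))))"
  shows "Lq_norm M q (\<lambda>\<omega>. SUP t\<in>{0..T}. ennreal (norm (Uhat t \<omega>))) \<le> B0"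
    and "Lq_norm M q (\<lambda>\<omega>. ennreal (Max ((\<lambda>j. norm (U j \<omega>)) ` {0..N}))) \<le> B0"
    and "Lq_norm M q (\<lambda>\<omega>. SUP t\<in>{0..T}. ennreal (norm (Uk t \<omega>))) \<le> B0"
proof -
  define E where "E = (\<integral>\<^sup>+\<omega>. ennreal (norm (u0 \<omega>) powr q) \<partial>M)"
  have E: "(\<integral>\<^sup>+\<omega>. ennreal_powr (ennreal (norm (u0 \<omega>))) q \<partial>M) = E" by (simp add: E_def ennreal_powr_ennreal)
  obtain X where X: "\<And>j. j < N \<Longrightarrow> ito_integral M FF W I h (g j) (g (Suc j)) (\<lambda>_ \<omega>. R j \<omega>) (X j)"
    and UT: "\<And>\<omega>. \<omega> \<in> space M \<Longrightarrow> Uhat T \<omega> = U N \<omega>"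
    and Ut: "\<And>\<omega> j t. \<omega> \<in> space M \<Longrightarrow> j < N \<Longrightarrow> t \<in> {g j..<g (Suc j)} \<Longrightarrow>
       Uhat t \<omega> = S (t - g j) (U j \<omega> + (t - g j) *\<^sub>R f j \<omega> + X j t \<omega>)"
    using ce unfolding continuous_extension_def Let_def k_def[symmetric] by blast
  have "\<forall>j\<in>{..<N}. \<exists>Y. Y \<in> borel_measurable M \<and> (AE \<omega> in M. \<forall>t\<in>{g j..g (Suc j)}. ennreal (norm (X j t \<omega>) ^ (2 * m)) \<le> Y \<omega>) \<and>
    (\<integral>\<^sup>+\<omega>. Y \<omega> \<partial>M) \<le> ennreal (chain_const m * gauss_moment m * step_power_const T m * k)"
    by (intro ballI) (rule integral_sup_bound[OF _ X], auto)
  from bchoice[OF this] obtain Y where Y: "\<And>j. j < N \<Longrightarrow> Y j \<in> borel_measurable M"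
    "\<And>j. j < N \<Longrightarrow> AE \<omega> in M. \<forall>t\<in>{g j..g (Suc j)}. ennreal (norm (X j t \<omega>) ^ (2 * m)) \<le> Y j \<omega>"
    "\<And>j. j < N \<Longrightarrow> (\<integral>\<^sup>+\<omega>. Y j \<omega> \<partial>M) \<le> ennreal (chain_const m * gauss_moment m * step_power_const T m * k)"
    by auto
  obtain V where V: "V \<in> borel_measurable M" "\<And>j \<omega>. j \<le> N \<Longrightarrow> ennreal (norm (U j \<omega>) powr q) \<le> V \<omega>"
    "(\<integral>\<^sup>+\<omega>. V \<omega> \<partial>M) \<le> ennreal max_const * (1 + E)"
    using maximal_bound unfolding E_def by blast
  \<comment> \<open>One majorant for all three quantities. The maximum of the stochastic integrals
    over the steps is replaced by the sum of all \<open>Y j\<close>, whose expectation stays bounded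
    because each term is of order \<open>k\<close>.\<close>
  define B where "B \<omega> = ennreal (3 powr q) * (V \<omega> + ennreal drift_const + (\<Sum>j<N. Y j \<omega>))" for \<omega>
  have VB: "V \<omega> \<le> B \<omega>" for \<omega>
  proof -
    have "(1::real) \<le> 3 powr q" using q by (intro ge_one_powr_ge_zero) auto
    then have "1 * V \<omega> \<le> ennreal (3 powr q) * (V \<omega> + (ennreal drift_const + (\<Sum>j<N. Y j \<omega>)))"
      by (intro mult_mono) auto
    then show ?thesis by (simp add: B_def add.assoc)
  qed
  have B: "(\<integral>\<^sup>+\<omega>. B \<omega> \<partial>M) \<le> ennreal total_const * (1 + E)"
  proof -
    have sumY: "(\<Sum>j<N. \<integral>\<^sup>+\<omega>. Y j \<omega> \<partial>M) \<le> ennreal integral_const"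
    proof -
      have "(\<Sum>j<N. \<integral>\<^sup>+\<omega>. Y j \<omega> \<partial>M) \<le> (\<Sum>j<N. ennreal (chain_const m * gauss_moment m * step_power_const T m * k))"
        using Y(3) by (intro sum_mono) auto
      also have "\<dots> = ennreal (\<Sum>j<N. chain_const m * gauss_moment m * step_power_const T m * k)"
        using chain_const_nonneg[OF m(1)] gauss_moment_nonneg step_power_const_nonneg T_pos k by (intro sum_ennreal) simp
      also have "(\<Sum>j<N. chain_const m * gauss_moment m * step_power_const T m * k) =
        chain_const m * gauss_moment m * step_power_const T m * (real N * k)" by simp
      finally show ?thesis unfolding k(3) integral_const_def .
    qed
    have "(\<integral>\<^sup>+\<omega>. B \<omega> \<partial>M) = ennreal (3 powr q) * ((\<integral>\<^sup>+\<omega>. V \<omega> \<partial>M) + ennreal drift_const + (\<Sum>j<N. \<integral>\<^sup>+\<omega>. Y j \<omega> \<partial>M))"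
    proof -
      note [measurable] = V(1)
      have [measurable]: "(\<lambda>\<omega>. \<Sum>j<N. Y j \<omega>) \<in> borel_measurable M" using Y(1) by (intro borel_measurable_sum) auto
      have "(\<integral>\<^sup>+\<omega>. (\<Sum>j<N. Y j \<omega>) \<partial>M) = (\<Sum>j<N. \<integral>\<^sup>+\<omega>. Y j \<omega> \<partial>M)" using Y(1) by (intro nn_integral_sum) auto
      then show ?thesis unfolding B_def by (simp add: nn_integral_cmult nn_integral_add emeasure_space_1)
    qed
    also have "\<dots> \<le> ennreal (3 powr q) * (ennreal max_const * (1 + E) + ennreal drift_const * (1 + E) + ennreal integral_const * (1 + E))"
    proof (intro mult_left_mono add_mono V(3))
      have "ennreal drift_const * 1 \<le> ennreal drift_const * (1 + E)" by (intro mult_left_mono) auto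
      then show "ennreal drift_const \<le> ennreal drift_const * (1 + E)" by simp
      have "ennreal integral_const * 1 \<le> ennreal integral_const * (1 + E)" by (intro mult_left_mono) auto
      then show "(\<Sum>j<N. \<integral>\<^sup>+\<omega>. Y j \<omega> \<partial>M) \<le> ennreal integral_const * (1 + E)" using sumY by simp
    qed auto
    also have "\<dots> = ennreal total_const * (1 + E)"
      unfolding total_const_def using const_nonneg max_const_nonneg
      by (simp add: ennreal_mult distrib_right[symmetric] mult.assoc)
    finally show ?thesis .
  qed
  note Lq = Lq_norm_le[where q=q and c=total_const and B=B and ?Z0.0="\<lambda>\<omega>. ennreal (norm (u0 \<omega>))" and M=M, OF _ const_nonneg(3) _ _ _ fin, unfolded E, folded B0_def]
  have q1: "1 \<le> q" "0 < q" using q by auto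
  show Umax: "Lq_norm M q (\<lambda>\<omega>. ennreal (Max ((\<lambda>j. norm (U j \<omega>)) ` {0..N}))) \<le> B0"
  proof (rule Lq[OF q1(1) _ _ B])
    show "(\<lambda>\<omega>. ennreal (Max ((\<lambda>j. norm (U j \<omega>)) ` {0..N}))) \<in> borel_measurable M"
      by (intro measurable_compose[OF borel_measurable_Max measurable_ennreal]) auto
    show "AE \<omega> in M. ennreal_powr (ennreal (Max ((\<lambda>j. norm (U j \<omega>)) ` {0..N}))) q \<le> B \<omega>"
    proof (rule AE_I2)
      fix \<omega>
      have "Max ((\<lambda>j. norm (U j \<omega>)) ` {0..N}) \<in> (\<lambda>j. norm (U j \<omega>)) ` {0..N}" by (intro Max_in) auto
      then obtain j where "Max ((\<lambda>j. norm (U j \<omega>)) ` {0..N}) = norm (U j \<omega>)" "j \<in> {0..N}" by (rule imageE)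
      then show "ennreal_powr (ennreal (Max ((\<lambda>j. norm (U j \<omega>)) ` {0..N}))) q \<le> B \<omega>"
        using V(2) VB order_trans by (fastforce simp: ennreal_powr_ennreal)
    qed
  qed
  \<comment> \<open>The piecewise constant process takes exactly the values \<open>U j\<close>, so
    its supremum is the maximum already bounded.\<close>
  have Uk_eq: "(SUP t\<in>{0..T}. ennreal (norm (Uk t \<omega>))) = ennreal (Max ((\<lambda>j. norm (U j \<omega>)) ` {0..N}))" if \<omega>: "\<omega> \<in> space M" for \<omega>
  proof (rule antisym)
    have UkT: "Uk T \<omega> = U N \<omega>" and Ukt: "\<And>j t. j < N \<Longrightarrow> t \<in> {g j..<g (Suc j)} \<Longrightarrow> Uk t \<omega> = U j \<omega>"
      using pc \<omega> unfolding piecewise_constant_extension_def by blast+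
    have "\<exists>j\<le>N. Uk t \<omega> = U j \<omega>" if t: "t \<in> {0..T}" for t
    proof (cases "t = T")
      case False
      then obtain j where "j < N" "t \<in> {g j..<g (Suc j)}" using grid_cover[OF T_pos N, of t] t by auto
      then show ?thesis using Ukt by (auto intro!: exI[of _ j])
    qed (use UkT in auto)
    then show "(SUP t\<in>{0..T}. ennreal (norm (Uk t \<omega>))) \<le> ennreal (Max ((\<lambda>j. norm (U j \<omega>)) ` {0..N}))"
      by (intro SUP_least ennreal_leI) (metis Max_ge finite_atLeastAtMost finite_imageI atLeastAtMost_iff imageI zero_le)
    have "\<exists>t\<in>{0..T}. Uk t \<omega> = U j \<omega>" if j: "j \<le> N" for j
    proof (cases "j = N")
      case True then show ?thesis using UkT T_pos by (intro bexI[of _ T]) auto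
    next
      case False
      then have "j < N" using j by simp
      then show ?thesis using Ukt[of j "g j"] g_Suc[of j] k g_bounds[OF j] by (intro bexI[of _ "g j"]) auto
    qed
    moreover have "Max ((\<lambda>j. norm (U j \<omega>)) ` {0..N}) \<in> (\<lambda>j. norm (U j \<omega>)) ` {0..N}" by (intro Max_in) auto
    ultimately obtain t where "t \<in> {0..T}" "Max ((\<lambda>j. norm (U j \<omega>)) ` {0..N}) = norm (Uk t \<omega>)" by fastforce
    then show "ennreal (Max ((\<lambda>j. norm (U j \<omega>)) ` {0..N})) \<le> (SUP t\<in>{0..T}. ennreal (norm (Uk t \<omega>)))"
      by (auto intro: SUP_upper2)
  qed
  have "Lq_norm M q (\<lambda>\<omega>. SUP t\<in>{0..T}. ennreal (norm (Uk t \<omega>))) = Lq_norm M q (\<lambda>\<omega>. ennreal (Max ((\<lambda>j. norm (U j \<omega>)) ` {0..N})))"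
    unfolding Lq_norm_def using Uk_eq by (simp cong: measurable_cong nn_integral_cong)
  then show "Lq_norm M q (\<lambda>\<omega>. SUP t\<in>{0..T}. ennreal (norm (Uk t \<omega>))) \<le> B0" using Umax by simp
  have good: "AE \<omega> in M. \<forall>j\<in>{..<N}. (\<forall>t\<in>{g j..g (Suc j)}. ennreal (norm (X j t \<omega>) ^ (2 * m)) \<le> Y j \<omega>) \<and>
     continuous_on {g j..g (Suc j)} (\<lambda>t. X j t \<omega>)"
  proof (rule AE_finite_allI)
    fix j assume "j \<in> {..<N}"
    then show "AE \<omega> in M. (\<forall>t\<in>{g j..g (Suc j)}. ennreal (norm (X j t \<omega>) ^ (2 * m)) \<le> Y j \<omega>) \<and>
     continuous_on {g j..g (Suc j)} (\<lambda>t. X j t \<omega>)"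
      using Y(2)[of j] X[of j] by (auto simp: ito_integral_def)
  qed simp
  show "Lq_norm M q (\<lambda>\<omega>. SUP t\<in>{0..T}. ennreal (norm (Uhat t \<omega>))) \<le> B0"
  proof (rule Lq[OF q1(1) _ _ B])
    show "AE \<omega> in M. ennreal_powr (SUP t\<in>{0..T}. ennreal (norm (Uhat t \<omega>))) q \<le> B \<omega>"
      using good AE_space
    proof eventually_elim
      case (elim \<omega>)
      show ?case
      proof (rule ennreal_powr_SUP_le[OF q1(2)])
        fix t assume t: "t \<in> {0..T}"
        show "ennreal (norm (Uhat t \<omega>) powr q) \<le> B \<omega>"
        proof (cases "t = T")
          case True
          then show ?thesis using UT[OF elim(2)] V(2)[of N \<omega>] VB[of \<omega>] by (auto intro: order_trans)
        next
          case False
          then obtain j where j: "j < N" "t \<in> {g j..<g (Suc j)}" using grid_cover[OF T_pos N, of t] t by auto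
          let ?\<kappa> = "sqrt (T * (step_const T * sqrt T))"
          have tj: "0 \<le> t - g j" "t - g j \<le> k" using j(2) g_Suc by auto
          have "norm (Uhat t \<omega>) \<le> norm (U j \<omega> + (t - g j) *\<^sub>R f j \<omega> + X j t \<omega>)"
            unfolding Ut[OF elim(2) j] by (rule S_contr[OF tj(1)])
          also have "\<dots> \<le> norm (U j \<omega>) + norm ((t - g j) *\<^sub>R f j \<omega>) + norm (X j t \<omega>)"
            by (intro order_trans[OF norm_triangle_ineq] add_right_mono norm_triangle_ineq)
          also have "norm ((t - g j) *\<^sub>R f j \<omega>) \<le> ?\<kappa>"
          proof -
            have "norm ((t - g j) *\<^sub>R f j \<omega>) = (t - g j) * norm (f j \<omega>)"
              by (simp only: norm_scaleR abs_of_nonneg[OF tj(1)])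
            also have "\<dots> \<le> k * L" using tj stop_bounds(1) by (intro mult_mono) auto
            finally show ?thesis using drift_bound by simp
          qed
          finally have "norm (Uhat t \<omega>) powr q \<le> (norm (U j \<omega>) + ?\<kappa> + norm (X j t \<omega>)) powr q"
            using q by (intro powr_mono2) auto
          also have "\<dots> \<le> 3 powr q * (norm (U j \<omega>) powr q + ?\<kappa> powr q + norm (X j t \<omega>) powr q)"
            using q T_pos step_const_nonneg by (intro powr_sum3_le) auto
          also have "norm (X j t \<omega>) powr q \<le> 1 + norm (X j t \<omega>) ^ (2 * m)"
            using m q by (intro powr_le_one_plus_power) auto
          finally have "norm (Uhat t \<omega>) powr q \<le> 3 powr q * (norm (U j \<omega>) powr q + drift_const + norm (X j t \<omega>) ^ (2 * m))"
            by (simp add: drift_const_def mult_left_mono add_ac)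
          then have "ennreal (norm (Uhat t \<omega>) powr q) \<le> ennreal (3 powr q * (norm (U j \<omega>) powr q + drift_const + norm (X j t \<omega>) ^ (2 * m)))"
            by (rule ennreal_leI)
          also have "\<dots> = ennreal (3 powr q) * (ennreal (norm (U j \<omega>) powr q) + ennreal drift_const + ennreal (norm (X j t \<omega>) ^ (2 * m)))"
            using const_nonneg by (simp add: ennreal_mult)
          also have "\<dots> \<le> B \<omega>"
            unfolding B_def
          proof (intro mult_left_mono add_mono order_refl)
            show "ennreal (norm (U j \<omega>) powr q) \<le> V \<omega>" using V(2) j by simp
            have "ennreal (norm (X j t \<omega>) ^ (2 * m)) \<le> Y j \<omega>" using elim(1) j by auto
            also have "\<dots> \<le> (\<Sum>j<N. Y j \<omega>)" using j by (intro member_le_sum) auto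
            finally show "ennreal (norm (X j t \<omega>) ^ (2 * m)) \<le> (\<Sum>j<N. Y j \<omega>)" .
          qed auto
          finally show ?thesis .
        qed
      qed simp
    qed
    \<comment> \<open>Rational times suffice by right continuity inside each grid interval;
      \<open>T\<close> is added because it lies in none of the half-open intervals.\<close>
    define Q where "Q = {t \<in> {0..T}. t \<in> \<rat>} \<union> {T}"
    have Q: "countable Q" "Q \<subseteq> {0..T}" "T \<in> Q" using T_pos unfolding Q_def
      by (auto intro!: countable_subset[OF _ countable_rat])
    have Uhm: "Uhat t \<in> borel_measurable M" if t: "t \<in> {0..T}" for t
    proof (cases "t = T")
      case True
      have "Uhat T \<in> borel_measurable M \<longleftrightarrow> U N \<in> borel_measurable M" using UT by (intro measurable_cong) auto
      then show ?thesis using U_M True by simp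
    next
      case False
      then obtain j where j: "j < N" "t \<in> {g j..<g (Suc j)}" using grid_cover[OF T_pos N, of t] t by auto
      have [measurable]: "U j \<in> borel_measurable M" using j by simp
      have "X j t \<in> borel_measurable (FF t)" using X[OF j(1)] j(2) by (simp add: ito_integral_def)
      then have [measurable]: "X j t \<in> borel_measurable M" by (rule FF_M[OF t])
      have tj: "0 \<le> t - g j" using j by simp
      note [measurable] = F_meas S_measurable[OF tj]
      have "(\<lambda>\<omega>. S (t - g j) (U j \<omega> + (t - g j) *\<^sub>R f j \<omega> + X j t \<omega>)) \<in> borel_measurable M" by measurable
      then show ?thesis using Ut[OF _ j] by (subst measurable_cong) auto
    qed
    have m1: "(\<lambda>\<omega>. SUP t\<in>Q. ennreal (norm (Uhat t \<omega>))) \<in> borel_measurable M"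
    proof (rule borel_measurable_SUP[OF Q(1)])
      fix t assume "t \<in> Q"
      then have [measurable]: "Uhat t \<in> borel_measurable M" using Q(2) Uhm by auto
      show "(\<lambda>\<omega>. ennreal (norm (Uhat t \<omega>))) \<in> borel_measurable M" by measurable
    qed
    have m2: "AE \<omega> in M. (SUP t\<in>Q. ennreal (norm (Uhat t \<omega>))) = (SUP t\<in>{0..T}. ennreal (norm (Uhat t \<omega>)))"
      using good AE_space
    proof eventually_elim
      case (elim \<omega>)
      show ?case
      proof (rule antisym)
        show "(SUP t\<in>Q. ennreal (norm (Uhat t \<omega>))) \<le> (SUP t\<in>{0..T}. ennreal (norm (Uhat t \<omega>)))"
          by (rule SUP_subset_mono[OF Q(2)]) simp
        show "(SUP t\<in>{0..T}. ennreal (norm (Uhat t \<omega>))) \<le> (SUP t\<in>Q. ennreal (norm (Uhat t \<omega>)))"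
        proof (rule SUP_least)
          fix t assume t: "t \<in> {0..T}"
          show "ennreal (norm (Uhat t \<omega>)) \<le> (SUP t\<in>Q. ennreal (norm (Uhat t \<omega>)))"
          proof (cases "t = T")
            case True then show ?thesis using Q(3) by (auto intro: SUP_upper)
          next
            case False
            then obtain j where j: "j < N" "t \<in> {g j..<g (Suc j)}" using grid_cover[OF T_pos N, of t] t by auto
            \<comment> \<open>Approximation from the right and below the next grid point keeps all
              times in the interval where one formula for \<open>Uhat\<close> is valid.\<close>
            have "\<exists>s\<in>\<rat>. t < s \<and> s < min (g (Suc j)) (t + inverse (real (Suc n)))" for n
              using j by (intro Rats_dense_in_real) auto
            then obtain s where s: "\<And>n. s n \<in> \<rat>" "\<And>n. t < s n" "\<And>n. s n < min (g (Suc j)) (t + inverse (real (Suc n)))" by metis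
            have sT: "s n \<in> Q" for n
              using s(1,2)[of n] s(3)[of n] t g_bounds[of "Suc j"] j(1) by (auto simp: Q_def)
            have sj: "s n \<in> {g j..<g (Suc j)}" for n using s(2)[of n] s(3)[of n] j(2) by auto
            have lim: "s \<longlonglongrightarrow> t"
            proof (rule tendsto_sandwich[of "\<lambda>_. t" s sequentially "\<lambda>n. t + inverse (real (Suc n))"])
              show "(\<lambda>n. t + inverse (real (Suc n))) \<longlonglongrightarrow> t" by (rule LIMSEQ_inverse_real_of_nat_add)
            qed (use s(2,3) in \<open>auto intro!: always_eventually less_imp_le\<close>)
            have cX: "continuous_on {g j..g (Suc j)} (\<lambda>t. X j t \<omega>)" using elim(1) j by auto
            have "(\<lambda>n. X j (s n) \<omega>) \<longlonglongrightarrow> X j t \<omega>"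
              by (rule continuous_on_tendsto_compose[OF cX lim]) (use sj j in \<open>auto simp: less_imp_le\<close>)
            then have "(\<lambda>n. S (s n - g j) (U j \<omega> + (s n - g j) *\<^sub>R f j \<omega> + X j (s n) \<omega>)) \<longlonglongrightarrow>
              S (t - g j) (U j \<omega> + (t - g j) *\<^sub>R f j \<omega> + X j t \<omega>)"
              by (intro S_tendsto tendsto_intros lim) (use sj j in auto)
            then have "(\<lambda>n. Uhat (s n) \<omega>) \<longlonglongrightarrow> Uhat t \<omega>"
              unfolding Ut[OF elim(2) j] Ut[OF elim(2) j(1) sj] .
            then have conv: "(\<lambda>n. ennreal (norm (Uhat (s n) \<omega>))) \<longlonglongrightarrow> ennreal (norm (Uhat t \<omega>))"
              by (intro tendsto_ennrealI tendsto_norm)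
            have le: "ennreal (norm (Uhat (s n) \<omega>)) \<le> (SUP t\<in>Q. ennreal (norm (Uhat t \<omega>)))" for n
              by (rule SUP_upper2[OF sT order_refl])
            show ?thesis by (rule LIMSEQ_le_const2[OF conv]) (use le in blast)
          qed
        qed
      qed
    qed
    \<comment> \<open>The supremum over all times agrees almost surely with a countable one;
      completeness of \<open>M\<close> makes it measurable.\<close>
    have "complete_measure M" using usual by (simp add: usual_filtration_def)
    moreover have "subalgebra M M" by (simp add: subalgebra_def)
    moreover have "null_sets M \<subseteq> sets M" by auto
    ultimately show "(\<lambda>\<omega>. SUP t\<in>{0..T}. ennreal (norm (Uhat t \<omega>))) \<in> borel_measurable M"
      by (rule borel_measurable_complete_AE[OF _ _ _ m1 m2])
  qed
qed

end

theorem proposition6p5: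
  fixes q \<epsilon> Cq T :: real
  assumes "2 \<le> q" and "0 < \<epsilon>" and "0 \<le> Cq" and "0 < T"
  shows "\<exists>C\<ge>0. \<forall>(I :: nat set) (h :: nat \<Rightarrow> 'h::{real_inner,banach,second_countable_topology})
      (K :: complex set) sc ip D A S
      (F :: 'y::{real_inner,banach,second_countable_topology} \<Rightarrow> 'y) (G :: 'y \<Rightarrow> 'h \<Rightarrow> 'y)
      (M :: 'w measure) FF W \<theta> u0 N U Uk Uhat.
    orthonormal_basis I h \<longrightarrow>
    hilbert_over K sc ip \<longrightarrow>
    c0_contraction_semigroup K sc S \<longrightarrow>
    generates D (\<lambda>x. - A x) S \<longrightarrow>
    F \<in> borel_measurable borel \<longrightarrow>
    G \<in> borel \<rightarrow>\<^sub>M hs_borel I h \<longrightarrow>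
    (\<forall>x. Re (ip x (F x)) + (q + \<epsilon> - 1) / 2 * (hs_norm I h (G x))\<^sup>2 \<le> Cq * (1 + (norm x)\<^sup>2)) \<longrightarrow>
    prob_space M \<longrightarrow>
    usual_filtration M T FF \<longrightarrow>
    cylindrical_BM M T FF W \<longrightarrow>
    0 < \<theta> \<longrightarrow> \<theta> \<le> 1 / 4 \<longrightarrow>
    u0 \<in> borel_measurable (FF 0) \<longrightarrow>
    Lq_norm M q (\<lambda>\<omega>. ennreal (norm (u0 \<omega>))) < \<infinity> \<longrightarrow>
    1 \<le> N \<longrightarrow>
    stopped_exponential_euler M W I h S F G \<theta> T N u0 U \<longrightarrow>
    piecewise_constant_extension M T N U Uk \<longrightarrow>
    continuous_extension M FF W I h S F G \<theta> T N U Uhat \<longrightarrow>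
      Lq_norm M q (\<lambda>\<omega>. SUP t\<in>{0..T}. ennreal (norm (Uhat t \<omega>)))
        \<le> ennreal C * (1 + Lq_norm M q (\<lambda>\<omega>. ennreal (norm (u0 \<omega>)))) \<and>
      Lq_norm M q (\<lambda>\<omega>. ennreal (Max ((\<lambda>j. norm (U j \<omega>)) ` {0..N})))
        \<le> ennreal C * (1 + Lq_norm M q (\<lambda>\<omega>. ennreal (norm (u0 \<omega>)))) \<and>
      Lq_norm M q (\<lambda>\<omega>. SUP t\<in>{0..T}. ennreal (norm (Uk t \<omega>)))
        \<le> ennreal C * (1 + Lq_norm M q (\<lambda>\<omega>. ennreal (norm (u0 \<omega>))))"
proof -
  \<comment> \<open>Half of \<epsilon> raises the exponent. The quantity
    \<open>r * \<epsilon> / 8\<close> is spent twice, as the expansion error in \<open>a\<close> and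
    as \<open>a * d\<close> for Young's inequality. Then \<open>a * (1 + d)\<close> is exactly
    \<open>r\<close> times the factor \<open>(q + \<epsilon> - 1) / 2\<close> of the coercivity
    condition.\<close>
  define r where "r = q + \<epsilon> / 2"
  define a where "a = r * (r - 1) / 2 + r * \<epsilon> / 8"
  define d where "d = r * \<epsilon> / 8 / a"
  \<comment> \<open>Rounding up gives an even order \<open>2 * m\<close> above \<open>r\<close>, and
    \<open>r \<ge> 2\<close> provides the \<open>m \<ge> 2\<close> that chaining and the step-size
    bound require.\<close>
  define m where "m = nat \<lceil>r\<rceil>"
  have r: "2 \<le> r" "q \<le> r" and slack: "0 < r * \<epsilon> / 8" using assms by (auto simp: r_def)
  have a: "0 < a" unfolding a_def using r slack by (intro add_nonneg_pos) auto
  have d: "0 < d" using slack a by (simp add: d_def)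
  have rm: "r \<le> real m" using r by (simp add: m_def)
  have m: "2 \<le> m" "q \<le> real (2 * m)" "r \<le> 2 * real m" using rm r by linarith+
  have ad: "a * (1 + d) = (q + \<epsilon> / 2) * (q + \<epsilon> - 1) / 2"
  proof -
    have "a * (1 + d) = a + r * \<epsilon> / 8" using a by (simp add: d_def field_simps)
    also have "\<dots> = r * (r + \<epsilon> / 2 - 1) / 2" unfolding a_def by (simp add: field_simps)
    also have "r + \<epsilon> / 2 - 1 = q + \<epsilon> - 1" by (simp add: r_def)
    finally show ?thesis by (simp add: r_def)
  qed
  obtain C where C: "0 \<le> C"
    "\<And>x y :: 'y. (1 + (norm (x + y))\<^sup>2) powr (r / 2) \<le> (1 + (norm x)\<^sup>2) powr (r / 2 - 1) *
       (1 + (norm x)\<^sup>2 + r * (x \<bullet> y) + (r * (r - 1) / 2 + r * \<epsilon> / 8) * (norm y)\<^sup>2 + C * norm y ^ (2 * m))"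
    using norm_powr_expansion_upper[OF r(1) slack m(3), where 'a='y] by blast
  \<comment> \<open>All parameters of \<open>total_const\<close> are fixed before the operators, the
    probability space, \<theta> and \<open>N\<close> are introduced, which is the claimed
    uniformity.\<close>
  let ?K = "euler_scheme.total_const T q \<epsilon> Cq a d C m powr (1 / q)"
  show ?thesis
  proof (rule exI[of _ ?K], rule conjI, simp, intro allI impI, goal_cases)
    case (1 I h K sc ip D A S F G M FF W \<theta> u0 N U Uk Uhat)
    \<comment> \<open>Coercivity involves only the real part of the inner product, so real and
      complex scalars lead to the same estimates.\<close>
    have inner: "Re (ip x y) = x \<bullet> y" for x y using 1(2) unfolding hilbert_over_def by blast
    interpret prob_space M by (rule 1(8))
    interpret cylindrical_noise M T FF W using assms(4) 1(9,10) by unfold_locales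
    interpret euler_scheme M T FF W I h S F G \<theta> u0 N U q \<epsilon> Cq a d C m
    proof (intro euler_scheme.intro euler_scheme_axioms.intro cylindrical_noise_axioms)
      show "bounded_linear (S t)" if "0 \<le> t" for t
        using 1(3) that unfolding c0_contraction_semigroup_def by blast
      show "norm (S t x) \<le> norm x" if "0 \<le> t" for t x
        using 1(3) that unfolding c0_contraction_semigroup_def by blast
      show "continuous_on {0..} (\<lambda>t. S t x)" for x using 1(3) unfolding c0_contraction_semigroup_def by blast
      show "x \<bullet> F x + (q + \<epsilon> - 1) / 2 * (hs_norm I h (G x))\<^sup>2 \<le> Cq * (1 + (norm x)\<^sup>2)" for x
        using 1(7)[rule_format, of x] unfolding inner .
      show "(1 + (norm (x + y))\<^sup>2) powr ((q + \<epsilon> / 2) / 2) \<le> (1 + (norm x)\<^sup>2) powr ((q + \<epsilon> / 2) / 2 - 1) *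
         (1 + (norm x)\<^sup>2 + (q + \<epsilon> / 2) * (x \<bullet> y) + a * (norm y)\<^sup>2 + C * norm y ^ (2 * m))" for x y :: 'y
        using C(2)[of x y] unfolding a_def r_def .
    qed (use assms 1 a d C(1) ad m in auto)
    show ?case using scheme_bounds[OF 1(14,17,18)] by blast
  qed
qed

end
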